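(* Fix $0<\alpha\le1$ and an integer $m\ge3$. Let $\omega_0\in\mathring{C}^{0,\alpha}(\mathbb{R}^2)$ be $m$-fold rotationally symmetric. Then the solution $\omega(t)$ of the 2D Euler equation with initial vorticity $\omega_0$ and its velocity $u(t)$ satisfy, for all $t\ge0$, $$\|\omega(t)\|_{\mathring{C}^{0,\alpha}}\le C\exp(C\exp(Ct))\qquad\text{and}\qquad \|\nabla u(t)\|_{L^\infty}\le C\exp(Ct),$$ where $C>0$ depends only on $\|\omega_0\|_{\mathring{C}^{0,\alpha}}$.
   Context: Norm: $\|f\|_{\mathring{C}^{0,\alpha}}:=\|f\|_{L^\infty(\mathbb{R}^2)}+\sup_{x\ne x'}\frac{||x|^\alpha f(x)-|x'|^\alpha f(x')|}{|x-x'|^\alpha}$ for $0<\alpha<1$; for $\alpha=1$ one may use the equivalent norm $\|f\|_{L^\infty}+\sup_{x\ne0}|x||\nabla f(x)|$. A scalar function $f$ is $m$-fold rotationally symmetric if $f(O_{2\pi/m}x)=f(x)$, a vector field $v$ if $v(O_{2\pi/m}x)=O_{2\pi/m}v(x)$, where $O_\theta$ is counterclockwise rotation by $\theta$. For bounded $m$-fold symmetric $\omega$, $m\ge3$, the velocity $u=u(\omega)$ is the unique $m$-fold symmetric vector field with $|u(x)|\le C|x|$ for some $C$, $\nabla\cdot u=0$ and $\nabla\times u=\partial_1u_2-\partial_2u_1=\omega$ in the sense of distributions. The solution of the 2D Euler equation $\partial_t\omega+u\cdot\nabla\omega=0$ with bounded $m$-fold symmetric initial data $\omega_0$ is the unique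 $m$-fold symmetric $\omega\in L^\infty([0,\infty);L^\infty(\mathbb{R}^2))$ with $\omega(t,x)=\omega_0(\Phi_t^{-1}(x))$, where $\frac{d}{dt}\Phi_t(x)=u(t,\Phi_t(x))$, $\Phi_0(x)=x$ and $u(t)=u(\omega(t))$. *)

theory Defs
  imports "HOL-Analysis.Analysis" "HOL-Probability.Essential_Supremum"
begin

text \<open>The measurability guard is needed because \<open>norm \<circ> f\<close> may be measurable when \<open>f\<close> is not.\<close>

definition Linfty_norm :: "(real^2 \<Rightarrow> 'b::real_normed_vector) \<Rightarrow> ereal" where
  "Linfty_norm f =
     (if f \<in> borel_measurable lebesgue then esssup lebesgue (\<lambda>x. ereal (norm (f x))) else \<infinity>)"

text \<open>The norm takes the value \<open>\<infinity>\<close> exactly outside the space. The same formula is used for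
  \<open>\<alpha> = 1\<close>, where it is equivalent to the norm given by the suprema of \<open>\<bar>f\<bar>\<close> and
  \<open>\<bar>x\<bar> \<bar>\<nabla>f\<bar>\<close>.\<close>

definition ring_holder_norm :: "real \<Rightarrow> (real^2 \<Rightarrow> real) \<Rightarrow> ereal" where
  "ring_holder_norm \<alpha> f = Linfty_norm f +
     (SUP (x, x') \<in> {(x, x'). x \<noteq> x'}.
        ereal (\<bar>norm x powr \<alpha> * f x - norm x' powr \<alpha> * f x'\<bar> / norm (x - x') powr \<alpha>))"

definition rotation :: "real \<Rightarrow> real^2 \<Rightarrow> real^2" where
  "rotation \<theta> x = vector [cos \<theta> * x$1 - sin \<theta> * x$2, sin \<theta> * x$1 + cos \<theta> * x$2]"

definition mfold_scalar :: "nat \<Rightarrow> (real^2 \<Rightarrow> real) \<Rightarrow> bool" where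
  "mfold_scalar m f \<longleftrightarrow> (\<forall>x. f (rotation (2 * pi / real m) x) = f x)"

definition mfold_vector :: "nat \<Rightarrow> (real^2 \<Rightarrow> real^2) \<Rightarrow> bool" where
  "mfold_vector m v \<longleftrightarrow>
     (\<forall>x. v (rotation (2 * pi / real m) x) = rotation (2 * pi / real m) (v x))"

definition partial_deriv :: "2 \<Rightarrow> (real^2 \<Rightarrow> real) \<Rightarrow> real^2 \<Rightarrow> real" where
  "partial_deriv i f x = frechet_derivative f (at x) (axis i 1)"

primrec C_k :: "nat \<Rightarrow> (real^2 \<Rightarrow> real) \<Rightarrow> bool" where
  "C_k 0 f \<longleftrightarrow> continuous_on UNIV f"
| "C_k (Suc k) f \<longleftrightarrow> f differentiable_on UNIV \<and> (\<forall>i. C_k k (partial_deriv i f))"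

definition test_function :: "(real^2 \<Rightarrow> real) \<Rightarrow> bool" where
  "test_function \<phi> \<longleftrightarrow> (\<forall>k. C_k k \<phi>) \<and> compact (closure {x. \<phi> x \<noteq> 0})"

definition locally_integrable :: "(real^2 \<Rightarrow> real) \<Rightarrow> bool" where
  "locally_integrable f \<longleftrightarrow> (\<forall>K. compact K \<longrightarrow> set_integrable lebesgue K f)"

definition weak_div :: "(real^2 \<Rightarrow> real^2) \<Rightarrow> (real^2 \<Rightarrow> real) \<Rightarrow> bool" where
  "weak_div u g \<longleftrightarrow>
     (\<forall>i. locally_integrable (\<lambda>x. u x $ i)) \<and> locally_integrable g \<and>
     (\<forall>\<phi>. test_function \<phi> \<longrightarrow>
        (LINT x|lebesgue. u x $ 1 * partial_deriv 1 \<phi> x + u x $ 2 * partial_deriv 2 \<phi> x)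
          = - (LINT x|lebesgue. g x * \<phi> x))"

text \<open>The curl is \<open>\<partial>\<^sub>1 u\<^sub>2 - \<partial>\<^sub>2 u\<^sub>1\<close>.\<close>

definition weak_curl :: "(real^2 \<Rightarrow> real^2) \<Rightarrow> (real^2 \<Rightarrow> real) \<Rightarrow> bool" where
  "weak_curl u w \<longleftrightarrow>
     (\<forall>i. locally_integrable (\<lambda>x. u x $ i)) \<and> locally_integrable w \<and>
     (\<forall>\<phi>. test_function \<phi> \<longrightarrow>
        (LINT x|lebesgue. u x $ 2 * partial_deriv 1 \<phi> x - u x $ 1 * partial_deriv 2 \<phi> x)
          = - (LINT x|lebesgue. w x * \<phi> x))"

definition weak_gradient :: "(real^2 \<Rightarrow> real^2) \<Rightarrow> (real^2 \<Rightarrow> real^2^2) \<Rightarrow> bool" where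
  "weak_gradient u G \<longleftrightarrow>
     (\<forall>i j. locally_integrable (\<lambda>x. u x $ i) \<and> locally_integrable (\<lambda>x. G x $ i $ j) \<and>
        (\<forall>\<phi>. test_function \<phi> \<longrightarrow>
           (LINT x|lebesgue. u x $ i * partial_deriv j \<phi> x)
             = - (LINT x|lebesgue. G x $ i $ j * \<phi> x)))"

text \<open>The distributional equations determine \<open>u\<close> only almost everywhere, whereas the flow needs
  its point values; continuity selects the representative. For \<open>m \<ge> 3\<close> the field is then
  unique.\<close>

definition is_velocity :: "nat \<Rightarrow> (real^2 \<Rightarrow> real) \<Rightarrow> (real^2 \<Rightarrow> real^2) \<Rightarrow> bool" where
  "is_velocity m \<omega> u \<longleftrightarrow>
     Linfty_norm \<omega> < \<infinity> \<and> mfold_scalar m \<omega> \<and>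
     continuous_on UNIV u \<and> mfold_vector m u \<and>
     (\<exists>C. \<forall>x. norm (u x) \<le> C * norm x) \<and>
     weak_div u (\<lambda>x. 0) \<and> weak_curl u \<omega>"

definition flow_map :: "(real \<Rightarrow> real^2 \<Rightarrow> real^2) \<Rightarrow> (real \<Rightarrow> real^2 \<Rightarrow> real^2) \<Rightarrow> bool" where
  "flow_map u \<Phi> \<longleftrightarrow>
     (\<forall>x. \<Phi> 0 x = x) \<and>
     (\<forall>t\<ge>0. bij (\<Phi> t) \<and>
        (\<forall>x. ((\<lambda>s. \<Phi> s x) has_vector_derivative u t (\<Phi> t x)) (at t within {0..})))"

text \<open>Values at negative times are irrelevant. The first two conjuncts express
  \<open>\<omega> \<in> L\<^sup>\<infinity>([0,\<infinity>); L\<^sup>\<infinity>(\<real>\<^sup>2))\<close>.\<close>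

definition euler_solution ::
  "nat \<Rightarrow> (real^2 \<Rightarrow> real) \<Rightarrow> (real \<Rightarrow> real^2 \<Rightarrow> real) \<Rightarrow> (real \<Rightarrow> real^2 \<Rightarrow> real^2) \<Rightarrow> bool" where
  "euler_solution m \<omega>0 \<omega> u \<longleftrightarrow>
     (\<lambda>(t, x). \<omega> t x) \<in> borel_measurable (lebesgue_on ({0..} \<times> UNIV)) \<and>
     (\<exists>B. AE t in lebesgue_on {0..}. Linfty_norm (\<omega> t) \<le> ereal B) \<and>
     (\<forall>t\<ge>0. mfold_scalar m (\<omega> t) \<and> is_velocity m (\<omega> t) (u t)) \<and>
     (\<exists>\<Phi>. flow_map u \<Phi> \<and> (\<forall>t\<ge>0. \<forall>x. \<omega> t x = \<omega>0 (inv (\<Phi> t) x)))"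

end

theory Submission
  imports Defs "HOL-Computational_Algebra.Polynomial"
begin

text \<open>Instead of the Biot--Savart integral, the velocity is compared with its averages over balls of
  radii \<open>r\<close> and \<open>2r\<close>: inserting test functions \<open>(x - z)\<^sub>q \<psi>(|x - z|\<^sup>2)\<close> into the weak equations expresses
  the difference of two such averages as a convolution of the vorticity with a smooth kernel of size
  \<open>1/r\<close> supported in \<open>|x - z| \<le> 2r\<close>. Every estimate is a telescoping sum over dyadic radii. Together
  with the rotational symmetry, which removes the trace-free symmetric part of the linear
  approximation at the origin, this gives \<open>|u(x)| \<le> C \<parallel>\<omega>\<parallel> |x|\<close>; summing the oscillations of \<open>\<omega>\<close> gives
  a log-Lipschitz bound for bounded \<open>\<omega>\<close> and a Lipschitz bound of size \<open>1/\<gamma>\<close> when \<open>\<omega>\<close> is Hoelder of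
  exponent \<open>\<gamma>\<close> in the scale invariant sense.

  By Osgood's argument the log-Lipschitz bound makes the inverse flow Hoelder of exponent
  \<open>exp (-Ct)\<close>. Hence \<open>\<omega>(t)\<close> has the exponent \<open>\<gamma> = \<alpha> exp (-Ct)\<close> with a bounded constant, so that
  \<open>u(t)\<close> is Lipschitz with constant \<open>C exp (Ct)\<close>. Gronwall's inequality with this constant then
  gives the double exponential bound with the original exponent \<open>\<alpha>\<close>.\<close>

section \<open>Smooth functions of one and two variables\<close>

text \<open>The velocity is known only through weak equations and a linear growth bound with an
  unspecified constant, and the Biot--Savart integral of a merely bounded vorticity does not
  converge absolutely at infinity; hence the comparison of averages instead of a formula for
  \<open>u\<close>. The vorticity may be discontinuous at the origin, so its oscillation on balls
  around x is under control only up to radii comparable to |x|. The dyadic sums are therefore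
  stopped there and the linear growth bound takes over; this is why that bound is proved first and
  why all Hoelder quotients are measured relative to the size of the points. A Gronwall argument
  needs a Lipschitz bound for the velocity, which in turn depends on the Hoelder norm to be
  estimated. The decreasing exponent breaks this circle: the constant in front stays bounded because
  distances are always divided by the size of the points, and all growth sits in the factor
  1/\<gamma>, which comes from a geometric series of ratio 2^\<gamma>.\<close>

definition flat :: "real poly \<Rightarrow> real \<Rightarrow> real" where
  "flat p x = (if x > 0 then poly p (1 / x) * exp (- (1 / x)) else 0)"

lemma poly_exp_decay: "((\<lambda>y. poly p y * exp (- y)) \<longlongrightarrow> (0::real)) at_top"
proof -
  have "((\<lambda>y. \<Sum>i\<le>degree p. coeff p i * (y ^ i / exp y)) \<longlongrightarrow> (\<Sum>i\<le>degree p. coeff p i * 0)) at_top"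
    by (intro tendsto_intros tendsto_power_div_exp_0)
  then show ?thesis
    by (simp add: poly_altdef exp_minus sum_distrib_right divide_inverse mult.assoc)
qed

text \<open>For x > 0 the derivative of p(1/x) exp(-1/x) is (p - p')(1/x) exp(-1/x) / x^2, so the
  family is closed under differentiation; \<open>[:0, 0, 1:]\<close> is the factor y^2 in the
  variable y = 1/x.\<close>

lemma flat_has_derivative:
  "(flat p has_real_derivative flat ([:0, 0, 1:] * (p - pderiv p)) x) (at x)"
proof -
  consider "x > 0" | "x < 0" | "x = 0" by linarith
  then show ?thesis
  proof cases
    case 1
    have "((\<lambda>x. poly p (1 / x) * exp (- (1 / x))) has_real_derivative
            flat ([:0, 0, 1:] * (p - pderiv p)) x) (at x)"
      using 1 unfolding flat_def
      by (auto intro!: derivative_eq_intros DERIV_chain'[where g="poly p"] poly_DERIV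
          simp: field_simps power2_eq_square)
    then show ?thesis
      by (rule has_field_derivative_transform_within_open[where S="{0<..}"])
        (use 1 in \<open>auto simp: flat_def\<close>)
  next
    case 2
    have "((\<lambda>x. 0) has_real_derivative flat ([:0, 0, 1:] * (p - pderiv p)) x) (at x)"
      using 2 by (simp add: flat_def)
    then show ?thesis
      by (rule has_field_derivative_transform_within_open[where S="{..<0}"])
        (use 2 in \<open>auto simp: flat_def\<close>)
  next
    case 3
    have inv: "filterlim (\<lambda>x::real. 1 / x) at_top (at_right 0)"
      using filterlim_inverse_at_top_right by (simp add: divide_inverse)
    \<comment> \<open>With y = 1/h the difference quotient is y p(y) exp(-y), so the decay is that
      of the polynomial \<open>[:0, 1:] * p\<close>.\<close>
    have "((\<lambda>h. flat p h / h) \<longlongrightarrow> 0) (at_right 0)"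
    proof (rule Lim_transform_eventually)
      show "((\<lambda>h. poly ([:0, 1:] * p) (1 / h) * exp (- (1 / h))) \<longlongrightarrow> 0) (at_right 0)"
        by (rule filterlim_compose[OF poly_exp_decay inv])
      show "\<forall>\<^sub>F h in at_right 0. poly ([:0, 1:] * p) (1 / h) * exp (- (1 / h)) = flat p h / h"
        by (simp add: eventually_at_filter flat_def divide_inverse)
    qed
    moreover have "((\<lambda>h. flat p h / h) \<longlongrightarrow> 0) (at_left 0)"
      by (rule tendsto_eventually) (simp add: eventually_at_filter flat_def)
    ultimately have "((\<lambda>h. flat p h / h) \<longlongrightarrow> 0) (at 0)"
      using filterlim_split_at by blast
    then show ?thesis
      using 3 by (simp add: DERIV_def flat_def)
  qed
qed

text \<open>Smoothness follows from closure of this family under differentiation, so only the closure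
  rules needed to build the cut-off functions are included.\<close>

inductive smooth1 :: "(real \<Rightarrow> real) \<Rightarrow> bool" where
  flat: "smooth1 (flat p)"
| const: "smooth1 (\<lambda>x. c)"
| ident: "smooth1 (\<lambda>x. x)"
| add: "smooth1 f \<Longrightarrow> smooth1 g \<Longrightarrow> smooth1 (\<lambda>x. f x + g x)"
| mult: "smooth1 f \<Longrightarrow> smooth1 g \<Longrightarrow> smooth1 (\<lambda>x. f x * g x)"
| compose: "smooth1 f \<Longrightarrow> smooth1 g \<Longrightarrow> smooth1 (\<lambda>x. f (g x))"
| antiderivative: "smooth1 f \<Longrightarrow> (\<And>x. (g has_real_derivative f x) (at x)) \<Longrightarrow> smooth1 g"
| quotient: "smooth1 f \<Longrightarrow> a > 0 \<Longrightarrow> (\<And>x. x < a \<Longrightarrow> f x = 0) \<Longrightarrow> smooth1 (\<lambda>x. f x / x ^ n)"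

lemma smooth1_has_derivative:
  assumes "smooth1 f"
  shows "\<exists>f'. (\<forall>x. (f has_real_derivative f' x) (at x)) \<and> smooth1 f'"
  using assms
proof induction
  case (flat p)
  then show ?case using flat_has_derivative smooth1.flat by blast
next
  case (const c)
  show ?case by (rule exI[of _ "\<lambda>x. 0"]) (auto intro: smooth1.const)
next
  case ident
  show ?case by (rule exI[of _ "\<lambda>x. 1"]) (auto intro: smooth1.const)
next
  case (add f g)
  then obtain f' g' where "\<And>x. (f has_real_derivative f' x) (at x)" "smooth1 f'"
    "\<And>x. (g has_real_derivative g' x) (at x)" "smooth1 g'" by blast
  then show ?case
    by (intro exI[of _ "\<lambda>x. f' x + g' x"]) (auto intro!: smooth1.add derivative_intros)
next
  case (mult f g)
  then obtain f' g' where "\<And>x. (f has_real_derivative f' x) (at x)" "smooth1 f'"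
    "\<And>x. (g has_real_derivative g' x) (at x)" "smooth1 g'" by blast
  with mult show ?case
    by (intro exI[of _ "\<lambda>x. f' x * g x + g' x * f x"])
      (auto intro!: smooth1.add smooth1.mult DERIV_mult)
next
  case (compose f g)
  then obtain f' g' where "\<And>x. (f has_real_derivative f' x) (at x)" "smooth1 f'"
    "\<And>x. (g has_real_derivative g' x) (at x)" "smooth1 g'" by blast
  then have "((\<lambda>x. f (g x)) has_real_derivative f' (g x) * g' x) (at x)" for x
    by (metis DERIV_chain2)
  moreover have "smooth1 (\<lambda>x. f' (g x) * g' x)"
    by (rule smooth1.mult[OF smooth1.compose]) fact+
  ultimately show ?case by (intro exI[of _ "\<lambda>x. f' (g x) * g' x"]) simp
next
  case (antiderivative f g)
  then show ?case by blast
next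
  case (quotient f a n)
  then obtain f' where f': "\<And>x. (f has_real_derivative f' x) (at x)" "smooth1 f'" by blast
  have f'0: "f' x = 0" if "x < a" for x
  proof -
    have "((\<lambda>x. 0) has_real_derivative f' x) (at x)"
      by (rule has_field_derivative_transform_within_open[OF f'(1), where S="{..<a}"])
        (use that quotient in auto)
    then show ?thesis using DERIV_unique DERIV_const by blast
  qed
  \<comment> \<open>The numerator of the derivative over the denominator \<open>x ^ Suc n\<close>.
    It vanishes below \<open>a\<close> again, so the rule \<open>quotient\<close> applies to the
    derivative.\<close>
  let ?h = "\<lambda>x. f' x * x + (- real n) * f x"
  have "smooth1 ?h"
    by (rule smooth1.add[OF smooth1.mult[OF f'(2) smooth1.ident]
          smooth1.mult[OF smooth1.const quotient.hyps(1)]])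
  then have "smooth1 (\<lambda>x. ?h x / x ^ Suc n)"
    by (rule smooth1.quotient[OF _ quotient.hyps(2)]) (simp add: f'0 quotient.hyps(3))
  moreover have "((\<lambda>x. f x / x ^ n) has_real_derivative ?h x / x ^ Suc n) (at x)" for x
  proof (cases "x > 0")
    case True
    have "((\<lambda>x. f x / x ^ n) has_real_derivative
        (f' x * x ^ n - f x * (real n * x ^ (n - 1))) / (x ^ n * x ^ n)) (at x)"
      by (rule DERIV_divide[OF f'(1)]) (use True in \<open>auto intro!: derivative_eq_intros\<close>)
    also have "(f' x * x ^ n - f x * (real n * x ^ (n - 1))) / (x ^ n * x ^ n) = ?h x / x ^ Suc n"
      using True by (cases n) (simp_all add: field_simps)
    finally show ?thesis .
  next
    case False
    have "((\<lambda>x. 0) has_real_derivative ?h x / x ^ Suc n) (at x)"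
      using False f'0[of x] quotient.hyps(2) quotient.hyps(3)[of x] by simp
    then show ?thesis
      by (rule has_field_derivative_transform_within_open[where S="{..<a}"])
        (use False quotient.hyps(2,3) in simp_all)
  qed
  ultimately show ?case by (intro exI[of _ "\<lambda>x. ?h x / x ^ Suc n"]) simp
qed

lemma smooth1_continuous: "smooth1 f \<Longrightarrow> continuous_on A f"
  using smooth1_has_derivative
  by (metis DERIV_isCont continuous_at_imp_continuous_on)

lemma smooth1_deriv:
  assumes "smooth1 f"
  shows "(f has_real_derivative deriv f x) (at x)" "smooth1 (deriv f)"
proof -
  obtain f' where f': "\<And>x. (f has_real_derivative f' x) (at x)" "smooth1 f'"
    using smooth1_has_derivative[OF assms] by blast
  then have "deriv f = f'" by (auto intro!: ext DERIV_imp_deriv)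
  with f' show "(f has_real_derivative deriv f x) (at x)" "smooth1 (deriv f)" by auto
qed

inductive smooth2 :: "(real^2 \<Rightarrow> real) \<Rightarrow> bool" where
  const: "smooth2 (\<lambda>x. c)"
| component: "smooth2 (\<lambda>x. x $ i)"
| add: "smooth2 f \<Longrightarrow> smooth2 g \<Longrightarrow> smooth2 (\<lambda>x. f x + g x)"
| mult: "smooth2 f \<Longrightarrow> smooth2 g \<Longrightarrow> smooth2 (\<lambda>x. f x * g x)"
| compose: "smooth1 f \<Longrightarrow> smooth2 g \<Longrightarrow> smooth2 (\<lambda>x. f (g x))"

lemma smooth2_has_derivative:
  assumes "smooth2 f"
  shows "\<exists>f'. (\<forall>x. (f has_derivative f' x) (at x)) \<and> (\<forall>v. smooth2 (\<lambda>x. f' x v))"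
  using assms
proof induction
  case (const c)
  show ?case by (rule exI[of _ "\<lambda>x v. 0"]) (auto intro: smooth2.const)
next
  case (component i)
  show ?case
    by (rule exI[of _ "\<lambda>x v. v $ i"])
      (auto intro: smooth2.const bounded_linear_imp_has_derivative bounded_linear_vec_nth)
next
  case (add f g)
  then obtain f' g' where
    "\<And>x. (f has_derivative f' x) (at x)" "\<And>v. smooth2 (\<lambda>x. f' x v)"
    "\<And>x. (g has_derivative g' x) (at x)" "\<And>v. smooth2 (\<lambda>x. g' x v)" by blast
  then show ?case
    by (intro exI[of _ "\<lambda>x v. f' x v + g' x v"]) (auto intro!: smooth2.add derivative_intros)
next
  case (mult f g)
  then obtain f' g' where
    "\<And>x. (f has_derivative f' x) (at x)" "\<And>v. smooth2 (\<lambda>x. f' x v)"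
    "\<And>x. (g has_derivative g' x) (at x)" "\<And>v. smooth2 (\<lambda>x. g' x v)" by blast
  with mult show ?case
    by (intro exI[of _ "\<lambda>x v. f x * g' x v + f' x v * g x"])
      (auto intro!: smooth2.add smooth2.mult derivative_intros)
next
  case (compose f g)
  obtain f' where f': "\<And>x. (f has_real_derivative f' x) (at x)" "smooth1 f'"
    using smooth1_has_derivative compose by blast
  obtain g' where g': "\<And>x. (g has_derivative g' x) (at x)" "\<And>v. smooth2 (\<lambda>x. g' x v)"
    using compose by blast
  have "((\<lambda>x. f (g x)) has_derivative (\<lambda>v. f' (g x) * g' x v)) (at x)" for x
    using diff_chain_at[OF g'(1) f'(1)[unfolded has_field_derivative_def], of x]
    by (simp add: o_def)
  moreover have "smooth2 (\<lambda>x. f' (g x) * g' x v)" for v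
    using smooth2.mult smooth2.compose f' g' compose by blast
  ultimately show ?case by (intro exI[of _ "\<lambda>x v. f' (g x) * g' x v"]) auto
qed

lemma smooth2_differentiable: "smooth2 f \<Longrightarrow> f differentiable_on UNIV"
  using smooth2_has_derivative
  by (metis differentiableI differentiable_at_imp_differentiable_on)

lemma smooth2_continuous: "smooth2 f \<Longrightarrow> continuous_on A f"
  using differentiable_imp_continuous_on smooth2_differentiable continuous_on_subset by blast

lemma partial_deriv_eq: "(f has_derivative f') (at x) \<Longrightarrow> partial_deriv i f x = f' (axis i 1)"
  unfolding partial_deriv_def using frechet_derivative_at by metis

lemma smooth2_partial_deriv: "smooth2 f \<Longrightarrow> smooth2 (partial_deriv i f)"
proof -
  assume "smooth2 f"
  then obtain f' where f': "\<And>x. (f has_derivative f' x) (at x)" "\<And>v. smooth2 (\<lambda>x. f' x v)"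
    using smooth2_has_derivative by blast
  then have "partial_deriv i f = (\<lambda>x. f' x (axis i 1))"
    by (auto simp: partial_deriv_eq)
  with f' show ?thesis by simp
qed

lemma smooth2_C_k: "smooth2 f \<Longrightarrow> C_k k f"
  by (induction k arbitrary: f)
    (auto intro: smooth2_continuous smooth2_differentiable smooth2_partial_deriv)

lemma test_functionI:
  assumes "smooth2 f" and "\<And>x. norm (x - z) > r \<Longrightarrow> f x = 0"
  shows "test_function f"
proof -
  have "closure {x. f x \<noteq> 0} \<subseteq> cball z r"
  proof (rule closure_minimal)
    show "{x. f x \<noteq> 0} \<subseteq> cball z r"
      using assms(2) by (force simp: dist_norm norm_minus_commute)
  qed simp
  then have "compact (closure {x. f x \<noteq> 0})"
    using compact_cball compact_closure bounded_subset bounded_cball closure_subset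
    by (metis (no_types, lifting) order_trans)
  with assms smooth2_C_k show ?thesis by (auto simp: test_function_def)
qed

section \<open>Radial test functions and integrals over balls\<close>

text \<open>Profiles are applied to the squared distance, a polynomial in the coordinates, because
  the distance itself is not differentiable at the centre.\<close>

abbreviation sqdist :: "real^2 \<Rightarrow> real^2 \<Rightarrow> real" where
  "sqdist z w \<equiv> (norm (w - z))\<^sup>2"

lemma sqdist_eq: "sqdist z w = (w$1 - z$1)\<^sup>2 + (w$2 - z$2)\<^sup>2" for z w :: "real^2"
  unfolding power2_norm_eq_inner by (simp add: inner_vec_def sum_2 power2_eq_square)

lemma smooth2_diff_component: "smooth2 (\<lambda>w. (w - z) $ i)"
  using smooth2.add[OF smooth2.component[of i] smooth2.const[of "- (z $ i)"]] by simp

lemma smooth2_sqdist: "smooth2 (sqdist z)"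
proof -
  have "sqdist z = (\<lambda>w. (w - z) $ 1 * (w - z) $ 1 + (w - z) $ 2 * (w - z) $ 2)"
    unfolding sqdist_eq by (simp add: power2_eq_square fun_eq_iff)
  then show ?thesis
    by (simp only: smooth2.add smooth2.mult smooth2_diff_component)
qed

lemma sqdist_has_derivative: "(sqdist z has_derivative (\<lambda>h. 2 * ((w - z) \<bullet> h))) (at w)"
  unfolding power2_norm_eq_inner
  by (auto intro!: derivative_eq_intros simp: inner_commute)

lemma partial_deriv_radial:
  assumes "smooth1 p"
  shows "partial_deriv i (\<lambda>w. p (sqdist z w)) w = 2 * (w - z) $ i * deriv p (sqdist z w)"
proof -
  have "((\<lambda>w. p (sqdist z w)) has_derivative (\<lambda>h. deriv p (sqdist z w) * (2 * ((w - z) \<bullet> h)))) (at w)"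
    using diff_chain_at[OF sqdist_has_derivative
        smooth1_deriv(1)[OF assms, unfolded has_field_derivative_def], of z w]
    by (simp add: o_def)
  from partial_deriv_eq[OF this] show ?thesis by (simp add: inner_axis)
qed

lemma partial_deriv_component_radial:
  assumes "smooth1 p"
  shows "partial_deriv i (\<lambda>w. (w - z) $ q * p (sqdist z w)) w =
    (if i = q then p (sqdist z w) else 0)
      + 2 * (w - z) $ q * (w - z) $ i * deriv p (sqdist z w)"
proof -
  have "((\<lambda>w. p (sqdist z w)) has_derivative (\<lambda>h. deriv p (sqdist z w) * (2 * ((w - z) \<bullet> h)))) (at w)"
    using diff_chain_at[OF sqdist_has_derivative
        smooth1_deriv(1)[OF assms, unfolded has_field_derivative_def], of z w]
    by (simp add: o_def)
  moreover have "((\<lambda>w. (w - z) $ q) has_derivative (\<lambda>h. h $ q)) (at w)"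
    by (auto intro!: derivative_eq_intros bounded_linear.has_derivative[OF bounded_linear_vec_nth])
  ultimately have "((\<lambda>w. (w - z) $ q * p (sqdist z w)) has_derivative
      (\<lambda>h. (w - z) $ q * (deriv p (sqdist z w) * (2 * ((w - z) \<bullet> h))) + h $ q * p (sqdist z w))) (at w)"
    by (rule has_derivative_mult[rotated])
  from partial_deriv_eq[OF this] show ?thesis
    by (auto simp: inner_axis) (auto simp: axis_def algebra_simps)
qed

lemma integrable_continuous_ball:
  fixes f :: "real^2 \<Rightarrow> real"
  assumes "continuous_on UNIV f" and "\<And>x. norm (x - z) > r \<Longrightarrow> f x = 0"
  shows "integrable lebesgue f"
proof -
  have "integrable lborel (\<lambda>x. indicator (cball z r) x *\<^sub>R f x)"
    using assms by (intro borel_integrable_compact continuous_on_subset[OF assms(1)]) auto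
  also have "(\<lambda>x. indicator (cball z r) x *\<^sub>R f x) = f"
    using assms(2) by (auto simp: indicator_def dist_norm norm_minus_commute fun_eq_iff)
  finally show ?thesis
    using borel_measurable_continuous_onI[OF assms(1)] by (simp add: integrable_completion)
qed

text \<open>The area of the enclosing square; the numerical constants below inherit the factor 4
  from here.\<close>

lemma measure_cball_le:
  assumes "r \<ge> 0"
  shows "measure lebesgue (cball (z::real^2) r) \<le> 4 * r\<^sup>2"
proof -
  have "cball z r \<subseteq> cbox (z - (\<chi> i. r)) (z + (\<chi> i. r))"
  proof
    fix x assume "x \<in> cball z r"
    then have "\<bar>(x - z) $ i\<bar> \<le> r" for i
      using component_le_norm_cart[of "x - z" i] by (auto simp: dist_norm norm_minus_commute)
    then show "x \<in> cbox (z - (\<chi> i. r)) (z + (\<chi> i. r))"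
      by (simp add: mem_box_cart abs_le_iff) (smt (verit))
  qed
  then have "measure lebesgue (cball z r) \<le> measure lebesgue (cbox (z - (\<chi> i. r)) (z + (\<chi> i. r)))"
    by (intro measure_mono_fmeasurable) auto
  also have "\<dots> = 4 * r\<^sup>2"
    using assms by (subst measure_completion)
      (auto simp: content_cbox_cart power2_eq_square UNIV_2 interval_ne_empty_cart)
  finally show ?thesis .
qed

text \<open>Integrability of \<open>f\<close> is not assumed: the Bochner integral of a
  non-integrable function is 0, for which the bound is trivial.\<close>

lemma integral_abs_le_ball:
  fixes f :: "real^2 \<Rightarrow> real"
  assumes "AE x in lebesgue. \<bar>f x\<bar> \<le> B * indicator (cball z r) x" and "r \<ge> 0" and "B \<ge> 0"
  shows "\<bar>LINT x|lebesgue. f x\<bar> \<le> 4 * B * r\<^sup>2"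
proof -
  have i: "integrable lebesgue (\<lambda>x. B * indicator (cball z r) x :: real)"
    by (intro integrable_mult_right integrable_real_indicator)
      (use emeasure_lborel_cball_finite[of z r] in \<open>auto simp: emeasure_completion\<close>)
  have "\<bar>LINT x|lebesgue. f x\<bar> \<le> (LINT x|lebesgue. B * indicator (cball z r) x)"
  proof (cases "integrable lebesgue f")
    case True
    have "\<bar>LINT x|lebesgue. f x\<bar> \<le> (LINT x|lebesgue. \<bar>f x\<bar>)"
      by (rule integral_abs_bound)
    also have "\<dots> \<le> (LINT x|lebesgue. B * indicator (cball z r) x)"
      using True i assms(1) by (intro integral_mono_AE) auto
    finally show ?thesis .
  qed (simp add: not_integrable_integral_eq assms(3))
  also have "\<dots> = B * measure lebesgue (cball z r)"
    by simp
  also have "\<dots> \<le> B * (4 * r\<^sup>2)"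
    using measure_cball_le[OF assms(2)] assms(3) by (intro mult_left_mono)
  finally show ?thesis by simp
qed

lemma integrable_AE_bounded_mult:
  fixes f g :: "real^2 \<Rightarrow> real"
  assumes "g \<in> borel_measurable lebesgue" and "AE x in lebesgue. \<bar>g x\<bar> \<le> N" and "integrable lebesgue f"
  shows "integrable lebesgue (\<lambda>x. g x * f x)"
proof (rule Bochner_Integration.integrable_bound)
  show "integrable lebesgue (\<lambda>x. N * f x)" using assms(3) by simp
  show "(\<lambda>x. g x * f x) \<in> borel_measurable lebesgue" using assms(1,3) by simp
  show "AE x in lebesgue. norm (g x * f x) \<le> norm (N * f x)"
    using assms(2) by eventually_elim (auto simp: abs_mult intro!: mult_mono)
qed

lemma lebesgue_integral_affine:
  fixes f :: "real^2 \<Rightarrow> real"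
  assumes "f \<in> borel_measurable borel" and "c > 0"
  shows "(LINT x|lebesgue. f x) = c\<^sup>2 * (LINT x|lebesgue. f (t + c *\<^sub>R x))"
proof -
  have "(LINT x|lebesgue. f x) = (LINT x|lborel. f x)"
    by (rule integral_completion) (use assms in simp)
  also have "\<dots> = (LINT x|density (distr lborel borel (\<lambda>x. t + c *\<^sub>R x)) (\<lambda>_. \<bar>c\<bar>^DIM(real^2)). f x)"
    using lborel_affine[of c t] assms(2) by auto
  also have "\<dots> = (LINT x|distr lborel borel (\<lambda>x. t + c *\<^sub>R x). c\<^sup>2 * f x)"
    using assms by (subst integral_density) (auto simp: power2_eq_square)
  also have "\<dots> = c\<^sup>2 * (LINT x|lborel. f (t + c *\<^sub>R x))"
    using assms by (subst integral_distr) (auto intro!: measurable_compose[OF _ assms(1)])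
  also have "(LINT x|lborel. f (t + c *\<^sub>R x)) = (LINT x|lebesgue. f (t + c *\<^sub>R x))"
    by (intro integral_completion[symmetric] measurable_compose[OF _ assms(1)]) simp
  finally show ?thesis .
qed

lemma lebesgue_integral_translate:
  fixes f :: "real^2 \<Rightarrow> real"
  assumes "f \<in> borel_measurable borel"
  shows "(LINT x|lebesgue. f (x + t)) = (LINT x|lebesgue. f x)"
  using lebesgue_integral_affine[OF assms, of 1 t] by (simp add: add.commute)

lemma antiderivative_exists:
  assumes "continuous_on UNIV (f :: real \<Rightarrow> real)"
  shows "\<exists>F. \<forall>x. (F has_real_derivative f x) (at x)"
  using einterval_antiderivative[of "-\<infinity>" "\<infinity>" f] assms
  by (auto simp: continuous_on_eq_continuous_at has_real_derivative_iff_has_vector_derivative)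

text \<open>The profile of the mollifiers \<open>\<rho>\<^sub>r(v) = \<eta>(|v|\<^sup>2 / r\<^sup>2) / r\<^sup>2\<close> is \<open>\<eta>\<close>, and
  \<open>\<rho>\<^sub>r - \<rho>\<^bsub>2r\<^esub>\<close> is the divergence-type expression \<open>(s \<psi>)'\<close> of the compactly supported \<open>\<psi>\<close>.\<close>

locale cutoff =
  fixes \<eta> \<psi> :: "real \<Rightarrow> real"
  assumes smooth_eta: "smooth1 \<eta>" and smooth_psi: "smooth1 \<psi>"
    and eta_nonneg: "\<And>s. \<eta> s \<ge> 0" and eta_zero: "\<And>s. s \<ge> 1 \<Longrightarrow> \<eta> s = 0"
    and eta_pos: "\<eta> (1/2) > 0"
    and psi_zero: "\<And>s. s \<ge> 4 \<Longrightarrow> \<psi> s = 0"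
    and psi_eq: "\<And>s. \<psi> s + s * deriv \<psi> s = \<eta> s - \<eta> (s / 4) / 4"

text \<open>If F is an antiderivative of \<eta>, then s \<psi>(s) = F(s) - F(s/4) solves the
  required equation. With \<eta> supported in [1/4, 1], the right side vanishes for s < 1/4, where F
  is constant, which makes the division by s smooth, and for s \<ge> 4, where both terms equal
  F(1).\<close>

lemma cutoff_exists: "\<exists>\<eta> \<psi>. cutoff \<eta> \<psi>"
proof -
  define \<eta> where "\<eta> s = flat 1 (s - 1/4) * flat 1 (1 - s)" for s
  have s_shift: "smooth1 (\<lambda>s. s - 1/4)" "smooth1 (\<lambda>s. 1 - s)" "smooth1 (\<lambda>s. s / 4)"
    using smooth1.add[OF smooth1.ident smooth1.const[of "-1/4"]]
      smooth1.add[OF smooth1.const[of 1] smooth1.mult[OF smooth1.const[of "-1"] smooth1.ident]]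
      smooth1.mult[OF smooth1.const[of "1/4"] smooth1.ident] by auto
  have eta: "smooth1 \<eta>"
    unfolding \<eta>_def
    by (rule smooth1.mult[OF smooth1.compose[OF smooth1.flat s_shift(1)]
          smooth1.compose[OF smooth1.flat s_shift(2)]])
  have eta0: "\<eta> s = 0" if "s \<le> 1/4 \<or> s \<ge> 1" for s
    using that by (auto simp: \<eta>_def flat_def)
  obtain F where F: "\<And>x. (F has_real_derivative \<eta> x) (at x)"
    using antiderivative_exists[OF smooth1_continuous[OF eta]] by blast
  have const: "F x = F y" if "\<And>t. x < t \<Longrightarrow> t < y \<Longrightarrow> \<eta> t = 0" "x < y" for x y
  proof -
    have "\<exists>t. x < t \<and> t < y \<and> F y - F x = (y - x) * \<eta> t"
      using MVT2[OF that(2), of F \<eta>] F by blast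
    with that(1) show ?thesis by force
  qed
  have F_low: "F s = F (1/4)" if "s \<le> 1/4" for s
  proof (cases "s < 1/4")
    case True
    then show ?thesis using const[of s "1/4"] eta0 by auto
  next
    case False
    with that have "s = 1/4" by simp
    then show ?thesis by (simp only:)
  qed
  have F_high: "F s = F 1" if "s \<ge> 1" for s
    using const[of 1 s] eta0 that by (cases "s = 1") auto
  have smF: "smooth1 F" using smooth1.antiderivative[OF eta F] .
  define h where "h s = F s + (-1) * F (s / 4)" for s
  have smh: "smooth1 h"
    unfolding h_def by (rule smooth1.add[OF smF smooth1.mult[OF smooth1.const
          smooth1.compose[OF smF s_shift(3)]]])
  have h0: "h s = 0" if "s < 1/4 \<or> s \<ge> 4" for s
    using that F_low[of s] F_low[of "s / 4"] F_high[of s] F_high[of "s/4"] by (auto simp: h_def)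
  define \<psi> where "\<psi> s = h s / s ^ 1" for s
  have psi: "smooth1 \<psi>"
    unfolding \<psi>_def by (rule smooth1.quotient[OF smh, of "1/4"]) (use h0 in auto)
  have "\<psi> s + s * deriv \<psi> s = \<eta> s - \<eta> (s / 4) / 4" for s
  proof -
    have h: "h s = s * \<psi> s" for s using h0[of s] by (auto simp: \<psi>_def)
    have "((\<lambda>s. s * \<psi> s) has_real_derivative (\<psi> s + s * deriv \<psi> s)) (at s)"
      by (auto intro!: derivative_eq_intros smooth1_deriv(1)[OF psi])
    moreover have "((\<lambda>s. F s + (-1) * F (s / 4)) has_real_derivative (\<eta> s - \<eta> (s / 4) / 4)) (at s)"
      by (auto intro!: derivative_eq_intros F DERIV_chain2[of F])
    ultimately show ?thesis
      using h DERIV_unique unfolding h_def by (metis (no_types, lifting) ext)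
  qed
  moreover have "\<eta> (1/2) > 0" "\<eta> s \<ge> 0" for s
    by (auto simp: \<eta>_def flat_def)
  ultimately have "cutoff \<eta> \<psi>"
    using eta psi eta0 h0 by unfold_locales (auto simp: \<psi>_def)
  then show ?thesis by blast
qed

section \<open>Mollifiers\<close>

lemma norm_axis_power2: "(norm (axis i c :: real^2))\<^sup>2 = c\<^sup>2"
  unfolding power2_norm_eq_inner by (simp add: inner_axis_axis power2_eq_square)

lemma compact_bound:
  assumes "continuous_on {0..b} (f :: real \<Rightarrow> real)" and "\<And>s. s > b \<Longrightarrow> f s = 0"
  shows "\<exists>M. \<forall>s\<ge>0. \<bar>f s\<bar> \<le> M"
proof -
  have "bounded (f ` {0..b})"
    by (intro compact_imp_bounded compact_continuous_image assms(1)) simp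
  then obtain M where M: "\<And>s. s \<in> {0..b} \<Longrightarrow> \<bar>f s\<bar> \<le> M"
    unfolding bounded_iff by (auto; fastforce)
  have "\<bar>f s\<bar> \<le> max M 0" if "s \<ge> 0" for s
    using M[of s] assms(2)[of s] that by (cases "s \<le> b") auto
  then show ?thesis by blast
qed

lemma deriv_zero_above:
  assumes "smooth1 f" and "\<And>s. s \<ge> b \<Longrightarrow> f s = 0" and "s > b"
  shows "deriv f s = 0"
proof -
  have "((\<lambda>x. 0) has_real_derivative deriv f s) (at s)"
    by (rule has_field_derivative_transform_within_open[OF smooth1_deriv(1)[OF assms(1)], where S="{b<..}"])
      (use assms in auto)
  then show ?thesis using DERIV_unique DERIV_const by blast
qed

context cutoff
begin

lemma cutoff_bounds:
  "\<exists>M>0. \<forall>s\<ge>0. \<bar>\<eta> s\<bar> \<le> M \<and> \<bar>deriv \<eta> s\<bar> \<le> M \<and> \<bar>deriv (deriv \<eta>) s\<bar> \<le> M \<and>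
     \<bar>\<psi> s\<bar> \<le> M \<and> \<bar>deriv \<psi> s\<bar> \<le> M"
proof -
  have d\<eta>: "deriv \<eta> s = 0" if "s > 1" for s
    using deriv_zero_above[OF smooth_eta eta_zero] that by blast
  \<comment> \<open>\<open>deriv_zero_above\<close> asks for vanishing on a closed half line,
    whereas \<open>deriv \<eta>\<close> is known to vanish only strictly beyond 1; hence the larger
    threshold 2.\<close>
  have dd\<eta>: "deriv (deriv \<eta>) s = 0" if "s > 2" for s
    using deriv_zero_above[OF smooth1_deriv(2)[OF smooth_eta], of 2] that d\<eta> by force
  have d\<psi>: "deriv \<psi> s = 0" if "s > 4" for s
    using deriv_zero_above[OF smooth_psi psi_zero] that by blast
  note c = smooth1_continuous smooth1_deriv(2) smooth_eta smooth_psi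
  have "\<exists>M. \<forall>s\<ge>0. \<bar>\<eta> s\<bar> \<le> M" "\<exists>M. \<forall>s\<ge>0. \<bar>deriv \<eta> s\<bar> \<le> M"
    "\<exists>M. \<forall>s\<ge>0. \<bar>deriv (deriv \<eta>) s\<bar> \<le> M"
    "\<exists>M. \<forall>s\<ge>0. \<bar>\<psi> s\<bar> \<le> M" "\<exists>M. \<forall>s\<ge>0. \<bar>deriv \<psi> s\<bar> \<le> M"
    using compact_bound[of 1 \<eta>] compact_bound[of 1 "deriv \<eta>"] compact_bound[of 2 "deriv (deriv \<eta>)"]
      compact_bound[of 4 \<psi>] compact_bound[of 4 "deriv \<psi>"] c d\<eta> dd\<eta> d\<psi> eta_zero psi_zero
    by auto
  then obtain M1 M2 M3 M4 M5 where B: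
    "\<And>s. s \<ge> 0 \<Longrightarrow> \<bar>\<eta> s\<bar> \<le> M1" "\<And>s. s \<ge> 0 \<Longrightarrow> \<bar>deriv \<eta> s\<bar> \<le> M2"
    "\<And>s. s \<ge> 0 \<Longrightarrow> \<bar>deriv (deriv \<eta>) s\<bar> \<le> M3" "\<And>s. s \<ge> 0 \<Longrightarrow> \<bar>\<psi> s\<bar> \<le> M4"
    "\<And>s. s \<ge> 0 \<Longrightarrow> \<bar>deriv \<psi> s\<bar> \<le> M5" by metis
  have "M1 \<ge> 0" "M2 \<ge> 0" "M3 \<ge> 0" "M4 \<ge> 0" "M5 \<ge> 0"
    using B[of 0] by auto
  then show ?thesis
    using B by (intro exI[of _ "M1 + M2 + M3 + M4 + M5 + 1"]) (simp, smt (verit))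
qed

definition M :: real where
  "M = (SOME M. M > 0 \<and> (\<forall>s\<ge>0. \<bar>\<eta> s\<bar> \<le> M \<and> \<bar>deriv \<eta> s\<bar> \<le> M \<and> \<bar>deriv (deriv \<eta>) s\<bar> \<le> M \<and>
     \<bar>\<psi> s\<bar> \<le> M \<and> \<bar>deriv \<psi> s\<bar> \<le> M))"

lemma M_pos: "M > 0"
  and M_bound: "s \<ge> 0 \<Longrightarrow> \<bar>\<eta> s\<bar> \<le> M" "s \<ge> 0 \<Longrightarrow> \<bar>deriv \<eta> s\<bar> \<le> M"
    "s \<ge> 0 \<Longrightarrow> \<bar>deriv (deriv \<eta>) s\<bar> \<le> M" "s \<ge> 0 \<Longrightarrow> \<bar>\<psi> s\<bar> \<le> M" "s \<ge> 0 \<Longrightarrow> \<bar>deriv \<psi> s\<bar> \<le> M"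
  using someI_ex[OF cutoff_bounds] unfolding M_def[symmetric] by blast+

definition \<rho> :: "real \<Rightarrow> real^2 \<Rightarrow> real" where
  "\<rho> r v = \<eta> ((norm v)\<^sup>2 / r\<^sup>2) / r\<^sup>2"

text \<open>A dyadic piece of the Biot--Savart kernel. By \<open>psi_eq\<close>, s \<psi>(s) = F(s)
  - F(s/4) with F' = \<eta>, so the pieces for all radii 2^k telescope to a constant multiple of v_q
  / |v|^2.\<close>

definition K :: "2 \<Rightarrow> real \<Rightarrow> real^2 \<Rightarrow> real" where
  "K q r v = v $ q * (\<psi> ((norm v)\<^sup>2 / r\<^sup>2) / r\<^sup>2)"

definition \<kappa> :: real where
  "\<kappa> = (LINT w|lebesgue. \<eta> ((norm (w :: real^2))\<^sup>2))"

definition moll :: "real \<Rightarrow> (real^2 \<Rightarrow> real) \<Rightarrow> real^2 \<Rightarrow> real" where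
  "moll r f z = (LINT w|lebesgue. f w * \<rho> r (w - z)) / \<kappa>"

lemma smooth1_rescale:
  assumes "smooth1 p"
  shows "smooth1 (\<lambda>s. p (s / a) / b)" "deriv (\<lambda>s. p (s / a) / b) s = deriv p (s / a) / (a * b)"
proof -
  show "smooth1 (\<lambda>s. p (s / a) / b)"
    using smooth1.mult[OF smooth1.const[of "1/b"]
        smooth1.compose[OF assms smooth1.mult[OF smooth1.const[of "1/a"] smooth1.ident]]] by simp
  have "((\<lambda>s. p (s / a)) has_real_derivative deriv p (s / a) * (1 / a)) (at s)"
    by (rule DERIV_chain2[where g="\<lambda>s. s / a", OF smooth1_deriv(1)[OF assms]])
      (use DERIV_cdivide[OF DERIV_ident, of a] in simp)
  then have "((\<lambda>s. p (s / a) / b) has_real_derivative deriv p (s / a) * (1 / a) / b) (at s)"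
    by (rule DERIV_cdivide)
  then show "deriv (\<lambda>s. p (s / a) / b) s = deriv p (s / a) / (a * b)"
    by (auto dest: DERIV_imp_deriv)
qed

lemma smooth2_rho: "smooth2 (\<lambda>w. \<rho> r (w - z))"
  unfolding \<rho>_def
  by (rule smooth2.compose[OF smooth1_rescale(1)[OF smooth_eta] smooth2_sqdist])

lemma smooth2_K: "smooth2 (\<lambda>w. K q r (w - z))"
  unfolding K_def
  by (rule smooth2.mult[OF smooth2_diff_component
        smooth2.compose[OF smooth1_rescale(1)[OF smooth_psi] smooth2_sqdist]])

lemma sq_ratio_ge: "r > 0 \<Longrightarrow> c \<ge> 0 \<Longrightarrow> norm v \<ge> c * r \<Longrightarrow> (norm v)\<^sup>2 / r\<^sup>2 \<ge> c\<^sup>2"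
  using power_mono[of "c * r" "norm v" 2] by (simp add: field_simps power_mult_distrib)

lemma rho_zero: "r > 0 \<Longrightarrow> norm v \<ge> r \<Longrightarrow> \<rho> r v = 0"
  using sq_ratio_ge[of r 1 v] eta_zero by (simp add: \<rho>_def)

lemma K_zero: "r > 0 \<Longrightarrow> norm v \<ge> 2 * r \<Longrightarrow> K q r v = 0"
  using sq_ratio_ge[of r 2 v] psi_zero by (simp add: K_def)

lemma rho_nonneg: "\<rho> r v \<ge> 0"
  by (simp add: \<rho>_def eta_nonneg)

lemma rho_le: "r > 0 \<Longrightarrow> \<bar>\<rho> r v\<bar> \<le> M / r\<^sup>2"
  using M_bound(1)[of "(norm v)\<^sup>2 / r\<^sup>2"] by (simp add: \<rho>_def divide_right_mono)

lemma K_le: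
  assumes "r > 0"
  shows "\<bar>K q r v\<bar> \<le> 2 * M / r"
proof (cases "norm v \<ge> 2 * r")
  case True
  then show ?thesis using K_zero assms M_pos by simp
next
  case False
  have "\<bar>K q r v\<bar> = \<bar>v $ q\<bar> * \<bar>\<psi> ((norm v)\<^sup>2 / r\<^sup>2)\<bar> / r\<^sup>2"
    by (simp add: K_def abs_mult)
  also have "\<dots> \<le> (2 * r) * M / r\<^sup>2"
    using False component_le_norm_cart[of v q] M_bound(4) assms
    by (intro divide_right_mono mult_mono) auto
  finally show ?thesis using assms by (simp add: power2_eq_square)
qed

text \<open>The product rule on |v| \<le> 2r: differentiating the profile gives 8, from |v| \<le> 2r
  used twice and the 2 of the chain rule, and differentiating the coordinate gives 1.\<close>

lemma K_lipschitz:
  assumes "r > 0"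
  shows "\<bar>K q r v - K q r v'\<bar> \<le> 9 * M / r\<^sup>2 * norm (v - v')"
proof -
  define p where "p s = \<psi> (s / r\<^sup>2) / r\<^sup>2" for s
  have p: "smooth1 p" "deriv p s = deriv \<psi> (s / r\<^sup>2) / (r\<^sup>2 * r\<^sup>2)" for s
    unfolding p_def using smooth1_rescale[OF smooth_psi] by blast+
  let ?D = "\<lambda>v h. v $ q * (deriv p (sqdist 0 v) * (2 * (v \<bullet> h))) + h $ q * p (sqdist 0 v)"
  have D: "(K q r has_derivative ?D v) (at v)" for v
  proof -
    have "((\<lambda>w. p (sqdist 0 w)) has_derivative (\<lambda>h. deriv p (sqdist 0 v) * (2 * (v \<bullet> h)))) (at v)"
      using diff_chain_at[OF sqdist_has_derivative
          smooth1_deriv(1)[OF p(1), unfolded has_field_derivative_def], of 0 v]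
      by (simp add: o_def)
    from has_derivative_mult[OF bounded_linear_imp_has_derivative[OF bounded_linear_vec_nth] this]
    show ?thesis by (simp add: K_def[abs_def] p_def)
  qed
  have "norm (?D v h) \<le> 9 * M / r\<^sup>2 * norm h" for v h
  proof (cases "norm v > 2 * r")
    case True
    then have "(norm v)\<^sup>2 / r\<^sup>2 > 4"
      using assms power_strict_mono[of "2 * r" "norm v" 2] by (simp add: field_simps power_mult_distrib)
    then show ?thesis
      using deriv_zero_above[OF smooth_psi psi_zero] psi_zero M_pos by (simp add: p p_def)
  next
    case False
    have "\<bar>v $ q * (deriv p (sqdist 0 v) * (2 * (v \<bullet> h)))\<bar> =
        \<bar>v $ q\<bar> * (\<bar>deriv \<psi> ((norm v)\<^sup>2 / r\<^sup>2)\<bar> * (2 * \<bar>v \<bullet> h\<bar>)) / (r\<^sup>2 * r\<^sup>2)"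
      by (simp add: p abs_mult)
    also have "\<dots> \<le> (2 * r) * (M * (2 * (2 * r * norm h))) / (r\<^sup>2 * r\<^sup>2)"
    proof (intro divide_right_mono mult_mono)
      show "\<bar>v \<bullet> h\<bar> \<le> 2 * r * norm h"
        using Cauchy_Schwarz_ineq2[of v h] False mult_right_mono[of "norm v" "2 * r" "norm h"] by simp
    qed (use False component_le_norm_cart[of v q] M_bound(5) assms M_pos in auto)
    also have "\<dots> = 8 * M / r\<^sup>2 * norm h"
      using assms by (simp add: field_simps power2_eq_square)
    finally have 1: "\<bar>v $ q * (deriv p (sqdist 0 v) * (2 * (v \<bullet> h)))\<bar> \<le> 8 * M / r\<^sup>2 * norm h" .
    have "\<bar>h $ q * p (sqdist 0 v)\<bar> \<le> norm h * (M / r\<^sup>2)"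
      unfolding abs_mult using component_le_norm_cart[of h q] M_bound(4)[of "(norm v)\<^sup>2 / r\<^sup>2"]
      by (intro mult_mono) (auto simp: p_def divide_right_mono)
    with 1 have "norm (?D v h) \<le> 8 * M / r\<^sup>2 * norm h + norm h * (M / r\<^sup>2)"
      unfolding real_norm_def by linarith
    also have "\<dots> = 9 * M / r\<^sup>2 * norm h" by (simp add: field_simps)
    finally show ?thesis .
  qed
  then have "onorm (?D v) \<le> 9 * M / r\<^sup>2" for v
    using M_pos by (intro onorm_bound) auto
  then have "norm (K q r v - K q r v') \<le> 9 * M / r\<^sup>2 * norm (v - v')"
    using D by (intro differentiable_bound[of UNIV "K q r" ?D]) auto
  then show ?thesis by simp
qed

lemma kappa_pos: "\<kappa> > 0"
proof -
  let ?f = "\<lambda>w::real^2. \<eta> ((norm w)\<^sup>2)"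
  have cont: "continuous_on UNIV ?f"
    using smooth2_continuous[OF smooth2.compose[OF smooth_eta smooth2_sqdist[of 0]]] by simp
  have int: "integrable lebesgue ?f"
    by (rule integrable_continuous_ball[where z=0 and r=1, OF cont])
      (use eta_zero power_mono[of 1] in force)
  have "open {w. ?f w > 0}"
    using open_Collect_less[OF continuous_on_const cont, of 0] .
  moreover have "axis 1 (sqrt (1/2)) \<in> {w. ?f w > 0}"
    using eta_pos by (simp add: norm_axis_power2)
  ultimately have "\<not> negligible {w. ?f w > 0}"
    using open_not_negligible by blast
  have "\<kappa> \<noteq> 0"
  proof
    assume "\<kappa> = 0"
    then have "AE w in lebesgue. ?f w = 0"
      using integral_nonneg_eq_0_iff_AE[OF int] eta_nonneg by (simp add: \<kappa>_def)
    moreover have eq: "{w \<in> space lebesgue. \<not> ?f w = 0} = {w. ?f w > 0}"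
      using eta_nonneg by (auto simp: less_le)
    moreover have "{w. ?f w > 0} \<in> sets lebesgue"
      using \<open>open {w. ?f w > 0}\<close> by (intro sets_completionI_sets) simp
    ultimately have "{w. ?f w > 0} \<in> null_sets lebesgue"
      using AE_iff_null[of lebesgue "\<lambda>w. ?f w = 0"] by simp
    then show False
      using \<open>\<not> negligible _\<close> negligible_iff_null_sets by blast
  qed
  moreover have "\<kappa> \<ge> 0" unfolding \<kappa>_def using eta_nonneg by simp
  ultimately show ?thesis by simp
qed

lemma integral_rho:
  assumes "r > 0"
  shows "(LINT w|lebesgue. \<rho> r (w - z)) = \<kappa>"
proof -
  have m: "(\<lambda>w. \<rho> r (w - z)) \<in> borel_measurable borel"
    by (rule borel_measurable_continuous_onI[OF smooth2_continuous[OF smooth2_rho]])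
  have "(LINT w|lebesgue. \<rho> r (w - z)) = r\<^sup>2 * (LINT w|lebesgue. \<rho> r (z + r *\<^sub>R w - z))"
    by (rule lebesgue_integral_affine[OF m assms])
  also have "\<dots> = r\<^sup>2 * (LINT w|lebesgue. \<eta> ((norm (w :: real^2))\<^sup>2) / r\<^sup>2)"
    using assms by (simp add: \<rho>_def power_mult_distrib)
  finally show ?thesis using assms by (simp add: \<kappa>_def)
qed

lemma integrable_rho: "r > 0 \<Longrightarrow> continuous_on UNIV f \<Longrightarrow> integrable lebesgue (\<lambda>w. f w * \<rho> r (w - z))"
  by (rule integrable_continuous_ball[where z=z and r=r])
    (auto intro!: continuous_intros smooth2_continuous[OF smooth2_rho] simp: rho_zero)

lemma integrable_K: "r > 0 \<Longrightarrow> integrable lebesgue (\<lambda>w. K q r (w - z))"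
  by (rule integrable_continuous_ball[where z=z and r="2 * r"])
    (auto intro!: smooth2_continuous[OF smooth2_K] simp: K_zero)

end

section \<open>Differences of averages at the radii r and 2r\<close>

context cutoff
begin

text \<open>\<open>f\<close> is a velocity component and \<open>g\<close> the vorticity: this is the part of the Biot--Savart law
  that lives at the dyadic scale \<open>r\<close>.\<close>

definition represented :: "(real^2 \<Rightarrow> real) \<Rightarrow> (real^2 \<Rightarrow> real) \<Rightarrow> real \<Rightarrow> bool" where
  "represented f g N \<longleftrightarrow> continuous_on UNIV f \<and> g \<in> borel_measurable lebesgue \<and>
     (AE x in lebesgue. \<bar>g x\<bar> \<le> N) \<and>
     (\<exists>c q. \<bar>c\<bar> \<le> 1 \<and> (\<forall>r>0. \<forall>z.
        (LINT w|lebesgue. f w * (\<rho> r (w - z) - \<rho> (2 * r) (w - z))) =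
          c * (LINT w|lebesgue. g w * K q r (w - z))))"

text \<open>The vector field (a_1, a_2) is radial, so it has no curl and its divergence is 2p + 2s
  p', which \<open>psi_eq\<close> turns into twice the difference of the two mollifiers. Subtracting
  the curl equation tested with a_2 from the divergence equation tested with a_1 leaves u_1 times
  that divergence; adding the equations with the roles exchanged leaves u_2. This yields the
  coefficients 1/2 and -1/2.\<close>

lemma velocity_represented:
  assumes "continuous_on UNIV u" and "weak_div u (\<lambda>x. 0)" and "weak_curl u \<omega>"
    and "\<omega> \<in> borel_measurable lebesgue" and "AE x in lebesgue. \<bar>\<omega> x\<bar> \<le> N"
  shows "represented (\<lambda>x. u x $ i) \<omega> N"
proof -
  have cont: "continuous_on UNIV (\<lambda>x. u x $ j)" for j
    using assms(1) by (intro continuous_intros)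
  have key: "(LINT w|lebesgue. u w $ 1 * (\<rho> r (w - z) - \<rho> (2 * r) (w - z))) =
        (1/2) * (LINT w|lebesgue. \<omega> w * K 2 r (w - z)) \<and>
      (LINT w|lebesgue. u w $ 2 * (\<rho> r (w - z) - \<rho> (2 * r) (w - z))) =
        - (1/2) * (LINT w|lebesgue. \<omega> w * K 1 r (w - z))" if r: "r > 0" for r z
  proof -
    define p where "p s = \<psi> (s / r\<^sup>2) / r\<^sup>2" for s
    have p: "smooth1 p" "deriv p s = deriv \<psi> (s / r\<^sup>2) / (r\<^sup>2 * r\<^sup>2)" for s
      unfolding p_def using smooth1_rescale[OF smooth_psi] by blast+
    define a where "a q w = K q r (w - z)" for q w
    have a_eq: "a q = (\<lambda>w. (w - z) $ q * p (sqdist z w))" for q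
      by (simp add: a_def K_def p_def fun_eq_iff)
    have sm: "smooth2 (a q)" for q unfolding a_def by (rule smooth2_K)
    have pd: "partial_deriv j (a q) w = (if j = q then p (sqdist z w) else 0)
        + 2 * (w - z) $ q * (w - z) $ j * deriv p (sqdist z w)" for j q w
      unfolding a_eq by (rule partial_deriv_component_radial[OF p(1)])
    have test: "test_function (a q)" for q
      by (rule test_functionI[OF sm, of "2 * r" z]) (simp add: a_def K_zero r)
    have zero: "partial_deriv j (a q) w = 0" if "norm (w - z) > 2 * r" for j q w
    proof -
      have "(norm (w - z))\<^sup>2 / r\<^sup>2 > 4"
        using that r power_strict_mono[of "2 * r" "norm (w - z)" 2]
        by (simp add: field_simps power_mult_distrib)
      then show ?thesis
        using deriv_zero_above[OF smooth_psi psi_zero] psi_zero unfolding pd by (simp add: p p_def)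
    qed
    have int: "integrable lebesgue (\<lambda>w. u w $ k * partial_deriv j (a q) w)" for j k q
      by (rule integrable_continuous_ball[of _ "2 * r" z])
        (auto intro!: continuous_on_mult[OF cont] smooth2_continuous[OF smooth2_partial_deriv[OF sm]]
          simp: zero)
    have div: "(LINT w|lebesgue. u w $ 1 * partial_deriv 1 (a q) w + u w $ 2 * partial_deriv 2 (a q) w) = 0" for q
      using assms(2) test unfolding weak_div_def by simp
    have curl: "(LINT w|lebesgue. u w $ 2 * partial_deriv 1 (a q) w - u w $ 1 * partial_deriv 2 (a q) w)
        = - (LINT w|lebesgue. \<omega> w * a q w)" for q
      using assms(3) test unfolding weak_curl_def by blast
    have comb: "2 * p s + 2 * s * deriv p s = 2 * (\<eta> (s / r\<^sup>2) / r\<^sup>2 - \<eta> (s / (2 * r)\<^sup>2) / (2 * r)\<^sup>2)" for s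
    proof -
      have "2 * p s + 2 * s * deriv p s = 2 * (\<psi> (s / r\<^sup>2) + s / r\<^sup>2 * deriv \<psi> (s / r\<^sup>2)) / r\<^sup>2"
        using r by (simp add: p p_def field_simps)
      also have "\<dots> = 2 * (\<eta> (s / r\<^sup>2) / r\<^sup>2 - \<eta> (s / (2 * r)\<^sup>2) / (2 * r)\<^sup>2)"
        unfolding psi_eq using r by (simp add: field_simps power_mult_distrib)
      finally show ?thesis .
    qed
    have comb': "2 * p (sqdist z w) + 2 * sqdist z w * deriv p (sqdist z w) =
        2 * (\<rho> r (w - z) - \<rho> (2 * r) (w - z))" for w
      unfolding comb by (simp add: \<rho>_def)
    have "(LINT w|lebesgue. 2 * (u w $ 1 * (\<rho> r (w - z) - \<rho> (2 * r) (w - z)))) =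
       (LINT w|lebesgue. (u w $ 1 * partial_deriv 1 (a 1) w + u w $ 2 * partial_deriv 2 (a 1) w) -
          (u w $ 2 * partial_deriv 1 (a 2) w - u w $ 1 * partial_deriv 2 (a 2) w))"
    proof (rule Bochner_Integration.integral_cong[OF refl])
      fix w
      have gen: "a * (2 * P + 2 * S * Q) =
          (a * (P + 2 * X * X * Q) + b * (0 + 2 * X * Y * Q)) - (b * (0 + 2 * Y * X * Q) - a * (P + 2 * Y * Y * Q))"
        if "S = X\<^sup>2 + Y\<^sup>2" for a b P Q S X Y :: real
        using that by (simp add: algebra_simps power2_eq_square)
      have "2 * (u w $ 1 * (\<rho> r (w - z) - \<rho> (2 * r) (w - z))) =
          u w $ 1 * (2 * p (sqdist z w) + 2 * sqdist z w * deriv p (sqdist z w))"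
        unfolding comb' by simp
      also note gen[of "sqdist z w" "(w - z) $ 1" "(w - z) $ 2" _ _ _ "u w $ 2"]
      finally show "2 * (u w $ 1 * (\<rho> r (w - z) - \<rho> (2 * r) (w - z))) =
        (u w $ 1 * partial_deriv 1 (a 1) w + u w $ 2 * partial_deriv 2 (a 1) w) -
          (u w $ 2 * partial_deriv 1 (a 2) w - u w $ 1 * partial_deriv 2 (a 2) w)"
        unfolding pd by (simp add: sqdist_eq)
    qed
    also have "\<dots> = (LINT w|lebesgue. \<omega> w * a 2 w)"
      by (subst Bochner_Integration.integral_diff)
        (auto intro!: Bochner_Integration.integrable_diff Bochner_Integration.integrable_add int
          simp: div curl)
    finally have 1: "2 * (LINT w|lebesgue. u w $ 1 * (\<rho> r (w - z) - \<rho> (2 * r) (w - z))) =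
        (LINT w|lebesgue. \<omega> w * a 2 w)" by simp
    have "(LINT w|lebesgue. 2 * (u w $ 2 * (\<rho> r (w - z) - \<rho> (2 * r) (w - z)))) =
       (LINT w|lebesgue. (u w $ 1 * partial_deriv 1 (a 2) w + u w $ 2 * partial_deriv 2 (a 2) w) +
          (u w $ 2 * partial_deriv 1 (a 1) w - u w $ 1 * partial_deriv 2 (a 1) w))"
    proof (rule Bochner_Integration.integral_cong[OF refl])
      fix w
      have gen: "a * (2 * P + 2 * S * Q) =
          (b * (0 + 2 * Y * X * Q) + a * (P + 2 * Y * Y * Q)) + (a * (P + 2 * X * X * Q) - b * (0 + 2 * X * Y * Q))"
        if "S = X\<^sup>2 + Y\<^sup>2" for a b P Q S X Y :: real
        using that by (simp add: algebra_simps power2_eq_square)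
      have "2 * (u w $ 2 * (\<rho> r (w - z) - \<rho> (2 * r) (w - z))) =
          u w $ 2 * (2 * p (sqdist z w) + 2 * sqdist z w * deriv p (sqdist z w))"
        unfolding comb' by simp
      also note gen[of "sqdist z w" "(w - z) $ 1" "(w - z) $ 2" _ _ _ "u w $ 1"]
      finally show "2 * (u w $ 2 * (\<rho> r (w - z) - \<rho> (2 * r) (w - z))) =
        (u w $ 1 * partial_deriv 1 (a 2) w + u w $ 2 * partial_deriv 2 (a 2) w) +
          (u w $ 2 * partial_deriv 1 (a 1) w - u w $ 1 * partial_deriv 2 (a 1) w)"
        unfolding pd by (simp add: sqdist_eq)
    qed
    also have "\<dots> = - (LINT w|lebesgue. \<omega> w * a 1 w)"
      by (subst Bochner_Integration.integral_add)
        (auto intro!: Bochner_Integration.integrable_diff Bochner_Integration.integrable_add int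
          simp: div curl)
    finally have 2: "2 * (LINT w|lebesgue. u w $ 2 * (\<rho> r (w - z) - \<rho> (2 * r) (w - z))) =
        - (LINT w|lebesgue. \<omega> w * a 1 w)" by simp
    show ?thesis using 1 2 by (simp add: a_def)
  qed
  have "i = 1 \<or> i = 2" using exhaust_2 by auto
  then have "\<exists>c q. \<bar>c\<bar> \<le> (1::real) \<and> (\<forall>r>0. \<forall>z.
        (LINT w|lebesgue. u w $ i * (\<rho> r (w - z) - \<rho> (2 * r) (w - z))) =
          c * (LINT w|lebesgue. \<omega> w * K q r (w - z)))"
  proof
    assume "i = 1"
    with key show ?thesis by (intro exI[of _ "1/2"] exI[of _ 2]) auto
  next
    assume "i = 2"
    with key show ?thesis by (intro exI[of _ "-(1/2)"] exI[of _ 1]) auto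
  qed
  with assms cont show ?thesis unfolding represented_def by blast
qed

lemma moll_scale_diff:
  assumes "represented f g N"
  shows "\<exists>c q. \<bar>c\<bar> \<le> 1 \<and> (\<forall>r>0. \<forall>z.
    moll r f z - moll (2 * r) f z = c / \<kappa> * (LINT w|lebesgue. g w * K q r (w - z)))"
proof -
  obtain c q where cq: "\<bar>c\<bar> \<le> 1" "\<And>r z. r > 0 \<Longrightarrow>
        (LINT w|lebesgue. f w * (\<rho> r (w - z) - \<rho> (2 * r) (w - z))) =
          c * (LINT w|lebesgue. g w * K q r (w - z))"
    using assms unfolding represented_def by blast
  have "moll r f z - moll (2 * r) f z = c / \<kappa> * (LINT w|lebesgue. g w * K q r (w - z))"
    if "r > 0" for r z
  proof -
    have "(LINT w|lebesgue. f w * \<rho> r (w - z)) - (LINT w|lebesgue. f w * \<rho> (2 * r) (w - z)) =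
        (LINT w|lebesgue. f w * (\<rho> r (w - z) - \<rho> (2 * r) (w - z)))"
    proof -
      have "integrable lebesgue (\<lambda>w. f w * \<rho> s (w - z))" if "s > 0" for s
        using assms integrable_rho[OF that] unfolding represented_def by blast
      with that show ?thesis
        by (subst Bochner_Integration.integral_diff[symmetric]) (simp_all add: right_diff_distrib)
    qed
    then show ?thesis
      unfolding moll_def diff_divide_distrib[symmetric] using cq(2)[OF that] by simp
  qed
  with cq(1) show ?thesis by blast
qed

text \<open>The kernel has size 2M/r on a ball of area at most 16 r^2, so the difference is of order
  r and summable towards small radii.\<close>

lemma moll_scale_diff_le:
  assumes "represented f g N" and "r > 0" and "N \<ge> 0"
  shows "\<bar>moll r f z - moll (2 * r) f z\<bar> \<le> 32 * M / \<kappa> * N * r"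
proof -
  obtain c q where cq: "\<bar>c\<bar> \<le> 1"
    "\<And>z. moll r f z - moll (2 * r) f z = c / \<kappa> * (LINT w|lebesgue. g w * K q r (w - z))"
    using moll_scale_diff[OF assms(1)] assms(2) by blast
  have "\<bar>LINT w|lebesgue. g w * K q r (w - z)\<bar> \<le> 4 * (N * (2 * M / r)) * (2 * r)\<^sup>2"
  proof (rule integral_abs_le_ball)
    have "AE x in lebesgue. \<bar>g x\<bar> \<le> N" using assms(1) unfolding represented_def by blast
    then show "AE w in lebesgue. \<bar>g w * K q r (w - z)\<bar> \<le> N * (2 * M / r) * indicator (cball z (2 * r)) w"
    proof eventually_elim
      case (elim w)
      show ?case
      proof (cases "w \<in> cball z (2 * r)")
        case True
        have "\<bar>g w\<bar> * \<bar>K q r (w - z)\<bar> \<le> N * (2 * M / r)"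
          by (intro mult_mono elim K_le assms) auto
        with True show ?thesis by (simp add: abs_mult)
      next
        case False
        then show ?thesis
          using K_zero[OF assms(2), of "w - z"] by (simp add: dist_norm norm_minus_commute)
      qed
    qed
  qed (use assms M_pos in auto)
  also have "\<dots> = 32 * M * N * r" using assms(2) by (simp add: field_simps power2_eq_square)
  finally have "\<bar>c\<bar> * \<bar>LINT w|lebesgue. g w * K q r (w - z)\<bar> \<le> 1 * (32 * M * N * r)"
    using cq(1) by (intro mult_mono) auto
  then show ?thesis
    unfolding cq(2) using kappa_pos by (simp add: abs_mult field_simps)
qed

text \<open>The integral of the kernel does not depend on its centre, so a constant
  \<open>c0\<close> may be subtracted from \<open>g\<close> without changing the increment: only the
  oscillation of the vorticity counts. The minimum comes from two regimes. For |h| \<le> r the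
  Lipschitz bound of the kernel is used on a ball of radius 3r, giving 324 = 4 * 9 * 9; for |h| > r
  the two terms are estimated separately, which gives only 64.\<close>

lemma moll_scale_diff_increment_le:
  assumes "represented f g N" and "r > 0" and "b \<ge> 0"
    and "AE w in lebesgue. w \<in> cball z (norm h + 2 * r) \<longrightarrow> \<bar>g w - c0\<bar> \<le> b"
  shows "\<bar>(moll r f (z + h) - moll (2 * r) f (z + h)) - (moll r f z - moll (2 * r) f z)\<bar>
    \<le> 324 * M / \<kappa> * b * min r (norm h)"
proof -
  obtain c q where cq: "\<bar>c\<bar> \<le> 1"
    "\<And>z. moll r f z - moll (2 * r) f z = c / \<kappa> * (LINT w|lebesgue. g w * K q r (w - z))"
    using moll_scale_diff[OF assms(1)] assms(2) by blast
  have gm: "g \<in> borel_measurable lebesgue" and gN: "AE x in lebesgue. \<bar>g x\<bar> \<le> N"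
    using assms(1) unfolding represented_def by auto
  have gc: "AE x in lebesgue. \<bar>g x - c0\<bar> \<le> N + \<bar>c0\<bar>"
    using gN by eventually_elim simp
  have gcm: "(\<lambda>x. g x - c0) \<in> borel_measurable lebesgue" using gm by simp
  note intK = integrable_K[OF assms(2), of q]
  have int: "integrable lebesgue (\<lambda>w. g w * K q r (w - y))"
      "integrable lebesgue (\<lambda>w. (g w - c0) * K q r (w - y))" for y
    using integrable_AE_bounded_mult[OF gm gN intK] integrable_AE_bounded_mult[OF gcm gc intK] by auto
  have trans: "(LINT w|lebesgue. K q r (w - y)) = (LINT w|lebesgue. K q r w)" for y
    using lebesgue_integral_translate[of "K q r" "- y"]
      borel_measurable_continuous_onI[OF smooth2_continuous[OF smooth2_K[of q r 0]]] by simp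
  have split: "(LINT w|lebesgue. g w * K q r (w - y)) =
      (LINT w|lebesgue. (g w - c0) * K q r (w - y)) + c0 * (LINT w|lebesgue. K q r w)" for y
  proof -
    have "(LINT w|lebesgue. g w * K q r (w - y)) =
        (LINT w|lebesgue. (g w - c0) * K q r (w - y) + c0 * K q r (w - y))"
      by (simp add: algebra_simps)
    also have "\<dots> = (LINT w|lebesgue. (g w - c0) * K q r (w - y)) + (LINT w|lebesgue. c0 * K q r (w - y))"
      by (rule Bochner_Integration.integral_add) (use int intK in auto)
    finally show ?thesis by (simp add: trans)
  qed
  let ?I = "\<lambda>y. LINT w|lebesgue. (g w - c0) * K q r (w - y)"
  have "\<bar>?I (z + h) - ?I z\<bar> \<le> 324 * M * b * min r (norm h)"
  proof (cases "norm h \<le> r")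
    case True
    have "?I (z + h) - ?I z = (LINT w|lebesgue. (g w - c0) * (K q r (w - (z + h)) - K q r (w - z)))"
      by (subst Bochner_Integration.integral_diff[symmetric]) (use int in \<open>simp_all add: left_diff_distrib right_diff_distrib\<close>)
    also have "\<bar>\<dots>\<bar> \<le> 4 * (b * (9 * M / r\<^sup>2 * norm h)) * (3 * r)\<^sup>2"
    proof (rule integral_abs_le_ball)
      show "AE w in lebesgue. \<bar>(g w - c0) * (K q r (w - (z + h)) - K q r (w - z))\<bar>
          \<le> b * (9 * M / r\<^sup>2 * norm h) * indicator (cball z (3 * r)) w"
        using assms(4)
      proof eventually_elim
        case (elim w)
        show ?case
        proof (cases "norm (w - z) \<le> norm h + 2 * r")
          case in_ball: True
          have "\<bar>(g w - c0) * (K q r (w - (z + h)) - K q r (w - z))\<bar> \<le> b * (9 * M / r\<^sup>2 * norm h)"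
            unfolding abs_mult
            using elim in_ball K_lipschitz[OF assms(2), of q "w - (z + h)" "w - z"] assms(3)
            by (intro mult_mono) (auto simp: dist_norm norm_minus_commute)
          with in_ball True show ?thesis by (simp add: dist_norm norm_minus_commute)
        next
          case False
          then have "norm (w - z) \<ge> 2 * r" using norm_ge_zero[of h] by linarith
          moreover have "norm (w - (z + h)) \<ge> 2 * r"
            using False norm_triangle_ineq[of "w - (z + h)" h] by simp
          ultimately have 0: "(g w - c0) * (K q r (w - (z + h)) - K q r (w - z)) = 0"
            using K_zero[OF assms(2)] by simp
          show ?thesis
            unfolding 0 abs_zero by (intro mult_nonneg_nonneg) (use assms M_pos in auto)
        qed
      qed
    qed (use assms M_pos in auto)
    also have "\<dots> = 324 * M * b * min r (norm h)"
      using True assms(2) by (simp add: field_simps power2_eq_square)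
    finally show ?thesis .
  next
    case False
    have "\<bar>?I y\<bar> \<le> 4 * (b * (2 * M / r)) * (2 * r)\<^sup>2" if y: "norm (y - z) \<le> norm h" for y
    proof (rule integral_abs_le_ball)
      show "AE w in lebesgue. \<bar>(g w - c0) * K q r (w - y)\<bar> \<le> b * (2 * M / r) * indicator (cball y (2 * r)) w"
        using assms(4)
      proof eventually_elim
        case (elim w)
        show ?case
        proof (cases "norm (w - y) \<le> 2 * r")
          case True
          then have "norm (w - z) \<le> norm h + 2 * r"
            using y norm_triangle_ineq[of "w - y" "y - z"] by simp
          with elim have "\<bar>g w - c0\<bar> \<le> b" by (simp add: dist_norm norm_minus_commute)
          then have "\<bar>g w - c0\<bar> * \<bar>K q r (w - y)\<bar> \<le> b * (2 * M / r)"
            by (intro mult_mono K_le assms) auto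
          with True show ?thesis by (simp add: abs_mult dist_norm norm_minus_commute)
        next
          case False
          then show ?thesis
            using K_zero[OF assms(2), of "w - y"] assms M_pos by (simp add: dist_norm norm_minus_commute)
        qed
      qed
    qed (use assms M_pos in auto)
    from this[of z] this[of "z + h"]
    have "\<bar>?I (z + h) - ?I z\<bar> \<le> 2 * (4 * (b * (2 * M / r)) * (2 * r)\<^sup>2)" by simp
    also have "\<dots> = 64 * (M * b * r)" using assms(2) by (simp add: field_simps power2_eq_square)
    also have "\<dots> \<le> 324 * (M * b * r)" using assms M_pos by (intro mult_right_mono) auto
    finally show ?thesis using False by simp
  qed
  then have "\<bar>c\<bar> * \<bar>?I (z + h) - ?I z\<bar> \<le> 1 * (324 * M * b * min r (norm h))"
    using cq(1) by (intro mult_mono) auto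
  then have *: "\<bar>c\<bar> * \<bar>?I (z + h) - ?I z\<bar> / \<kappa> \<le> 324 * M * b * min r (norm h) / \<kappa>"
    using kappa_pos by (intro divide_right_mono) auto
  have eq: "(moll r f (z + h) - moll (2 * r) f (z + h)) - (moll r f z - moll (2 * r) f z) =
      c / \<kappa> * (?I (z + h) - ?I z)"
    unfolding cq(2) split by (simp add: right_diff_distrib distrib_left)
  show ?thesis
    unfolding eq abs_mult abs_divide using * kappa_pos by simp
qed

lemma moll_close:
  assumes "continuous_on UNIV f" and "r > 0" and "\<And>w. norm (w - z) \<le> r \<Longrightarrow> \<bar>f w - f z\<bar> \<le> e"
  shows "\<bar>moll r f z - f z\<bar> \<le> e"
proof -
  have int: "integrable lebesgue (\<lambda>w. f w * \<rho> r (w - z))" "integrable lebesgue (\<lambda>w. \<rho> r (w - z))"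
    using integrable_rho[OF assms(2,1)] integrable_rho[OF assms(2) continuous_on_const[of _ 1]] by auto
  have "(LINT w|lebesgue. f w * \<rho> r (w - z)) - f z * \<kappa> =
      (LINT w|lebesgue. f w * \<rho> r (w - z)) - (LINT w|lebesgue. f z * \<rho> r (w - z))"
    by (simp add: integral_rho[OF assms(2)])
  also have "\<dots> = (LINT w|lebesgue. (f w - f z) * \<rho> r (w - z))"
    by (subst Bochner_Integration.integral_diff[symmetric]) (use int in \<open>simp_all add: left_diff_distrib right_diff_distrib\<close>)
  also have "\<bar>\<dots>\<bar> \<le> (LINT w|lebesgue. \<bar>(f w - f z) * \<rho> r (w - z)\<bar>)"
    by (rule integral_abs_bound)
  also have "\<dots> \<le> (LINT w|lebesgue. e * \<rho> r (w - z))"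
  proof (rule integral_mono)
    show "integrable lebesgue (\<lambda>w. \<bar>(f w - f z) * \<rho> r (w - z)\<bar>)"
      using int by (intro integrable_abs) (simp add: left_diff_distrib)
    fix w
    show "\<bar>(f w - f z) * \<rho> r (w - z)\<bar> \<le> e * \<rho> r (w - z)"
      using assms(3)[of w] rho_zero[OF assms(2), of "w - z"] rho_nonneg[of r "w - z"]
      by (cases "norm (w - z) \<le> r") (auto simp: abs_mult intro!: mult_right_mono)
  qed (use int in simp)
  also have "\<dots> = e * \<kappa>" by (simp add: integral_rho[OF assms(2)])
  finally have "\<bar>moll r f z * \<kappa> - f z * \<kappa>\<bar> \<le> e * \<kappa>"
    using kappa_pos by (simp add: moll_def)
  then have "\<bar>moll r f z - f z\<bar> * \<kappa> \<le> e * \<kappa>"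
    using kappa_pos by (simp add: abs_mult left_diff_distrib[symmetric])
  then show ?thesis using kappa_pos by simp
qed

text \<open>The q-th partial derivative of \<open>moll r f\<close> at z, with the derivative falling
  on the mollifier. In this form it is an integral to which the weak equations apply
  directly.\<close>

definition slope :: "real \<Rightarrow> (real^2 \<Rightarrow> real) \<Rightarrow> real^2 \<Rightarrow> 2 \<Rightarrow> real" where
  "slope r f z q = - (2 / \<kappa>) *
     (LINT w|lebesgue. f w * ((w - z) $ q * (deriv \<eta> ((norm (w - z))\<^sup>2 / r\<^sup>2) / (r\<^sup>2 * r\<^sup>2))))"

end

section \<open>Taylor expansion of averages and summation over dyadic radii\<close>

lemma smooth1_mvt:
  assumes "smooth1 f"
  shows "\<exists>\<xi>. min a b \<le> \<xi> \<and> \<xi> \<le> max a b \<and> f b - f a = (b - a) * deriv f \<xi>"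
proof -
  consider "a < b" | "b < a" | "a = b" by linarith
  then show ?thesis
  proof cases
    case 1
    then obtain \<xi> where "a < \<xi>" "\<xi> < b" "f b - f a = (b - a) * deriv f \<xi>"
      using MVT2[of a b f "deriv f"] smooth1_deriv(1)[OF assms] by blast
    then show ?thesis by (intro exI[of _ \<xi>]) auto
  next
    case 2
    then obtain \<xi> where "b < \<xi>" "\<xi> < a" "f a - f b = (a - b) * deriv f \<xi>"
      using MVT2[of b a f "deriv f"] smooth1_deriv(1)[OF assms] by blast
    then show ?thesis by (intro exI[of _ \<xi>]) (auto simp: algebra_simps)
  next
    case 3
    then show ?thesis by auto
  qed
qed

lemma telescope_limit_le:
  fixes a :: "nat \<Rightarrow> real"
  assumes "a \<longlonglongrightarrow> L" and "\<And>n. \<bar>a (Suc n) - a n\<bar> \<le> c / 2 ^ Suc n"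
  shows "\<bar>L - a 0\<bar> \<le> c"
proof -
  have "0 \<le> c / 2 ^ Suc 0" by (rule order_trans[OF abs_ge_zero assms(2)])
  then have c: "c \<ge> 0" by simp
  have b: "\<bar>a n - a 0\<bar> \<le> c * (1 - 1 / 2 ^ n)" for n
  proof (induction n)
    case (Suc n)
    have "\<bar>a (Suc n) - a 0\<bar> \<le> c / 2 ^ Suc n + c * (1 - 1 / 2 ^ n)"
      using Suc assms(2)[of n] by linarith
    also have "\<dots> = c * (1 - 1 / 2 ^ Suc n)" by (simp add: field_simps)
    finally show ?case .
  qed simp
  have "\<bar>a n - a 0\<bar> \<le> c" for n
  proof -
    have "c * (1 - 1 / 2 ^ n) \<le> c * 1" using c by (intro mult_left_mono) auto
    with b[of n] show ?thesis by simp
  qed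
  then show ?thesis
    by (intro LIMSEQ_le_const2[of "\<lambda>n. \<bar>a n - a 0\<bar>"]) (use assms(1) in \<open>auto intro!: tendsto_intros\<close>)
qed

lemma integral_lincomb:
  fixes a b c d :: "'a \<Rightarrow> real"
  assumes "integrable N a" "integrable N b" "integrable N c" "integrable N d"
  shows "(LINT w|N. a w - b w + (k * c w + l * d w)) =
    (LINT w|N. a w) - (LINT w|N. b w) + (k * (LINT w|N. c w) + l * (LINT w|N. d w))"
  using assms by simp

context cutoff
begin

lemma eta_taylor:
  assumes "a \<ge> 0" "b \<ge> 0"
  shows "\<bar>\<eta> b - \<eta> a - deriv \<eta> a * (b - a)\<bar> \<le> M * (b - a)\<^sup>2"
proof -
  obtain \<xi> where \<xi>: "min a b \<le> \<xi>" "\<xi> \<le> max a b" "\<eta> b - \<eta> a = (b - a) * deriv \<eta> \<xi>"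
    using smooth1_mvt[OF smooth_eta] by blast
  obtain \<zeta> where \<zeta>: "min a \<xi> \<le> \<zeta>" "deriv \<eta> \<xi> - deriv \<eta> a = (\<xi> - a) * deriv (deriv \<eta>) \<zeta>"
    using smooth1_mvt[OF smooth1_deriv(2)[OF smooth_eta]] by blast
  have "\<zeta> \<ge> 0" using \<zeta>(1) \<xi>(1) assms by linarith
  have "\<bar>\<xi> - a\<bar> \<le> \<bar>b - a\<bar>" using \<xi>(1,2) by linarith
  then have "\<bar>deriv \<eta> \<xi> - deriv \<eta> a\<bar> \<le> \<bar>b - a\<bar> * M"
    unfolding \<zeta>(2) abs_mult using M_bound(3)[OF \<open>\<zeta> \<ge> 0\<close>] by (intro mult_mono) auto
  then have "\<bar>b - a\<bar> * \<bar>deriv \<eta> \<xi> - deriv \<eta> a\<bar> \<le> \<bar>b - a\<bar> * (\<bar>b - a\<bar> * M)"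
    by (intro mult_left_mono) auto
  moreover have "\<eta> b - \<eta> a - deriv \<eta> a * (b - a) = (b - a) * (deriv \<eta> \<xi> - deriv \<eta> a)"
    using \<xi>(3) by (simp add: algebra_simps)
  ultimately show ?thesis
    by (simp add: abs_mult power2_eq_square abs_mult_self_eq mult.commute mult.left_commute)
qed

lemma deriv_eta_zero: "r > 0 \<Longrightarrow> norm v > r \<Longrightarrow> deriv \<eta> ((norm v)\<^sup>2 / r\<^sup>2) = 0"
  using power_strict_mono[of r "norm v" 2] deriv_zero_above[OF smooth_eta eta_zero]
  by (simp add: field_simps)

text \<open>The arguments of \<eta> differ by at most 5|h|/r, so its second order remainder
  contributes 25; the term |h|^2 / r^2 inside that difference, absent from the linear part,
  contributes 1. The ball has radius 2r so that outside it both v and v - h lie beyond the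
  support.\<close>

lemma rho_taylor:
  assumes "r > 0" "norm h \<le> r"
  shows "\<bar>\<rho> r (v - h) - \<rho> r v + 2 * (deriv \<eta> ((norm v)\<^sup>2 / r\<^sup>2) / (r\<^sup>2 * r\<^sup>2) * (v \<bullet> h))\<bar>
    \<le> 26 * M * (norm h)\<^sup>2 / (r\<^sup>2 * r\<^sup>2) * indicator (cball 0 (2 * r)) v"
proof (cases "norm v \<le> 2 * r")
  case True
  define a where "a = (norm v)\<^sup>2 / r\<^sup>2"
  define b where "b = (norm (v - h))\<^sup>2 / r\<^sup>2"
  have eq: "(norm (v - h))\<^sup>2 = (norm v)\<^sup>2 - 2 * (v \<bullet> h) + (norm h)\<^sup>2"
    unfolding power2_norm_eq_inner by (simp add: inner_diff_left inner_diff_right inner_commute)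
  have ba: "b - a = (- 2 * (v \<bullet> h) + (norm h)\<^sup>2) / r\<^sup>2"
    unfolding a_def b_def eq by (simp add: diff_divide_distrib add_divide_distrib)
  have "\<bar>v \<bullet> h\<bar> \<le> 2 * r * norm h"
    using Cauchy_Schwarz_ineq2[of v h] mult_right_mono[OF True, of "norm h"] by simp
  moreover have "(norm h)\<^sup>2 \<le> r * norm h"
    using mult_right_mono[OF assms(2), of "norm h"] by (simp add: power2_eq_square)
  ultimately have "\<bar>- 2 * (v \<bullet> h) + (norm h)\<^sup>2\<bar> \<le> 5 * r * norm h"
    using abs_triangle_ineq[of "- 2 * (v \<bullet> h)" "(norm h)\<^sup>2"] by (simp add: abs_mult)
  then have "\<bar>b - a\<bar> \<le> 5 * r * norm h / r\<^sup>2"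
    unfolding ba abs_divide by (simp add: divide_right_mono)
  then have "(b - a)\<^sup>2 \<le> (5 * r * norm h / r\<^sup>2)\<^sup>2"
    by (metis abs_le_square_iff abs_of_nonneg order.trans abs_ge_zero)
  also have "\<dots> = 25 * (norm h)\<^sup>2 / r\<^sup>2"
    using assms(1) by (simp add: power2_eq_square field_simps)
  finally have "M * (b - a)\<^sup>2 \<le> M * (25 * (norm h)\<^sup>2 / r\<^sup>2)"
    using M_pos by (intro mult_left_mono) auto
  moreover have "\<bar>\<eta> b - \<eta> a - deriv \<eta> a * (b - a)\<bar> \<le> M * (b - a)\<^sup>2"
    by (rule eta_taylor) (simp_all add: a_def b_def)
  ultimately have 1: "\<bar>\<eta> b - \<eta> a - deriv \<eta> a * (b - a)\<bar> \<le> 25 * M * (norm h)\<^sup>2 / r\<^sup>2"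
    by (simp add: mult.commute mult.left_commute)
  have 2: "\<bar>deriv \<eta> a * ((norm h)\<^sup>2 / r\<^sup>2)\<bar> \<le> M * ((norm h)\<^sup>2 / r\<^sup>2)"
    unfolding abs_mult using M_bound(2)[of a] by (intro mult_mono) (auto simp: a_def)
  have "\<rho> r (v - h) - \<rho> r v + 2 * (deriv \<eta> a / (r\<^sup>2 * r\<^sup>2) * (v \<bullet> h)) =
      ((\<eta> b - \<eta> a - deriv \<eta> a * (b - a)) + deriv \<eta> a * ((norm h)\<^sup>2 / r\<^sup>2)) / r\<^sup>2"
    unfolding ba using assms(1) by (simp add: \<rho>_def a_def[symmetric] b_def[symmetric] field_simps)
  also have "\<bar>\<dots>\<bar> = \<bar>(\<eta> b - \<eta> a - deriv \<eta> a * (b - a)) + deriv \<eta> a * ((norm h)\<^sup>2 / r\<^sup>2)\<bar> / r\<^sup>2"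
    by (simp only: abs_divide abs_power2)
  also have "\<dots> \<le> (25 * M * (norm h)\<^sup>2 / r\<^sup>2 + M * ((norm h)\<^sup>2 / r\<^sup>2)) / r\<^sup>2"
    by (rule divide_right_mono) (use 1 2 in linarith, simp)
  also have "\<dots> = 26 * M * (norm h)\<^sup>2 / (r\<^sup>2 * r\<^sup>2)"
    using assms(1) by (simp add: field_simps)
  finally show ?thesis using True by (simp add: a_def)
next
  case False
  have "norm (v - h) \<ge> r" using False assms norm_triangle_ineq2[of v h] by linarith
  moreover have "deriv \<eta> ((norm v)\<^sup>2 / r\<^sup>2) = 0"
    by (rule deriv_eta_zero[OF assms(1)]) (use False assms(1) in linarith)
  ultimately show ?thesis using False assms rho_zero[OF assms(1)] by simp
qed

lemma integrable_slope:
  fixes z :: "real^2"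
  assumes "continuous_on UNIV f" "r > 0"
  shows "integrable lebesgue (\<lambda>w. f w * ((w - z) $ q * (deriv \<eta> ((norm (w - z))\<^sup>2 / r\<^sup>2) / (r\<^sup>2 * r\<^sup>2))))"
proof (rule integrable_continuous_ball[of _ r z])
  show "continuous_on UNIV (\<lambda>w. f w * ((w - z) $ q * (deriv \<eta> ((norm (w - z))\<^sup>2 / r\<^sup>2) / (r\<^sup>2 * r\<^sup>2))))"
    by (intro continuous_on_mult assms smooth2_continuous smooth2.mult smooth2_diff_component
        smooth2.compose[OF smooth1_rescale(1)[OF smooth1_deriv(2)[OF smooth_eta]] smooth2_sqdist])
qed (simp add: deriv_eta_zero assms)

lemma slope_le:
  assumes "continuous_on UNIV f" "r > 0" "S \<ge> 0" "\<And>w. norm (w - z) \<le> 2 * r \<Longrightarrow> \<bar>f w\<bar> \<le> S"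
  shows "\<bar>slope r f z q\<bar> \<le> 64 * M / \<kappa> * S / r"
proof -
  let ?g = "\<lambda>w. f w * ((w - z) $ q * (deriv \<eta> ((norm (w - z))\<^sup>2 / r\<^sup>2) / (r\<^sup>2 * r\<^sup>2)))"
  have "\<bar>LINT w|lebesgue. ?g w\<bar> \<le> 4 * (S * (2 * r * (M / (r\<^sup>2 * r\<^sup>2)))) * (2 * r)\<^sup>2"
  proof (rule integral_abs_le_ball)
    show "AE w in lebesgue. \<bar>?g w\<bar> \<le> S * (2 * r * (M / (r\<^sup>2 * r\<^sup>2))) * indicator (cball z (2 * r)) w"
    proof (rule AE_I2)
      fix w
      show "\<bar>?g w\<bar> \<le> S * (2 * r * (M / (r\<^sup>2 * r\<^sup>2))) * indicator (cball z (2 * r)) w"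
      proof (cases "norm (w - z) \<le> 2 * r")
        case True
        have "\<bar>?g w\<bar> = \<bar>f w\<bar> * (\<bar>(w - z) $ q\<bar> * (\<bar>deriv \<eta> ((norm (w - z))\<^sup>2 / r\<^sup>2)\<bar> / (r\<^sup>2 * r\<^sup>2)))"
          by (simp add: abs_mult)
        also have "\<dots> \<le> S * (2 * r * (M / (r\<^sup>2 * r\<^sup>2)))"
          using component_le_norm_cart[of "w - z" q] True assms M_bound(2) M_pos
          by (intro mult_mono divide_right_mono) auto
        finally show ?thesis using True by (simp add: dist_norm norm_minus_commute)
      next
        case False
        then show ?thesis using deriv_eta_zero[OF assms(2), of "w - z"] assms
          by (simp add: dist_norm norm_minus_commute)
      qed
    qed
  qed (use assms M_pos in auto)
  also have "\<dots> = 32 * M * S / r" using assms(2) by (simp add: field_simps power2_eq_square)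
  finally have "2 / \<kappa> * \<bar>LINT w|lebesgue. ?g w\<bar> \<le> 2 / \<kappa> * (32 * M * S / r)"
    using kappa_pos by (intro mult_left_mono) auto
  then show ?thesis using kappa_pos unfolding slope_def abs_mult by (simp add: abs_mult)
qed

text \<open>All differentiation falls on the mollifier, so only the size of \<open>f\<close> enters:
  the remainder of \<open>rho_taylor\<close> is integrated over an area of at most 16 r^2, and 416 =
  16 * 26.\<close>

lemma moll_taylor:
  assumes "continuous_on UNIV f" "r > 0" "S \<ge> 0" "\<And>w. norm (w - z) \<le> 2 * r \<Longrightarrow> \<bar>f w\<bar> \<le> S"
    and "norm h \<le> r"
  shows "\<bar>moll r f (z + h) - moll r f z - (slope r f z 1 * h $ 1 + slope r f z 2 * h $ 2)\<bar>
    \<le> 416 * M / \<kappa> * S * (norm h)\<^sup>2 / r\<^sup>2"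
proof -
  let ?d = "\<lambda>w. deriv \<eta> ((norm (w - z))\<^sup>2 / r\<^sup>2) / (r\<^sup>2 * r\<^sup>2)"
  let ?T = "\<lambda>w. f w * (\<rho> r (w - z - h) - \<rho> r (w - z) + 2 * (?d w * ((w - z) \<bullet> h)))"
  have int: "integrable lebesgue (\<lambda>w. f w * \<rho> r (w - z - h))" "integrable lebesgue (\<lambda>w. f w * \<rho> r (w - z))"
    using integrable_rho[OF assms(2,1), of "z + h"] integrable_rho[OF assms(2,1), of z]
    by (auto simp: diff_diff_eq)
  note int2 = integrable_slope[OF assms(1,2), of z]
  have "\<bar>LINT w|lebesgue. ?T w\<bar> \<le> 4 * (S * (26 * M * (norm h)\<^sup>2 / (r\<^sup>2 * r\<^sup>2))) * (2 * r)\<^sup>2"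
  proof (rule integral_abs_le_ball)
    show "AE w in lebesgue. \<bar>?T w\<bar> \<le> S * (26 * M * (norm h)\<^sup>2 / (r\<^sup>2 * r\<^sup>2)) * indicator (cball z (2 * r)) w"
    proof (rule AE_I2)
      fix w
      show "\<bar>?T w\<bar> \<le> S * (26 * M * (norm h)\<^sup>2 / (r\<^sup>2 * r\<^sup>2)) * indicator (cball z (2 * r)) w"
      proof (cases "norm (w - z) \<le> 2 * r")
        case True
        have "\<bar>f w\<bar> * \<bar>\<rho> r (w - z - h) - \<rho> r (w - z) + 2 * (?d w * ((w - z) \<bullet> h))\<bar>
            \<le> S * (26 * M * (norm h)\<^sup>2 / (r\<^sup>2 * r\<^sup>2))"
          using rho_taylor[OF assms(2,5), of "w - z"] True assms(3,4)
          by (intro mult_mono) auto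
        then show ?thesis using True unfolding abs_mult by (simp add: dist_norm norm_minus_commute)
      next
        case False
        then have "\<rho> r (w - z - h) - \<rho> r (w - z) + 2 * (?d w * ((w - z) \<bullet> h)) = 0"
          using rho_taylor[OF assms(2,5), of "w - z"] by simp
        then have 0: "?T w = 0" by simp
        show ?thesis
          unfolding 0 abs_zero by (intro mult_nonneg_nonneg) (use assms M_pos in auto)
      qed
    qed
  qed (use assms M_pos in auto)
  also have "\<dots> = 416 * M * S * (norm h)\<^sup>2 / r\<^sup>2"
    using assms(2) by (simp add: field_simps power2_eq_square)
  finally have bound: "\<bar>LINT w|lebesgue. ?T w\<bar> / \<kappa> \<le> 416 * M * S * (norm h)\<^sup>2 / r\<^sup>2 / \<kappa>"
    using kappa_pos by (intro divide_right_mono) auto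
  have "(LINT w|lebesgue. ?T w) = (LINT w|lebesgue. f w * \<rho> r (w - z - h) - f w * \<rho> r (w - z) +
      (2 * h $ 1 * (f w * ((w - z) $ 1 * ?d w)) + 2 * h $ 2 * (f w * ((w - z) $ 2 * ?d w))))"
  proof (rule Bochner_Integration.integral_cong[OF refl])
    fix w
    have gen: "F * (a - b + 2 * (D * (x * k + y * l))) =
        F * a - F * b + (2 * k * (F * (x * D)) + 2 * l * (F * (y * D)))" for F a b D x y k l :: real
      by (simp add: algebra_simps)
    show "?T w = f w * \<rho> r (w - z - h) - f w * \<rho> r (w - z) +
        (2 * h $ 1 * (f w * ((w - z) $ 1 * ?d w)) + 2 * h $ 2 * (f w * ((w - z) $ 2 * ?d w)))"
      unfolding inner_vec_def sum_2 inner_real_def by (rule gen)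
  qed
  also have "\<dots> = (LINT w|lebesgue. f w * \<rho> r (w - z - h)) - (LINT w|lebesgue. f w * \<rho> r (w - z)) +
      (2 * h $ 1 * (LINT w|lebesgue. f w * ((w - z) $ 1 * ?d w)) +
       2 * h $ 2 * (LINT w|lebesgue. f w * ((w - z) $ 2 * ?d w)))"
    by (rule integral_lincomb[OF int int2 int2])
  finally have eq: "(LINT w|lebesgue. ?T w) / \<kappa> =
      moll r f (z + h) - moll r f z - (slope r f z 1 * h $ 1 + slope r f z 2 * h $ 2)"
    using kappa_pos by (simp add: moll_def slope_def diff_diff_eq field_simps)
  have "\<bar>LINT w|lebesgue. ?T w\<bar> / \<kappa> = \<bar>(LINT w|lebesgue. ?T w) / \<kappa>\<bar>"
    using kappa_pos by (simp only: abs_divide abs_of_pos)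
  with bound show ?thesis unfolding eq by (simp add: mult.commute)
qed

text \<open>For |h| \<le> r the quadratic remainder is at most its linear counterpart, and the two
  slope terms add 64 each: 544 = 416 + 128.\<close>

lemma moll_increment_le:
  assumes "continuous_on UNIV f" "r > 0" "S \<ge> 0" "\<And>w. norm (w - z) \<le> 2 * r \<Longrightarrow> \<bar>f w\<bar> \<le> S"
    and "norm h \<le> r"
  shows "\<bar>moll r f (z + h) - moll r f z\<bar> \<le> 544 * M / \<kappa> * S * norm h / r"
proof -
  have s: "\<bar>slope r f z q * h $ q\<bar> \<le> 64 * M / \<kappa> * S / r * norm h" for q
    unfolding abs_mult using slope_le[where z=z and q=q, OF assms(1-4)] component_le_norm_cart[of h q]
      M_pos kappa_pos assms(2,3)
    by (intro mult_mono) auto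
  have "(norm h)\<^sup>2 / r\<^sup>2 \<le> norm h / r"
    using assms(2,5) by (simp add: field_simps power2_eq_square mult_right_mono)
  then have "416 * M / \<kappa> * S * ((norm h)\<^sup>2 / r\<^sup>2) \<le> 416 * M / \<kappa> * S * (norm h / r)"
    using M_pos kappa_pos assms(3) by (intro mult_left_mono) auto
  moreover have "\<bar>moll r f (z + h) - moll r f z - (slope r f z 1 * h $ 1 + slope r f z 2 * h $ 2)\<bar>
      \<le> 416 * M / \<kappa> * S * ((norm h)\<^sup>2 / r\<^sup>2)"
    using moll_taylor[where z=z, OF assms] by simp
  ultimately have "\<bar>moll r f (z + h) - moll r f z\<bar> \<le>
      416 * M / \<kappa> * S * (norm h / r) + 64 * M / \<kappa> * S / r * norm h + 64 * M / \<kappa> * S / r * norm h"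
    using s[of 1] s[of 2] by linarith
  also have "\<dots> = 544 * M / \<kappa> * S * norm h / r" by (simp add: field_simps)
  finally show ?thesis .
qed

lemma moll_tendsto:
  assumes "continuous_on UNIV f" "R > 0"
  shows "(\<lambda>n. moll (R / 2 ^ n) f z) \<longlonglongrightarrow> f z"
proof (rule LIMSEQ_I)
  fix e :: real assume "e > 0"
  then obtain d where d: "d > 0" "\<And>w. dist w z < d \<Longrightarrow> dist (f w) (f z) < e / 2"
    using assms(1) by (metis UNIV_I continuous_on_iff half_gt_zero)
  have "(\<lambda>n. R * (1 / 2) ^ n) \<longlonglongrightarrow> R * 0"
    by (intro tendsto_intros LIMSEQ_power_zero) simp
  then obtain n0 where n0: "\<And>n. n \<ge> n0 \<Longrightarrow> R / 2 ^ n < d"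
    using order_tendstoD(2)[of "\<lambda>n. R * (1 / 2) ^ n" "R * 0" sequentially d] d(1)
    by (auto simp: eventually_sequentially power_divide)
  have "norm (moll (R / 2 ^ n) f z - f z) < e" if "n \<ge> n0" for n
  proof -
    have "\<bar>moll (R / 2 ^ n) f z - f z\<bar> \<le> e / 2"
    proof (rule moll_close[OF assms(1)])
      fix w assume "norm (w - z) \<le> R / 2 ^ n"
      then show "\<bar>f w - f z\<bar> \<le> e / 2"
        using d(2)[of w] n0[OF that] by (simp add: dist_norm less_imp_le)
    qed (use assms in auto)
    then show ?thesis using \<open>e > 0\<close> by simp
  qed
  then show "\<exists>no. \<forall>n\<ge>no. norm (moll (R / 2 ^ n) f z - f z) < e" by blast
qed

lemma represented_moll_le:
  assumes "represented f g N" "N \<ge> 0" "R > 0"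
  shows "\<bar>f z - moll R f z\<bar> \<le> 32 * M / \<kappa> * N * R"
proof -
  have cont: "continuous_on UNIV f" using assms(1) by (simp add: represented_def)
  have "\<bar>f z - moll (R / 2 ^ 0) f z\<bar> \<le> 32 * M / \<kappa> * N * R"
  proof (rule telescope_limit_le[OF moll_tendsto[OF cont assms(3)]])
    fix n
    show "\<bar>moll (R / 2 ^ Suc n) f z - moll (R / 2 ^ n) f z\<bar> \<le> 32 * M / \<kappa> * N * R / 2 ^ Suc n"
      using moll_scale_diff_le[OF assms(1) _ assms(2), of "R / 2 ^ Suc n" z] assms(3) by simp
  qed
  then show ?thesis by simp
qed

text \<open>Below |h| the factor r in \<open>min r (norm h)\<close> makes the scales sum
  geometrically to one term; above |h| every scale costs |h| times the oscillation at that scale.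
  The factor 3 is there because the relevant ball has radius |h| + 2r. Leaving the modulus
  \<open>B\<close> arbitrary serves both the bounded case (constant \<open>B\<close>) and the
  Hoelder case (a power).\<close>

lemma represented_increment_le:
  assumes "represented f g N" "AE w in lebesgue. \<bar>g w - c0\<bar> \<le> B (norm (w - z))"
    and "\<And>s t. 0 \<le> s \<Longrightarrow> s \<le> t \<Longrightarrow> B s \<le> B t" "B 0 \<ge> 0" "h \<noteq> 0"
  shows "\<bar>(f (z + h) - f z) - (moll (2 ^ n * norm h) f (z + h) - moll (2 ^ n * norm h) f z)\<bar>
    \<le> 324 * M / \<kappa> * norm h * (B (3 * norm h) + (\<Sum>j<n. B (3 * (2 ^ j * norm h))))"
proof -
  have cont: "continuous_on UNIV f" using assms(1) by (simp add: represented_def)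
  define d where "d = norm h"
  have d: "d > 0" using assms(5) by (simp add: d_def)
  define a where "a r = moll r f (z + h) - moll r f z" for r
  have C: "324 * M / \<kappa> \<ge> 0" using M_pos kappa_pos by simp
  have B0: "B s \<ge> 0" if "s \<ge> 0" for s using assms(3)[of 0 s] assms(4) that by simp
  have step: "\<bar>a r - a (2 * r)\<bar> \<le> 324 * M / \<kappa> * B t * min r d" if "r > 0" "d + 2 * r \<le> t" for r t
  proof -
    have "AE w in lebesgue. w \<in> cball z (norm h + 2 * r) \<longrightarrow> \<bar>g w - c0\<bar> \<le> B t"
      using assms(2)
    proof eventually_elim
      case (elim w)
      then show ?case
        using assms(3)[of "norm (w - z)" t] that(2) by (auto simp: dist_norm norm_minus_commute d_def)
    qed
    from moll_scale_diff_increment_le[OF assms(1) that(1) B0 this] that d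
    show ?thesis by (simp add: a_def d_def algebra_simps)
  qed
  have down: "\<bar>(f (z + h) - f z) - a (d / 2 ^ 0)\<bar> \<le> 324 * M / \<kappa> * B (3 * d) * d"
  proof (rule telescope_limit_le)
    show "(\<lambda>n. a (d / 2 ^ n)) \<longlonglongrightarrow> f (z + h) - f z"
      unfolding a_def by (intro tendsto_intros moll_tendsto cont d)
    fix n
    have "2 * (d / 2 ^ Suc n) \<le> 2 * d"
      using d one_le_power[of "2::real" n] one_le_power[of "2::real" "Suc n"] by (simp add: field_simps)
    then have "\<bar>a (d / 2 ^ Suc n) - a (2 * (d / 2 ^ Suc n))\<bar> \<le> 324 * M / \<kappa> * B (3 * d) * min (d / 2 ^ Suc n) d"
      using d by (intro step) auto
    also have "\<dots> \<le> 324 * M / \<kappa> * B (3 * d) * (d / 2 ^ Suc n)"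
      using C B0[of "3 * d"] d by (intro mult_left_mono mult_nonneg_nonneg) auto
    finally show "\<bar>a (d / 2 ^ Suc n) - a (d / 2 ^ n)\<bar> \<le> 324 * M / \<kappa> * B (3 * d) * d / 2 ^ Suc n"
      by simp
  qed
  have up: "\<bar>a d - a (2 ^ n * d)\<bar> \<le> 324 * M / \<kappa> * d * (\<Sum>j<n. B (3 * (2 ^ j * d)))"
  proof (induction n)
    case (Suc n)
    have "d \<le> 2 ^ n * d" using d by simp
    then have "\<bar>a (2 ^ n * d) - a (2 * (2 ^ n * d))\<bar> \<le> 324 * M / \<kappa> * B (3 * (2 ^ n * d)) * min (2 ^ n * d) d"
      using d by (intro step) auto
    also have "\<dots> \<le> 324 * M / \<kappa> * B (3 * (2 ^ n * d)) * d"
      using C B0[of "3 * (2 ^ n * d)"] d by (intro mult_left_mono mult_nonneg_nonneg) auto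
    finally have "\<bar>a d - a (2 ^ Suc n * d)\<bar> \<le> 324 * M / \<kappa> * d * (\<Sum>j<n. B (3 * (2 ^ j * d)))
        + 324 * M / \<kappa> * B (3 * (2 ^ n * d)) * d"
      using Suc unfolding power_Suc mult.assoc[of 2 "2 ^ n" d] by linarith
    then show ?case by (simp add: algebra_simps)
  qed simp
  show ?thesis
    using down up by (simp add: a_def d_def[symmetric] algebra_simps)
qed

end

section \<open>Linear growth of the velocity\<close>

text \<open>Counts the dyadic scales between an increment of length d and the distance X to the
  origin, where the sums stop.\<close>

lemma dyadic_exponent:
  assumes "0 < d" "d \<le> 2 * X"
  shows "\<exists>n. X \<le> 2 ^ n * d \<and> 2 ^ n * d \<le> 2 * (X::real)"
proof (cases "X \<le> d")
  case True
  with assms show ?thesis by (intro exI[of _ 0]) simp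
next
  case False
  have ex: "\<exists>n. X \<le> 2 ^ n * d"
  proof -
    obtain n where "X / d < 2 ^ n" using real_arch_pow[of 2 "X / d"] by auto
    then show ?thesis using assms(1) by (intro exI[of _ n]) (simp add: field_simps less_imp_le)
  qed
  define n where "n = (LEAST n. X \<le> 2 ^ n * d)"
  have n: "X \<le> 2 ^ n * d" "\<And>k. k < n \<Longrightarrow> \<not> X \<le> 2 ^ k * d"
    unfolding n_def using LeastI_ex[OF ex] not_less_Least by blast+
  obtain k where k: "n = Suc k" using n(1) False by (cases n) auto
  then have "\<not> X \<le> 2 ^ k * d" using n(2) by blast
  with n(1) k show ?thesis by (intro exI[of _ n]) auto
qed

lemma powr_minus_one_ge:
  assumes "0 < \<gamma>"
  shows "2 powr \<gamma> - 1 \<ge> \<gamma> / (2::real)"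
proof -
  have "\<gamma> / 2 \<le> \<gamma> * ln 2"
    using assms ln2_ge_two_thirds by (simp add: field_simps)
  also have "\<gamma> * ln 2 \<le> exp (\<gamma> * ln 2) - 1"
  proof -
    have "1 + \<gamma> * ln 2 \<le> exp (\<gamma> * ln 2)" by (rule exp_ge_add_one_self)
    then show ?thesis by linarith
  qed
  also have "\<dots> = 2 powr \<gamma> - 1" by (simp add: powr_def)
  finally show ?thesis .
qed

text \<open>A geometric sum of ratio q = 2^\<gamma>, dominated by its last term up to the factor
  1/(q - 1) \<le> 2/\<gamma>. This is the source of the 1/\<gamma> in the Lipschitz bound. The 9 is
  3 * 3: one factor bounds 3^\<gamma>, the other collects the first term (1/\<gamma>) and the sum
  (2/\<gamma>).\<close>

lemma holder_dyadic_sum_le: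
  fixes A :: real
  assumes "0 < \<gamma>" "\<gamma> \<le> 1" "0 < d" "0 < X" "A \<ge> 0"
  shows "A * (3 * d / X) powr \<gamma> + (\<Sum>j<n. A * (3 * (2 ^ j * d) / X) powr \<gamma>)
    \<le> 9 * A / \<gamma> * (2 ^ n * d / X) powr \<gamma>"
proof -
  define q :: real where "q = 2 powr \<gamma>"
  define y where "y = (d / X) powr \<gamma>"
  have q: "q - 1 \<ge> \<gamma> / 2" unfolding q_def using powr_minus_one_ge[OF assms(1)] .
  then have q1: "q > 1" using assms(1) by linarith
  have y: "y \<ge> 0" by (simp add: y_def)
  have qn: "(2 ^ j * d / X) powr \<gamma> = q ^ j * y" for j
  proof -
    have "(2 ^ j * d / X) powr \<gamma> = (2 ^ j * (d / X)) powr \<gamma>" by simp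
    also have "\<dots> = (2 ^ j) powr \<gamma> * y"
      unfolding y_def by (rule powr_mult)
    also have "(2 ^ j :: real) powr \<gamma> = q ^ j"
      using powr_powr[of 2 "real j" \<gamma>] powr_powr[of 2 \<gamma> "real j"]
        powr_realpow[of 2 j] powr_realpow[of "2 powr \<gamma>" j]
      by (simp add: q_def mult.commute)
    finally show ?thesis .
  qed
  have three: "(3 * t / X) powr \<gamma> \<le> 3 * (t / X) powr \<gamma>" if "t > 0" for t
  proof -
    have "(3::real) powr \<gamma> \<le> 3 powr 1" by (rule powr_mono) (use assms in auto)
    then have "3 powr \<gamma> * (t / X) powr \<gamma> \<le> 3 * (t / X) powr \<gamma>"
      by (intro mult_right_mono) auto
    moreover have "3 powr \<gamma> * (t / X) powr \<gamma> = (3 * t / X) powr \<gamma>"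
      using powr_mult[of 3 "t / X" \<gamma>] that assms by simp
    ultimately show ?thesis by simp
  qed
  have t1: "(3 * d / X) powr \<gamma> \<le> 3 * y" unfolding y_def by (rule three[OF assms(3)])
  have t2: "(3 * (2 ^ j * d) / X) powr \<gamma> \<le> 3 * (q ^ j * y)" for j
    using three[of "2 ^ j * d"] assms(3) unfolding qn by simp
  have "A * (3 * d / X) powr \<gamma> + (\<Sum>j<n. A * (3 * (2 ^ j * d) / X) powr \<gamma>)
      \<le> A * (3 * y) + (\<Sum>j<n. A * (3 * (q ^ j * y)))"
    by (intro add_mono sum_mono mult_left_mono t1 t2 assms)
  also have "\<dots> = 3 * A * y * (1 + (\<Sum>j<n. q ^ j))"
    by (simp add: sum_distrib_left algebra_simps)
  also have "\<dots> \<le> 3 * A * y * (q ^ n * (3 / \<gamma>))"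
  proof (rule mult_left_mono)
    have "q ^ n \<ge> 1" using q1 by simp
    have "(\<Sum>j<n. q ^ j) = (q ^ n - 1) / (q - 1)"
      using q1 by (simp add: geometric_sum)
    also have "\<dots> \<le> q ^ n / (\<gamma> / 2)"
      using q q1 \<open>q ^ n \<ge> 1\<close> assms by (intro frac_le) auto
    finally have "(\<Sum>j<n. q ^ j) \<le> q ^ n / (\<gamma> / 2)" .
    moreover have "1 \<le> q ^ n / \<gamma>"
      using \<open>q ^ n \<ge> 1\<close> assms by (simp add: field_simps)
    ultimately have "1 + (\<Sum>j<n. q ^ j) \<le> q ^ n / \<gamma> + q ^ n / (\<gamma> / 2)"
      by linarith
    also have "\<dots> = q ^ n * (3 / \<gamma>)" by (simp add: field_simps)
    finally show "1 + (\<Sum>j<n. q ^ j) \<le> q ^ n * (3 / \<gamma>)" .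
  qed (use assms y in auto)
  also have "\<dots> = 9 * A / \<gamma> * (2 ^ n * d / X) powr \<gamma>"
    unfolding qn by (simp add: field_simps)
  finally show ?thesis .
qed

lemma norm_le_components: "norm x \<le> \<bar>x $ 1\<bar> + \<bar>x $ 2\<bar>" for x :: "real^2"
  using norm_le_l1_cart[of x] by (simp add: sum_2)

lemma norm_rotation: "norm (rotation \<theta> x) = norm x"
proof -
  have "sqdist 0 (rotation \<theta> x) = sqdist 0 x"
  proof -
    have "(c * a - s * b)\<^sup>2 + (s * a + c * b)\<^sup>2 = (c\<^sup>2 + s\<^sup>2) * (a\<^sup>2 + b\<^sup>2)" for a b c s :: real
      by (simp add: power2_eq_square algebra_simps)
    from this[of "cos \<theta>" "x $ 1" "sin \<theta>" "x $ 2"] show ?thesis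
      unfolding sqdist_eq by (simp add: rotation_def)
  qed
  then show ?thesis by simp
qed

text \<open>A trace-free symmetric matrix \<open>S\<close> and a rotation \<open>R\<close> satisfy \<open>S R = R\<^sup>T S\<close>, so that
  \<open>R S - S R = 2 sin \<theta> J S\<close> with an isometry \<open>J\<close>.\<close>

lemma equivariant_symmetric_part_small:
  fixes u :: "real^2 \<Rightarrow> real^2"
  assumes "u (rotation \<theta> z) = rotation \<theta> (u z)" "sin \<theta> \<noteq> 0"
    and "\<And>x. norm x = norm z \<Longrightarrow> \<bar>u x $ 1 - (p * x $ 1 + q * x $ 2)\<bar> \<le> e \<and>
      \<bar>u x $ 2 - (q * x $ 1 - p * x $ 2)\<bar> \<le> e"
  shows "norm (u z) \<le> 6 * e / \<bar>sin \<theta>\<bar>"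
proof -
  define c s where "c = cos \<theta>" and "s = sin \<theta>"
  define a b where "a = p * z $ 1 + q * z $ 2" and "b = q * z $ 1 - p * z $ 2"
  have cs: "\<bar>c\<bar> \<le> 1" "\<bar>s\<bar> \<le> 1" "\<bar>s\<bar> > 0" using assms(2) by (simp_all add: c_def s_def)
  have 1: "\<bar>u z $ 1 - a\<bar> \<le> e" "\<bar>u z $ 2 - b\<bar> \<le> e"
    using assms(3)[of z] by (simp_all add: a_def b_def)
  then have e: "e \<ge> 0" by linarith
  have 2: "\<bar>(c * u z $ 1 - s * u z $ 2) - (c * a + s * b)\<bar> \<le> e"
      "\<bar>(s * u z $ 1 + c * u z $ 2) - (- s * a + c * b)\<bar> \<le> e"
  proof -
    have 3: "\<bar>u (rotation \<theta> z) $ 1 - (p * rotation \<theta> z $ 1 + q * rotation \<theta> z $ 2)\<bar> \<le> e"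
      "\<bar>u (rotation \<theta> z) $ 2 - (q * rotation \<theta> z $ 1 - p * rotation \<theta> z $ 2)\<bar> \<le> e"
      using assms(3)[OF norm_rotation[of \<theta> z]] by auto
    have 4: "p * rotation \<theta> z $ 1 + q * rotation \<theta> z $ 2 = c * a + s * b"
      "q * rotation \<theta> z $ 1 - p * rotation \<theta> z $ 2 = - s * a + c * b"
      "rotation \<theta> (u z) $ 1 = c * u z $ 1 - s * u z $ 2"
      "rotation \<theta> (u z) $ 2 = s * u z $ 1 + c * u z $ 2"
      by (simp_all add: rotation_def c_def s_def a_def b_def algebra_simps)
    show "\<bar>(c * u z $ 1 - s * u z $ 2) - (c * a + s * b)\<bar> \<le> e"
      "\<bar>(s * u z $ 1 + c * u z $ 2) - (- s * a + c * b)\<bar> \<le> e"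
      using 3 unfolding assms(1) 4 .
  qed
  have small: "\<bar>k * t\<bar> \<le> e" if "\<bar>k\<bar> \<le> 1" "\<bar>t\<bar> \<le> e" for k t
    unfolding abs_mult using mult_mono[OF that] e by simp
  note 3 = small[OF cs(1) 1(1)] small[OF cs(2) 1(2)] small[OF cs(2) 1(1)] small[OF cs(1) 1(2)]
  have tri: "\<bar>x - y - z\<bar> \<le> 3 * e" if "\<bar>x\<bar> \<le> e" "\<bar>y\<bar> \<le> e" "\<bar>z\<bar> \<le> e" for x y z :: real
    using that by linarith
  \<comment> \<open>With S the trace-free symmetric matrix and R the rotation, these are, up to
    sign, the components of R S z - S R z. As u(R z) = R u(z), both products approximate the same
    vector, and only error terms remain.\<close>
  have 4: "2 * s * b = c * (u z $ 1 - a) - s * (u z $ 2 - b) - ((c * u z $ 1 - s * u z $ 2) - (c * a + s * b))"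
    "2 * s * a = ((s * u z $ 1 + c * u z $ 2) - (- s * a + c * b)) - s * (u z $ 1 - a) - c * (u z $ 2 - b)"
    by (simp_all add: algebra_simps)
  have "\<bar>2 * s * b\<bar> \<le> 3 * e" "\<bar>2 * s * a\<bar> \<le> 3 * e"
    unfolding 4 by (rule tri[OF 3(1,2) 2(1)], rule tri[OF 2(2) 3(3,4)])
  then have "2 * \<bar>s\<bar> * \<bar>b\<bar> \<le> 3 * e" "2 * \<bar>s\<bar> * \<bar>a\<bar> \<le> 3 * e" by (simp_all add: abs_mult)
  then have ab: "\<bar>b\<bar> \<le> 3 / 2 * (e / \<bar>s\<bar>)" "\<bar>a\<bar> \<le> 3 / 2 * (e / \<bar>s\<bar>)"
    using cs(3) by (simp_all add: field_simps)
  have "e * \<bar>s\<bar> \<le> e * 1" using cs(2) e by (intro mult_left_mono) auto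
  then have "e \<le> e / \<bar>s\<bar>" using cs(3) by (simp add: field_simps)
  with 1 ab norm_le_components[of "u z"] have "norm (u z) \<le> 6 * (e / \<bar>s\<bar>)" by linarith
  then show ?thesis unfolding s_def[symmetric] by simp
qed

definition velocity_data :: "nat \<Rightarrow> (real^2 \<Rightarrow> real^2) \<Rightarrow> (real^2 \<Rightarrow> real) \<Rightarrow> real \<Rightarrow> bool" where
  "velocity_data m u \<omega> N \<longleftrightarrow> is_velocity m \<omega> u \<and> \<omega> \<in> borel_measurable lebesgue \<and>
     (AE x in lebesgue. \<bar>\<omega> x\<bar> \<le> N) \<and> N \<ge> 0"

context cutoff
begin

lemma velocity_data_represented: "velocity_data m u \<omega> N \<Longrightarrow> represented (\<lambda>x. u x $ i) \<omega> N"
  unfolding velocity_data_def is_velocity_def using velocity_represented by blast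

text \<open>The slopes form the gradient matrix of the averaged velocity. Testing the weak equations
  with the mollifier itself shows that its trace vanishes and that its antisymmetric part is the
  averaged vorticity, hence of size N.\<close>

lemma slope_div_curl:
  assumes "velocity_data m u \<omega> N" and "r > 0"
  shows "slope r (\<lambda>x. u x $ 1) z 1 + slope r (\<lambda>x. u x $ 2) z 2 = 0"
    and "\<bar>slope r (\<lambda>x. u x $ 2) z 1 - slope r (\<lambda>x. u x $ 1) z 2\<bar> \<le> 4 * M / \<kappa> * N"
proof -
  have u: "continuous_on UNIV u" "weak_div u (\<lambda>x. 0)" "weak_curl u \<omega>" "AE x in lebesgue. \<bar>\<omega> x\<bar> \<le> N" "N \<ge> 0"
    using assms(1) by (auto simp: velocity_data_def is_velocity_def)
  have cont: "continuous_on UNIV (\<lambda>x. u x $ i)" for i using u(1) by (intro continuous_intros)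
  let ?d = "\<lambda>w. deriv \<eta> ((norm (w - z))\<^sup>2 / r\<^sup>2) / (r\<^sup>2 * r\<^sup>2)"
  have pd: "partial_deriv j (\<lambda>w. \<rho> r (w - z)) w = 2 * ((w - z) $ j * ?d w)" for j w
    unfolding \<rho>_def partial_deriv_radial[OF smooth1_rescale(1)[OF smooth_eta]]
      smooth1_rescale(2)[OF smooth_eta] by simp
  have test: "test_function (\<lambda>w. \<rho> r (w - z))"
    by (rule test_functionI[OF smooth2_rho, of r z]) (simp add: rho_zero assms(2))
  note int = integrable_slope[OF cont assms(2), of _ z]
  let ?I = "\<lambda>i j. LINT w|lebesgue. u w $ i * ((w - z) $ j * ?d w)"
  have "(LINT w|lebesgue. u w $ 1 * (2 * ((w - z) $ 1 * ?d w)) + u w $ 2 * (2 * ((w - z) $ 2 * ?d w))) = 0"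
    using u(2) test unfolding weak_div_def pd[symmetric] by simp
  moreover have "(LINT w|lebesgue. u w $ 1 * (2 * ((w - z) $ 1 * ?d w)) + u w $ 2 * (2 * ((w - z) $ 2 * ?d w))) =
      (LINT w|lebesgue. 0 - 0 + (2 * (u w $ 1 * ((w - z) $ 1 * ?d w)) + 2 * (u w $ 2 * ((w - z) $ 2 * ?d w))))"
    by (simp only: diff_0_right add_0_left mult.left_commute[of _ 2])
  moreover have "\<dots> = (LINT (w::real^2)|lebesgue. 0) - (LINT (w::real^2)|lebesgue. 0) + (2 * ?I 1 1 + 2 * ?I 2 2)"
    by (rule integral_lincomb[OF _ _ int int]) auto
  ultimately have "?I 1 1 + ?I 2 2 = 0" by simp
  then have "- (2 / \<kappa>) * (?I 1 1 + ?I 2 2) = 0" by simp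
  then show "slope r (\<lambda>x. u x $ 1) z 1 + slope r (\<lambda>x. u x $ 2) z 2 = 0"
    unfolding slope_def distrib_left .
  have "(LINT w|lebesgue. u w $ 2 * (2 * ((w - z) $ 1 * ?d w)) - u w $ 1 * (2 * ((w - z) $ 2 * ?d w))) =
      - (LINT w|lebesgue. \<omega> w * \<rho> r (w - z))"
    using u(3) test unfolding weak_curl_def pd[symmetric] by simp
  moreover have "(LINT w|lebesgue. u w $ 2 * (2 * ((w - z) $ 1 * ?d w)) - u w $ 1 * (2 * ((w - z) $ 2 * ?d w))) =
      (LINT w|lebesgue. 0 - 0 + (2 * (u w $ 2 * ((w - z) $ 1 * ?d w)) + (- 2) * (u w $ 1 * ((w - z) $ 2 * ?d w))))"
    by (simp only: diff_0_right add_0_left mult.left_commute[of _ 2] mult_minus_left add_uminus_conv_diff)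
  moreover have "\<dots> = (LINT (w::real^2)|lebesgue. 0) - (LINT (w::real^2)|lebesgue. 0) + (2 * ?I 2 1 + (- 2) * ?I 1 2)"
    by (rule integral_lincomb[OF _ _ int int]) auto
  ultimately have c: "2 * ?I 2 1 - 2 * ?I 1 2 = - (LINT w|lebesgue. \<omega> w * \<rho> r (w - z))" by simp
  have eq: "slope r (\<lambda>x. u x $ 2) z 1 - slope r (\<lambda>x. u x $ 1) z 2 = - (1 / \<kappa>) * (2 * ?I 2 1 - 2 * ?I 1 2)"
  proof -
    have "- (2 / \<kappa>) * X - (- (2 / \<kappa>) * Y) = - (1 / \<kappa>) * (2 * X - 2 * Y)" for X Y
      by (simp add: diff_divide_distrib algebra_simps)
    then show ?thesis unfolding slope_def .
  qed
  have "\<bar>LINT w|lebesgue. \<omega> w * \<rho> r (w - z)\<bar> \<le> 4 * (N * (M / r\<^sup>2)) * r\<^sup>2"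
  proof (rule integral_abs_le_ball)
    show "AE w in lebesgue. \<bar>\<omega> w * \<rho> r (w - z)\<bar> \<le> N * (M / r\<^sup>2) * indicator (cball z r) w"
      using u(4)
    proof eventually_elim
      case (elim w)
      show ?case
      proof (cases "norm (w - z) \<le> r")
        case True
        have "\<bar>\<omega> w\<bar> * \<bar>\<rho> r (w - z)\<bar> \<le> N * (M / r\<^sup>2)"
          by (intro mult_mono elim rho_le assms u) auto
        with True show ?thesis by (simp add: abs_mult dist_norm norm_minus_commute)
      next
        case False
        then show ?thesis
          using rho_zero[OF assms(2), of "w - z"] by (simp add: dist_norm norm_minus_commute)
      qed
    qed
  qed (use assms u M_pos in auto)
  also have "\<dots> = 4 * M * N" using assms(2) by (simp add: field_simps)
  finally have "\<bar>LINT w|lebesgue. \<omega> w * \<rho> r (w - z)\<bar> / \<kappa> \<le> 4 * M * N / \<kappa>"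
    using kappa_pos by (intro divide_right_mono) auto
  then show "\<bar>slope r (\<lambda>x. u x $ 2) z 1 - slope r (\<lambda>x. u x $ 1) z 2\<bar> \<le> 4 * M / \<kappa> * N"
    unfolding eq c using kappa_pos by (simp add: abs_mult)
qed

text \<open>Expansion at the origin through averages of radius R. Replacing \<open>u\<close> by its
  average costs N R at each of the two points (64 = 2 * 32); the Taylor remainder costs C |z|^2 / R
  since |u| \<le> 2 C R on the ball involved (832 = 2 * 416). The second error, the one carrying C,
  improves as R grows.\<close>

lemma velocity_component_le_linear:
  assumes "velocity_data m u \<omega> N" "\<And>x. norm (u x) \<le> C * norm x" "C \<ge> 0" "R > 0" "norm z \<le> R"
  shows "\<bar>u z $ i - (slope R (\<lambda>x. u x $ i) 0 1 * z $ 1 + slope R (\<lambda>x. u x $ i) 0 2 * z $ 2)\<bar>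
    \<le> 64 * (M / \<kappa>) * N * R + 832 * (M / \<kappa>) * C * (norm z)\<^sup>2 / R"
proof -
  have N: "N \<ge> 0" using assms(1) by (simp add: velocity_data_def)
  note rep = velocity_data_represented[OF assms(1), of i]
  have cont: "continuous_on UNIV (\<lambda>x. u x $ i)" using rep by (simp add: represented_def)
  have "u 0 = 0" using assms(2)[of 0] by simp
  have "\<bar>u w $ i\<bar> \<le> C * (2 * R)" if "norm (w - 0) \<le> 2 * R" for w
    using component_le_norm_cart[of "u w" i] assms(2)[of w] mult_left_mono[OF that assms(3)] by simp
  from moll_taylor[where z=0, OF cont assms(4) _ this assms(5)]
  have "\<bar>moll R (\<lambda>x. u x $ i) z - moll R (\<lambda>x. u x $ i) 0 -
      (slope R (\<lambda>x. u x $ i) 0 1 * z $ 1 + slope R (\<lambda>x. u x $ i) 0 2 * z $ 2)\<bar>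
      \<le> 416 * M / \<kappa> * (C * (2 * R)) * (norm z)\<^sup>2 / R\<^sup>2"
    using assms by simp
  also have "\<dots> = 832 * (M / \<kappa>) * C * (norm z)\<^sup>2 / R"
    using assms(4) by (simp add: field_simps power2_eq_square)
  finally show ?thesis
    using represented_moll_le[OF rep N assms(4), of z] represented_moll_le[OF rep N assms(4), of 0]
      \<open>u 0 = 0\<close> by simp
qed

lemma velocity_le_improve:
  assumes "velocity_data m u \<omega> N" "\<And>x. norm (u x) \<le> C * norm x" "C \<ge> 0" "R > 0" "norm z \<le> R"
    and "sin (2 * pi / real m) \<noteq> 0"
  shows "norm (u z) \<le> 6 * (64 * (M / \<kappa>) * N * R + 832 * (M / \<kappa>) * C * (norm z)\<^sup>2 / R
    + 4 * (M / \<kappa>) * N * norm z) / \<bar>sin (2 * pi / real m)\<bar>"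
proof -
  define s where "s i j = slope R (\<lambda>x. u x $ i) 0 j" for i j
  have tr: "s 2 2 = - s 1 1" and cu: "\<bar>s 2 1 - s 1 2\<bar> \<le> 4 * M / \<kappa> * N"
    using slope_div_curl[OF assms(1,4), of 0] by (simp_all add: s_def)
  have eqv: "u (rotation (2 * pi / real m) z) = rotation (2 * pi / real m) (u z)"
    using assms(1) by (simp add: velocity_data_def is_velocity_def mfold_vector_def)
  show ?thesis
  \<comment> \<open>The trace vanishes exactly; replacing the entry \<open>s 2 1\<close> by
    \<open>s 1 2\<close> makes the matrix symmetric at the price of the bounded antisymmetric part,
    the third error term.\<close>
  proof (rule equivariant_symmetric_part_small[where p="s 1 1" and q="s 1 2", OF eqv assms(6)])
    fix x :: "real^2" assume x: "norm x = norm z"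
    have lin: "\<bar>u x $ i - (s i 1 * x $ 1 + s i 2 * x $ 2)\<bar>
        \<le> 64 * (M / \<kappa>) * N * R + 832 * (M / \<kappa>) * C * (norm z)\<^sup>2 / R" for i
      using velocity_component_le_linear[OF assms(1-4), of x i] assms(5) x by (simp add: s_def)
    have "\<bar>(s 2 1 - s 1 2) * x $ 1\<bar> \<le> 4 * M / \<kappa> * N * norm z"
      unfolding abs_mult using cu component_le_norm_cart[of x 1] x by (intro mult_mono) auto
    then have d: "\<bar>(s 2 1 - s 1 2) * x $ 1\<bar> \<le> 4 * (M / \<kappa>) * N * norm z" by simp
    then have "0 \<le> 4 * (M / \<kappa>) * N * norm z" by linarith
    moreover have "u x $ 2 - (s 1 2 * x $ 1 - s 1 1 * x $ 2) =
        (u x $ 2 - (s 2 1 * x $ 1 + s 2 2 * x $ 2)) + (s 2 1 - s 1 2) * x $ 1"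
      unfolding tr by (simp add: algebra_simps)
    ultimately show "\<bar>u x $ 1 - (s 1 1 * x $ 1 + s 1 2 * x $ 2)\<bar> \<le>
          64 * (M / \<kappa>) * N * R + 832 * (M / \<kappa>) * C * (norm z)\<^sup>2 / R + 4 * (M / \<kappa>) * N * norm z \<and>
        \<bar>u x $ 2 - (s 1 2 * x $ 1 - s 1 1 * x $ 2)\<bar> \<le>
          64 * (M / \<kappa>) * N * R + 832 * (M / \<kappa>) * C * (norm z)\<^sup>2 / R + 4 * (M / \<kappa>) * N * norm z"
      using lin[of 1] lin[of 2] d by linarith
  qed
qed

text \<open>A self-improving estimate: any admissible growth constant C may be replaced by D N +
  C/2. Starting from the unspecified constant of \<open>is_velocity\<close>, iteration converges to
  2 D N, which depends on the solution only through N. The condition m \<ge> 3 puts the angle 2 pi /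
  m strictly between 0 and pi, so that its sine is positive.\<close>

lemma velocity_linear_growth:
  assumes "m \<ge> 3"
  shows "\<exists>V>0. \<forall>u \<omega> N. velocity_data m u \<omega> N \<longrightarrow> (\<forall>z. norm (u z) \<le> V * N * norm z)"
proof -
  define \<sigma> where "\<sigma> = sin (2 * pi / real m)"
  have "2 * pi / real m < pi" using assms by (simp add: field_simps)
  then have \<sigma>: "\<sigma> > 0" unfolding \<sigma>_def using assms by (intro sin_gt_zero) auto
  define C0 where "C0 = M / \<kappa>"
  have C0: "C0 > 0" using M_pos kappa_pos by (simp add: C0_def)
  \<comment> \<open>The radius is taken as R = L |z|. Since 9984 = 2 * 6 * 832, this L makes the
    coefficient in front of C at most 1/2.\<close>
  define L where "L = 9984 * C0 / \<sigma> + 1"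
  have L: "L \<ge> 1" "L > 0" using C0 \<sigma> by (simp_all add: L_def add_pos_pos)
  define D where "D = 6 / \<sigma> * (64 * C0 * L + 4 * C0)"
  have D: "D > 0" using C0 \<sigma> L by (simp add: D_def add_pos_pos)
  have half: "6 / \<sigma> * (832 * C0 / L) \<le> 1 / 2"
    using C0 \<sigma> L by (simp add: L_def field_simps)
  have improve: "norm (u z) \<le> (D * N + C / 2) * norm z"
    if v: "velocity_data m u \<omega> N" and C: "\<And>x. norm (u x) \<le> C * norm x" "C \<ge> 0" for u \<omega> N C z
  proof (cases "z = 0")
    case True
    then show ?thesis using C(1)[of z] by simp
  next
    case False
    have "norm z \<le> L * norm z" using L mult_right_mono[of 1 L "norm z"] by simp
    then have "norm (u z) \<le> 6 * (64 * C0 * N * (L * norm z) + 832 * C0 * C * (norm z)\<^sup>2 / (L * norm z)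
        + 4 * C0 * N * norm z) / \<bar>\<sigma>\<bar>"
      using velocity_le_improve[OF v C, of "L * norm z" z] False L \<sigma> by (simp add: C0_def \<sigma>_def)
    also have "\<dots> = (D * N + (6 / \<sigma> * (832 * C0 / L)) * C) * norm z"
      using False L \<sigma> by (simp add: D_def field_simps power2_eq_square)
    also have "\<dots> \<le> (D * N + 1 / 2 * C) * norm z"
      using half C(2) by (intro mult_right_mono add_left_mono) auto
    finally show ?thesis by simp
  qed
  have "norm (u z) \<le> 2 * D * N * norm z" if v: "velocity_data m u \<omega> N" for u \<omega> N z
  proof -
    have N: "N \<ge> 0" using v by (simp add: velocity_data_def)
    obtain C' where C': "\<And>x. norm (u x) \<le> C' * norm x"
      using v by (auto simp: velocity_data_def is_velocity_def)
    define C where "C = \<bar>C'\<bar>"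
    have C: "norm (u x) \<le> C * norm x" for x
      by (rule order_trans[OF C' mult_right_mono]) (auto simp: C_def)
    have it: "norm (u x) \<le> (2 * D * N + C / 2 ^ n) * norm x" for n x
    proof (induction n arbitrary: x)
      case 0
      have "C * norm x \<le> (2 * D * N + C) * norm x" using D N by (intro mult_right_mono) auto
      with C[of x] show ?case by simp
    next
      case (Suc n)
      have "norm (u x) \<le> (D * N + (2 * D * N + C / 2 ^ n) / 2) * norm x"
        by (rule improve[OF v Suc]) (use D N in \<open>auto simp: C_def\<close>)
      moreover have "D * N + (2 * D * N + C / 2 ^ n) / 2 = 2 * D * N + C / 2 ^ Suc n"
        by (simp add: field_simps)
      ultimately show ?case by simp
    qed
    have "(\<lambda>n. (2 * D * N + C * (1 / 2) ^ n) * norm z) \<longlonglongrightarrow> (2 * D * N + C * 0) * norm z"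
      by (intro tendsto_intros LIMSEQ_power_zero) simp
    then show ?thesis
      by (intro LIMSEQ_le_const[where X="\<lambda>n. (2 * D * N + C * (1 / 2) ^ n) * norm z"])
        (use it in \<open>auto simp: power_divide\<close>)
  qed
  with D show ?thesis by (intro exI[of _ "2 * D"]) auto
qed

end

section \<open>Modulus of continuity and difference quotients of the velocity\<close>

context cutoff
begin

text \<open>The sum over scales ends at a radius R = 2^n |h| \<ge> |x|. There the linear growth
  bound controls the velocity by 3 V N R on the ball of radius 2R about x, so the remaining
  increment of the averages is of order N |h|, with 1632 = 3 * 544.\<close>

lemma velocity_increment_le:
  assumes "velocity_data m u \<omega> N" "\<And>z. norm (u z) \<le> V * N * norm z" "V > 0" "h \<noteq> 0"
    and "norm x \<le> 2 ^ n * norm h"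
    and "AE w in lebesgue. \<bar>\<omega> w - b\<bar> \<le> B (norm (w - x))"
    and "\<And>s t. 0 \<le> s \<Longrightarrow> s \<le> t \<Longrightarrow> B s \<le> B t" "B 0 \<ge> 0"
  shows "\<bar>u (x + h) $ i - u x $ i\<bar> \<le> M / \<kappa> * norm h *
    (1632 * V * N + 324 * (B (3 * norm h) + (\<Sum>j<n. B (3 * (2 ^ j * norm h)))))"
proof -
  define R where "R = 2 ^ n * norm h"
  have N: "N \<ge> 0" using assms(1) by (simp add: velocity_data_def)
  have hR: "norm h \<le> R"
    using mult_right_mono[OF one_le_power[of "2::real" n], of "norm h"] by (simp add: R_def)
  have R: "R > 0" using assms(4) by (simp add: R_def)
  note rep = velocity_data_represented[OF assms(1), of i]
  have cont: "continuous_on UNIV (\<lambda>x. u x $ i)" using rep by (simp add: represented_def)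
  have VN: "V * N \<ge> 0" using assms(3) N by simp
  have "\<bar>u w $ i\<bar> \<le> V * N * (3 * R)" if "norm (w - x) \<le> 2 * R" for w
  proof -
    have "norm w \<le> 3 * R"
      using that assms(5) norm_triangle_ineq[of "w - x" x] by (simp add: R_def)
    then have "V * N * norm w \<le> V * N * (3 * R)" using VN by (intro mult_left_mono)
    with assms(2)[of w] component_le_norm_cart[of "u w" i] show ?thesis by linarith
  qed
  from moll_increment_le[where z=x, OF cont R _ this hR] VN R
  have "\<bar>moll R (\<lambda>x. u x $ i) (x + h) - moll R (\<lambda>x. u x $ i) x\<bar>
      \<le> 544 * M / \<kappa> * (V * N * (3 * R)) * norm h / R" by simp
  also have "\<dots> = M / \<kappa> * norm h * (1632 * V * N)" using R by (simp add: field_simps)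
  finally have 1: "\<bar>moll R (\<lambda>x. u x $ i) (x + h) - moll R (\<lambda>x. u x $ i) x\<bar> \<le> M / \<kappa> * norm h * (1632 * V * N)" .
  have "\<bar>(u (x + h) $ i - u x $ i) - (moll R (\<lambda>x. u x $ i) (x + h) - moll R (\<lambda>x. u x $ i) x)\<bar>
      \<le> 324 * M / \<kappa> * norm h * (B (3 * norm h) + (\<Sum>j<n. B (3 * (2 ^ j * norm h))))"
    using represented_increment_le[OF rep assms(6,7,8,4), of n] by (simp add: R_def)
  also have "\<dots> = M / \<kappa> * norm h * (324 * (B (3 * norm h) + (\<Sum>j<n. B (3 * (2 ^ j * norm h)))))"
    by simp
  finally show ?thesis using 1 unfolding distrib_left by linarith
qed

text \<open>With a constant modulus each scale between |h| and |x| contributes N |h|, and there are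
  at most 2 ln (2X/|h|) of them. The expansion is made at the point farther from the origin, which
  guarantees |h| \<le> 2|x|.\<close>

lemma velocity_log_lipschitz:
  assumes "velocity_data m u \<omega> N" "\<And>z. norm (u z) \<le> V * N * norm z" "V > 0"
    and "x \<noteq> y" "norm x \<le> X" "norm y \<le> X"
  shows "norm (u x - u y) \<le> M / \<kappa> * (3264 * V + 1296) * N * norm (x - y) * (1 + ln (2 * X / norm (x - y)))"
proof -
  have *: "norm (u x - u y) \<le> M / \<kappa> * (3264 * V + 1296) * N * norm (x - y) * (1 + ln (2 * X / norm (x - y)))"
    if "norm y \<le> norm x" "x \<noteq> y" "norm x \<le> X" for x y
  proof -
    have N: "N \<ge> 0" and AE: "AE x in lebesgue. \<bar>\<omega> x\<bar> \<le> N"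
      using assms(1) by (simp_all add: velocity_data_def)
    define h where "h = y - x"
    have h: "norm h > 0" "norm (x - y) = norm h" using that(2) by (simp_all add: h_def norm_minus_commute)
    have hx: "norm h \<le> 2 * norm x"
      using norm_triangle_ineq4[of y x] that(1) by (simp add: h_def)
    obtain n where n: "norm x \<le> 2 ^ n * norm h" "2 ^ n * norm h \<le> 2 * norm x"
      using dyadic_exponent[OF h(1) hx] by blast
    define l where "l = ln (2 * X / norm h)"
    have "(2::real) ^ n \<le> 2 * X / norm h" using n(2) that(3) h(1) by (simp add: field_simps)
    then have "ln (2 ^ n :: real) \<le> l" unfolding l_def using h(1)
      by (intro ln_mono) auto
    then have "real n * ln 2 \<le> l" by (simp add: ln_realpow)
    moreover have "real n * (1 / 2) \<le> real n * ln 2"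
      using ln2_ge_two_thirds by (intro mult_left_mono) auto
    ultimately have nl: "real n \<le> 2 * l" by linarith
    then have l: "l \<ge> 0" by linarith
    have C0: "M / \<kappa> \<ge> 0" using M_pos kappa_pos by simp
    have "\<bar>u (x + h) $ i - u x $ i\<bar> \<le> M / \<kappa> * norm h * (N * ((1632 * V + 648) * (1 + l)))" for i
    proof -
      have "\<bar>u (x + h) $ i - u x $ i\<bar> \<le> M / \<kappa> * norm h * (1632 * V * N + 324 * (N + (\<Sum>j<n. N)))"
        by (rule velocity_increment_le[OF assms(1-3) _ n(1), where b=0 and B="\<lambda>_. N"])
          (use AE N h in auto)
      also have "1632 * V * N + 324 * (N + (\<Sum>j<n. N)) = N * (1632 * V + 324 * (1 + real n))"
        by (simp add: algebra_simps)
      also have "M / \<kappa> * norm h * (N * (1632 * V + 324 * (1 + real n))) \<le>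
          M / \<kappa> * norm h * (N * ((1632 * V + 648) * (1 + l)))"
      proof (intro mult_left_mono)
        have "0 \<le> V * l" using l assms(3) by simp
        then show "1632 * V + 324 * (1 + real n) \<le> (1632 * V + 648) * (1 + l)"
          using nl by (simp add: algebra_simps)
      qed (use N h M_pos kappa_pos in auto)
      finally show ?thesis .
    qed
    from this[of 1] this[of 2]
    have "norm (u (x + h) - u x) \<le> 2 * (M / \<kappa> * norm h * (N * ((1632 * V + 648) * (1 + l))))"
      using norm_le_components[of "u (x + h) - u x"] unfolding vector_minus_component by linarith
    also have "\<dots> = M / \<kappa> * (3264 * V + 1296) * N * norm h * (1 + l)"
      by (simp add: algebra_simps add_divide_distrib)
    finally show ?thesis unfolding h l_def[symmetric] by (simp add: norm_minus_commute h_def)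
  qed
  show ?thesis
  proof (cases "norm y \<le> norm x")
    case True
    then show ?thesis using *[of y x] assms by blast
  next
    case False
    then show ?thesis using *[of x y] assms by (simp add: norm_minus_commute)
  qed
qed

lemma AE_holder_modulus:
  assumes "AE w in lebesgue. \<bar>\<omega> w - \<omega> x\<bar> \<le> A * (norm (w - x) / norm x) powr \<gamma>"
    and "0 < \<gamma>" "A \<ge> 0" "x \<noteq> 0"
  defines "B \<equiv> \<lambda>s. A * (s / norm x) powr \<gamma>"
  shows "AE w in lebesgue. \<bar>\<omega> w - \<omega> x\<bar> \<le> B (norm (w - x))"
    "\<And>s t. 0 \<le> s \<Longrightarrow> s \<le> t \<Longrightarrow> B s \<le> B t" "B 0 \<ge> 0"
  using assms by (auto simp: B_def intro!: mult_left_mono powr_mono2 divide_right_mono)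

text \<open>The oscillation grows geometrically with the scale and is of order A at the last one, of
  size about |x|; the whole sum is therefore at most 18 A/\<gamma> and the logarithm
  disappears.\<close>

lemma velocity_lipschitz:
  assumes "velocity_data m u \<omega> N" "\<And>z. norm (u z) \<le> V * N * norm z" "V > 0"
    and "0 < \<gamma>" "\<gamma> \<le> 1" "A \<ge> 0"
    and H: "\<And>x. x \<noteq> 0 \<Longrightarrow> AE w in lebesgue. \<bar>\<omega> w - \<omega> x\<bar> \<le> A * (norm (w - x) / norm x) powr \<gamma>"
  shows "norm (u x - u y) \<le> M / \<kappa> * (3264 * V + 11664) * (N + A / \<gamma>) * norm (x - y)"
proof -
  have *: "norm (u x - u y) \<le> M / \<kappa> * (3264 * V + 11664) * (N + A / \<gamma>) * norm (x - y)"
    if "norm y \<le> norm x" "x \<noteq> y" for x y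
  proof -
    have N: "N \<ge> 0" using assms(1) by (simp_all add: velocity_data_def)
    have "x \<noteq> 0" using that by auto
    define h where "h = y - x"
    have h: "norm h > 0" "norm (x - y) = norm h" using that(2) by (simp_all add: h_def norm_minus_commute)
    have hx: "norm h \<le> 2 * norm x"
      using norm_triangle_ineq4[of y x] that(1) by (simp add: h_def)
    obtain n where n: "norm x \<le> 2 ^ n * norm h" "2 ^ n * norm h \<le> 2 * norm x"
      using dyadic_exponent[OF h(1) hx] by blast
    have C0: "M / \<kappa> \<ge> 0" using M_pos kappa_pos by simp
    have "(2 ^ n * norm h / norm x) powr \<gamma> \<le> 2 powr \<gamma>"
      using n(2) \<open>x \<noteq> 0\<close> assms(4) by (intro powr_mono2) (auto simp: field_simps)
    also have "\<dots> \<le> 2 powr 1" using assms(5) by (intro powr_mono) auto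
    finally have p2: "(2 ^ n * norm h / norm x) powr \<gamma> \<le> 2" by simp
    let ?B = "\<lambda>s. A * (s / norm x) powr \<gamma>"
    have "?B (3 * norm h) + (\<Sum>j<n. ?B (3 * (2 ^ j * norm h))) \<le> 9 * A / \<gamma> * (2 ^ n * norm h / norm x) powr \<gamma>"
      by (rule holder_dyadic_sum_le) (use assms h \<open>x \<noteq> 0\<close> in auto)
    also have "\<dots> \<le> 9 * A / \<gamma> * 2" using p2 assms by (intro mult_left_mono) auto
    finally have S: "?B (3 * norm h) + (\<Sum>j<n. ?B (3 * (2 ^ j * norm h))) \<le> 18 * (A / \<gamma>)" by simp
    have "\<bar>u (x + h) $ i - u x $ i\<bar> \<le> M / \<kappa> * norm h * ((1632 * V + 5832) * (N + A / \<gamma>))" for i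
    proof -
      have "\<bar>u (x + h) $ i - u x $ i\<bar> \<le> M / \<kappa> * norm h *
          (1632 * V * N + 324 * (?B (3 * norm h) + (\<Sum>j<n. ?B (3 * (2 ^ j * norm h)))))"
        by (rule velocity_increment_le[OF assms(1-3) _ n(1)
              AE_holder_modulus[OF H[OF \<open>x \<noteq> 0\<close>] assms(4,6) \<open>x \<noteq> 0\<close>]]) (use h in auto)
      also have "\<dots> \<le> M / \<kappa> * norm h * ((1632 * V + 5832) * (N + A / \<gamma>))"
      proof (rule mult_left_mono)
        have "1632 * V * N + 324 * W \<le> (1632 * V + 5832) * (N + a)" if "W \<le> 18 * a" "a \<ge> 0" for W a
        proof -
          have "0 \<le> V * a" using that assms(3) by simp
          moreover have "(1632 * V + 5832) * (N + a) = 1632 * V * N + 5832 * N + 1632 * (V * a) + 5832 * a"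
            by (simp add: algebra_simps)
          ultimately show ?thesis using that N by linarith
        qed
        from this[OF S] show "1632 * V * N + 324 * (?B (3 * norm h) + (\<Sum>j<n. ?B (3 * (2 ^ j * norm h))))
            \<le> (1632 * V + 5832) * (N + A / \<gamma>)"
          using assms by simp
      qed (use M_pos kappa_pos in simp)
      finally show ?thesis .
    qed
    from this[of 1] this[of 2]
    have "norm (u (x + h) - u x) \<le> 2 * (M / \<kappa> * norm h * ((1632 * V + 5832) * (N + A / \<gamma>)))"
      using norm_le_components[of "u (x + h) - u x"] unfolding vector_minus_component by linarith
    also have "\<dots> = M / \<kappa> * (3264 * V + 11664) * (N + A / \<gamma>) * norm h"
      by (simp add: algebra_simps add_divide_distrib)
    finally show ?thesis unfolding h by (simp add: norm_minus_commute h_def)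
  qed
  show ?thesis
  proof (cases "x = y")
    case False
    then show ?thesis
      using *[of y x] *[of x y] by (cases "norm y \<le> norm x") (auto simp: norm_minus_commute)
  qed simp
qed

text \<open>Provides classical dyadic derivatives at every nonzero point, so that the weak gradient
  can be defined as an explicit limit without appeal to almost everywhere differentiability. The
  quotients are Cauchy because all late ones are close to the slope of a fixed average.\<close>

lemma velocity_partial_derivative_exists:
  assumes "velocity_data m u \<omega> N" "\<And>z. norm (u z) \<le> V * N * norm z" "V > 0"
    and "0 < \<gamma>" "\<gamma> \<le> 1" "A \<ge> 0" "x \<noteq> 0"
    and H: "AE w in lebesgue. \<bar>\<omega> w - \<omega> x\<bar> \<le> A * (norm (w - x) / norm x) powr \<gamma>"
  shows "convergent (\<lambda>n. (u (x + axis j (1 / 2 ^ n)) $ i - u x $ i) * 2 ^ n)"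
proof -
  define D where "D n = (u (x + axis j (1 / 2 ^ n)) $ i - u x $ i) * 2 ^ n" for n
  have N: "N \<ge> 0" using assms(1) by (simp_all add: velocity_data_def)
  note rep = velocity_data_represented[OF assms(1), of i]
  have cont: "continuous_on UNIV (\<lambda>x. u x $ i)" using rep by (simp add: represented_def)
  have VN: "V * N \<ge> 0" using assms(3) N by simp
  have C0: "M / \<kappa> \<ge> 0" using M_pos kappa_pos by simp
  let ?a = "\<lambda>n. axis j (1 / 2 ^ n) :: real^2"
  have na: "norm (?a n) = 1 / 2 ^ n" for n
    by (rule power2_eq_imp_eq) (simp_all add: norm_axis_power2)
  \<comment> \<open>For averages of radius 2^(-J), \<open>\<epsilon> J\<close> is the error of the
    scales below that radius, small for large J and independent of n. The Taylor remainder
    \<open>c J\<close> may blow up with J, but it is divided by 2^n; so J is fixed first and n is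
    sent to infinity afterwards.\<close>
  define \<epsilon> where "\<epsilon> J = 324 * (M / \<kappa>) * (9 * A / \<gamma> * (1 / 2 ^ J / norm x) powr \<gamma>)" for J :: nat
  define c where "c J = 416 * M / \<kappa> * (V * N * (norm x + 2 * (1 / 2 ^ J))) * 4 ^ J" for J :: nat
  define s where "s J = slope (1 / 2 ^ J) (\<lambda>x. u x $ i) x j" for J :: nat
  have approx: "\<bar>D n - s J\<bar> \<le> \<epsilon> J + c J / 2 ^ n" if "J \<le> n" for J n
  proof -
    define r :: real where "r = 1 / 2 ^ J"
    have r: "r > 0" by (simp add: r_def)
    have rn: "2 ^ (n - J) * norm (?a n) = r"
      unfolding na r_def using that by (simp add: power_diff)
    have nar: "norm (?a n) \<le> r" unfolding na r_def using that by (simp add: field_simps)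
    let ?B = "\<lambda>s. A * (s / norm x) powr \<gamma>"
    let ?m = "moll r (\<lambda>x. u x $ i) (x + ?a n) - moll r (\<lambda>x. u x $ i) x"
    have a0: "?a n \<noteq> 0" using na[of n] by (metis norm_zero divide_eq_0_iff power_not_zero zero_neq_numeral zero_neq_one)
    have "\<bar>(u (x + ?a n) $ i - u x $ i) - ?m\<bar> \<le> 324 * M / \<kappa> * norm (?a n) *
        (?B (3 * norm (?a n)) + (\<Sum>j<n - J. ?B (3 * (2 ^ j * norm (?a n)))))"
      using represented_increment_le[OF rep AE_holder_modulus[OF H assms(4,6,7)] a0, of "n - J"]
      unfolding rn by simp
    also have "\<dots> \<le> 324 * M / \<kappa> * norm (?a n) * (9 * A / \<gamma> * (2 ^ (n - J) * norm (?a n) / norm x) powr \<gamma>)"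
      using M_pos kappa_pos a0 assms by (intro mult_left_mono holder_dyadic_sum_le) auto
    also have "\<dots> = \<epsilon> J / 2 ^ n" unfolding rn by (simp add: \<epsilon>_def na r_def)
    finally have 1: "\<bar>(u (x + ?a n) $ i - u x $ i) - ?m\<bar> \<le> \<epsilon> J / 2 ^ n" .
    have "\<bar>u w $ i\<bar> \<le> V * N * (norm x + 2 * r)" if "norm (w - x) \<le> 2 * r" for w
    proof -
      have "norm w \<le> norm x + 2 * r"
        using that norm_triangle_ineq[of "w - x" x] by simp
      then have "V * N * norm w \<le> V * N * (norm x + 2 * r)" using VN by (intro mult_left_mono)
      with assms(2)[of w] component_le_norm_cart[of "u w" i] show ?thesis by linarith
    qed
    from moll_taylor[where z=x, OF cont r _ this nar] VN r
    have "\<bar>?m - (slope r (\<lambda>x. u x $ i) x 1 * ?a n $ 1 + slope r (\<lambda>x. u x $ i) x 2 * ?a n $ 2)\<bar>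
        \<le> 416 * M / \<kappa> * (V * N * (norm x + 2 * r)) * (norm (?a n))\<^sup>2 / r\<^sup>2" by simp
    also have "slope r (\<lambda>x. u x $ i) x 1 * ?a n $ 1 + slope r (\<lambda>x. u x $ i) x 2 * ?a n $ 2 = s J / 2 ^ n"
      using exhaust_2[of j] by (auto simp: axis_def s_def r_def)
    also have "416 * M / \<kappa> * (V * N * (norm x + 2 * r)) * (norm (?a n))\<^sup>2 / r\<^sup>2 = c J / 2 ^ n / 2 ^ n"
    proof -
      have "(norm (?a n))\<^sup>2 / r\<^sup>2 = 4 ^ J / 2 ^ n / 2 ^ n"
        unfolding na r_def by (simp add: power2_eq_square power_mult_distrib[symmetric])
      then show ?thesis unfolding c_def r_def[symmetric] by (simp add: times_divide_eq_right[symmetric] del: times_divide_eq_right)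
    qed
    finally have 2: "\<bar>?m - s J / 2 ^ n\<bar> \<le> c J / 2 ^ n / 2 ^ n" .
    have "\<bar>(u (x + ?a n) $ i - u x $ i) - s J / 2 ^ n\<bar> \<le> \<epsilon> J / 2 ^ n + c J / 2 ^ n / 2 ^ n"
      using 1 2 by linarith
    then have "\<bar>(u (x + ?a n) $ i - u x $ i) - s J / 2 ^ n\<bar> * 2 ^ n \<le> (\<epsilon> J / 2 ^ n + c J / 2 ^ n / 2 ^ n) * 2 ^ n"
      by (intro mult_right_mono) auto
    moreover have "\<bar>D n - s J\<bar> = \<bar>(u (x + ?a n) $ i - u x $ i) - s J / 2 ^ n\<bar> * 2 ^ n"
    proof -
      have "D n - s J = ((u (x + ?a n) $ i - u x $ i) - s J / 2 ^ n) * 2 ^ n"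
        by (simp add: D_def left_diff_distrib)
      then show ?thesis by (simp add: abs_mult)
    qed
    moreover have "(\<epsilon> J / 2 ^ n + c J / 2 ^ n / 2 ^ n) * 2 ^ n = \<epsilon> J + c J / 2 ^ n"
      by (simp add: distrib_right)
    ultimately show ?thesis by linarith
  qed
  have half: "(\<lambda>n. (1 / 2) ^ n :: real) \<longlonglongrightarrow> 0" by (rule LIMSEQ_power_zero) simp
  have "(\<lambda>J. 324 * (M / \<kappa>) * (9 * A / \<gamma> * ((1 / 2) ^ J / norm x) powr \<gamma>))
      \<longlonglongrightarrow> 324 * (M / \<kappa>) * (9 * A / \<gamma> * (0 / norm x) powr \<gamma>)"
    by (intro tendsto_intros tendsto_powr2 half) (use assms in \<open>auto intro!: always_eventually\<close>)
  then have \<epsilon>0: "\<epsilon> \<longlonglongrightarrow> 0" by (simp add: \<epsilon>_def[abs_def] power_divide)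
  have "Cauchy D"
  proof (rule CauchyI)
    fix e :: real assume e: "e > 0"
    obtain J where J: "\<epsilon> J < e / 4"
      using order_tendstoD(2)[OF \<epsilon>0, of "e / 4"] e by (auto simp: eventually_sequentially)
    have "(\<lambda>n. c J * (1 / 2) ^ n) \<longlonglongrightarrow> c J * 0" by (intro tendsto_intros half)
    then obtain n0 where n0: "\<And>n. n \<ge> n0 \<Longrightarrow> c J / 2 ^ n < e / 4"
      using order_tendstoD(2)[of "\<lambda>n. c J * (1 / 2) ^ n" "c J * 0" sequentially "e / 4"] e
      by (auto simp: eventually_sequentially power_divide)
    have "norm (D k - D n) < e" if "k \<ge> max n0 J" "n \<ge> max n0 J" for k n
    proof -
      have "J \<le> k" "J \<le> n" "n0 \<le> k" "n0 \<le> n" using that by auto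
      then have "\<bar>D k - s J\<bar> < e / 2" "\<bar>D n - s J\<bar> < e / 2"
        using approx[of J k] approx[of J n] n0[of k] n0[of n] J by linarith+
      then show ?thesis unfolding real_norm_def by linarith
    qed
    then show "\<exists>K. \<forall>m\<ge>K. \<forall>n\<ge>K. norm (D m - D n) < e" by blast
  qed
  then show ?thesis unfolding D_def[symmetric] by (simp add: Cauchy_convergent_iff)
qed

end

text \<open>Bundles the estimates with one constant depending on m alone and free of the cut-off
  functions, so that the dynamical part can be carried out without reference to the
  mollifiers.\<close>

definition velocity_bound :: "nat \<Rightarrow> real \<Rightarrow> bool" where
  "velocity_bound m C \<longleftrightarrow> (\<forall>u \<omega> N. velocity_data m u \<omega> N \<longrightarrow>
    (\<forall>z. norm (u z) \<le> C * N * norm z) \<and>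
    (\<forall>x y X. x \<noteq> y \<longrightarrow> norm x \<le> X \<longrightarrow> norm y \<le> X \<longrightarrow>
       norm (u x - u y) \<le> C * N * norm (x - y) * (1 + ln (2 * X / norm (x - y)))) \<and>
    (\<forall>\<gamma> A. 0 < \<gamma> \<longrightarrow> \<gamma> \<le> 1 \<longrightarrow> A \<ge> 0 \<longrightarrow>
       (\<forall>x. x \<noteq> 0 \<longrightarrow> (AE w in lebesgue. \<bar>\<omega> w - \<omega> x\<bar> \<le> A * (norm (w - x) / norm x) powr \<gamma>)) \<longrightarrow>
       (\<forall>x y. norm (u x - u y) \<le> C * (N + A / \<gamma>) * norm (x - y)) \<and>
       (\<forall>x i j. x \<noteq> 0 \<longrightarrow> convergent (\<lambda>n. (u (x + axis j (1 / 2 ^ n)) $ i - u x $ i) * 2 ^ n))))"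

lemma velocity_bound_exists:
  assumes "m \<ge> 3"
  shows "\<exists>C>0. velocity_bound m C"
proof -
  obtain \<eta> \<psi> where "cutoff \<eta> \<psi>" using cutoff_exists by blast
  then interpret cutoff \<eta> \<psi> .
  obtain V where V: "V > 0" "\<And>u \<omega> N z. velocity_data m u \<omega> N \<Longrightarrow> norm (u z) \<le> V * N * norm z"
    using velocity_linear_growth[OF assms] by blast
  define C1 C2 where "C1 = M / \<kappa> * (3264 * V + 1296)" and "C2 = M / \<kappa> * (3264 * V + 11664)"
  have C: "C1 > 0" "C2 > 0" using V M_pos kappa_pos by (simp_all add: C1_def C2_def add_pos_pos)
  define C where "C = V + C1 + C2"
  have CC: "V \<le> C" "C1 \<le> C" "C2 \<le> C" "C > 0" using C V(1) by (simp_all add: C_def)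
  show ?thesis
    unfolding velocity_bound_def
  proof (intro exI[of _ C] conjI allI impI CC(4))
    fix u \<omega> N
    assume v: "velocity_data m u \<omega> N"
    then have N: "N \<ge> 0" by (simp add: velocity_data_def)
    note V' = V(2)[OF v]
    show "norm (u z) \<le> C * N * norm z" for z
      by (rule order_trans[OF V']) (intro mult_right_mono CC N norm_ge_zero)
    show "norm (u x - u y) \<le> C * N * norm (x - y) * (1 + ln (2 * X / norm (x - y)))"
      if "x \<noteq> y" "norm x \<le> X" "norm y \<le> X" for x y X
    proof -
      have "norm (x - y) \<le> 2 * X" using norm_triangle_ineq4[of x y] that by simp
      then have "2 * X / norm (x - y) \<ge> 1" using that(1) by simp
      then have "ln (2 * X / norm (x - y)) \<ge> 0" by simp
      then show ?thesis
        by (intro order_trans[OF velocity_log_lipschitz[OF v V' V(1) that]] mult_right_mono)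
          (use CC N in \<open>simp_all add: C1_def\<close>)
    qed
    fix \<gamma> A :: real
    assume \<gamma>: "0 < \<gamma>" "\<gamma> \<le> 1" "A \<ge> 0"
      and H: "\<forall>x. x \<noteq> 0 \<longrightarrow> (AE w in lebesgue. \<bar>\<omega> w - \<omega> x\<bar> \<le> A * (norm (w - x) / norm x) powr \<gamma>)"
    show "norm (u x - u y) \<le> C * (N + A / \<gamma>) * norm (x - y)" for x y
      by (intro order_trans[OF velocity_lipschitz[OF v V' V(1) \<gamma>]] mult_right_mono)
        (use CC N \<gamma> H in \<open>simp_all add: C2_def\<close>)
    show "convergent (\<lambda>n. (u (x + axis j (1 / 2 ^ n)) $ i - u x $ i) * 2 ^ n)" if "x \<noteq> 0" for x i j
      using velocity_partial_derivative_exists[OF v V' V(1) \<gamma> that] H that by blast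
  qed
qed

section \<open>Weak gradients of Lipschitz fields\<close>

lemma norm_axis_dyadic: "norm (axis j (1 / 2 ^ n) :: real^2) = 1 / 2 ^ n"
  by (rule power2_eq_imp_eq) (simp_all add: norm_axis_power2)

lemma locally_integrable_bounded:
  assumes "f \<in> borel_measurable lebesgue" "\<And>x. \<bar>f x\<bar> \<le> B"
  shows "locally_integrable f"
  unfolding locally_integrable_def set_integrable_def
proof (intro allI impI)
  fix K :: "(real^2) set" assume "compact K"
  then have K: "K \<in> lmeasurable" by (rule lmeasurable_compact)
  show "integrable lebesgue (\<lambda>x. indicator K x *\<^sub>R f x)"
  proof (rule Bochner_Integration.integrable_bound)
    show "integrable lebesgue (\<lambda>x. B * indicator K x :: real)"
      using K by (intro integrable_mult_right integrable_real_indicator)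
        (auto simp: fmeasurable_def)
    show "AE x in lebesgue. norm (indicator K x *\<^sub>R f x) \<le> norm (B * indicator K x :: real)"
      using assms(2) by (intro AE_I2) (auto simp: indicator_def intro: order_trans[OF _ abs_ge_self])
  qed (use assms(1) K in \<open>auto simp: fmeasurable_def\<close>)
qed

lemma locally_integrable_continuous:
  assumes "continuous_on UNIV f"
  shows "locally_integrable f"
  unfolding locally_integrable_def set_integrable_def
proof (intro allI impI)
  fix K :: "(real^2) set" assume K: "compact K"
  have "integrable lborel (\<lambda>x. indicator K x *\<^sub>R f x)"
    by (rule borel_integrable_compact[OF K continuous_on_subset[OF assms]]) simp
  then show "integrable lebesgue (\<lambda>x. indicator K x *\<^sub>R f x)"
    by (subst integrable_completion) (auto dest: borel_measurable_integrable)
qed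

lemma test_function_partial_deriv:
  assumes "test_function \<phi>"
  shows "continuous_on UNIV \<phi>" "continuous_on UNIV (partial_deriv j \<phi>)"
    "((\<lambda>t. \<phi> (x + axis j t)) has_real_derivative partial_deriv j \<phi> (x + axis j t)) (at t)"
    "\<exists>R. \<forall>x. norm x > R \<longrightarrow> \<phi> x = 0 \<and> partial_deriv j \<phi> x = 0"
proof -
  have C: "C_k k \<phi>" for k using assms by (simp add: test_function_def)
  have diff: "\<phi> differentiable (at x)" for x
    using C[of "Suc 0"] by (simp add: differentiable_on_def)
  show "continuous_on UNIV \<phi>" using C[of 0] by simp
  show "continuous_on UNIV (partial_deriv j \<phi>)" using C[of "Suc 0"] by simp
  have D: "(\<phi> has_derivative frechet_derivative \<phi> (at x)) (at x)" for x
    using diff frechet_derivative_works by blast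
  show "((\<lambda>t. \<phi> (x + axis j t)) has_real_derivative partial_deriv j \<phi> (x + axis j t)) (at t)"
  proof -
    have ax: "axis j t = t *\<^sub>R axis j 1" for t :: real
      by (simp add: vec_eq_iff axis_def)
    have "((\<lambda>t. x + t *\<^sub>R axis j 1) has_derivative (\<lambda>s. 0 + s *\<^sub>R axis j 1)) (at t)"
      by (intro has_derivative_add has_derivative_const has_derivative_scaleR_left has_derivative_ident)
    then have "((\<lambda>t. x + t *\<^sub>R axis j 1) has_derivative (\<lambda>s. s *\<^sub>R axis j 1)) (at t)" by simp
    from diff_chain_at[OF this D]
    have "((\<lambda>t. \<phi> (x + t *\<^sub>R axis j 1)) has_derivative
        (\<lambda>s. frechet_derivative \<phi> (at (x + t *\<^sub>R axis j 1)) (s *\<^sub>R axis j 1))) (at t)"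
      by (simp add: o_def)
    moreover have "frechet_derivative \<phi> (at (x + t *\<^sub>R axis j 1)) (s *\<^sub>R axis j 1) =
        partial_deriv j \<phi> (x + t *\<^sub>R axis j 1) * s" for s
      unfolding partial_deriv_def linear_scale[OF has_derivative_linear[OF D]] by simp
    ultimately have "((\<lambda>t. \<phi> (x + t *\<^sub>R axis j 1)) has_real_derivative
        partial_deriv j \<phi> (x + t *\<^sub>R axis j 1)) (at t)"
      unfolding has_field_derivative_def by (simp only:)
    then show ?thesis unfolding ax[symmetric] .
  qed
  have "compact (closure {x. \<phi> x \<noteq> 0})"
    using assms by (simp add: test_function_def)
  from bounded_subset_ballD[OF compact_imp_bounded[OF this], of 0]
  obtain R where "closure {x. \<phi> x \<noteq> 0} \<subseteq> ball 0 R" by auto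
  then have R: "closure {x. \<phi> x \<noteq> 0} \<subseteq> cball 0 R"
    by (rule order_trans) (rule ball_subset_cball)
  have z: "\<phi> x = 0" if "norm x > R" for x
  proof (rule ccontr)
    assume "\<phi> x \<noteq> 0"
    then have "x \<in> {x. \<phi> x \<noteq> 0}" by simp
    then have "x \<in> cball 0 R" by (rule subsetD[OF R, OF subsetD[OF closure_subset]])
    with that show False by simp
  qed
  have z': "partial_deriv j \<phi> x = 0" if "norm x > R" for x
  proof -
    have "((\<lambda>x. 0) has_derivative (\<lambda>h. 0)) (at x)" by simp
    then have "(\<phi> has_derivative (\<lambda>h. 0)) (at x)"
    proof (rule has_derivative_transform_within_open)
      show "open (- cball (0 :: real^2) R)" by (simp add: open_Compl)
      show "x \<in> - cball 0 R" using that by simp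
    qed (simp add: z)
    from partial_deriv_eq[OF this] show ?thesis .
  qed
  show "\<exists>R. \<forall>x. norm x > R \<longrightarrow> \<phi> x = 0 \<and> partial_deriv j \<phi> x = 0"
    using z z' by metis
qed

text \<open>Discrete integration by parts: translation invariance moves the difference quotient from
  \<open>f\<close> to the test function, and dominated convergence is applied on both sides, with
  the Lipschitz bound of \<open>f\<close> on one and the bounded derivative of the test function on
  the other.\<close>

lemma weak_partial_derivative:
  fixes f g :: "real^2 \<Rightarrow> real"
  assumes "\<And>x y. \<bar>f x - f y\<bar> \<le> L * norm (x - y)"
    and "\<And>x. x \<noteq> 0 \<Longrightarrow> (\<lambda>n. (f (x + axis j (1 / 2 ^ n)) - f x) * 2 ^ n) \<longlonglongrightarrow> g x"
    and "g \<in> borel_measurable lebesgue" and "continuous_on UNIV f" and "test_function \<phi>"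
  shows "(LINT x|lebesgue. f x * partial_deriv j \<phi> x) = - (LINT x|lebesgue. g x * \<phi> x)"
proof -
  note \<phi> = test_function_partial_deriv(1-3)[OF assms(5)]
  note pd = \<phi>(2)[of j]
  let ?a = "\<lambda>n. axis j (1 / 2 ^ n) :: real^2"
  obtain R where R: "\<And>x. norm x > R \<Longrightarrow> \<phi> x = 0" "\<And>x. norm x > R \<Longrightarrow> partial_deriv j \<phi> x = 0"
    using test_function_partial_deriv(4)[OF assms(5), of j] by blast
  have meas: "h \<in> borel_measurable lebesgue" if "continuous_on UNIV h" for h :: "real^2 \<Rightarrow> real"
    using borel_measurable_continuous_onI[OF that] by (simp add: measurable_completion)
  obtain B where B: "\<And>x. \<bar>partial_deriv j \<phi> x\<bar> \<le> B"
  proof -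
    have "bounded (partial_deriv j \<phi> ` cball 0 R)"
      by (intro compact_imp_bounded compact_continuous_image continuous_on_subset[OF pd]) auto
    then obtain b where b: "\<And>x. norm x \<le> R \<Longrightarrow> \<bar>partial_deriv j \<phi> x\<bar> \<le> b"
      unfolding bounded_iff by (auto; fastforce)
    have "\<bar>partial_deriv j \<phi> x\<bar> \<le> max b 0" for x
      using b[of x] R(2)[of x] by (cases "norm x \<le> R") auto
    with that show ?thesis by blast
  qed
  \<comment> \<open>The quotient produced by the shift in the opposite direction; it tends to minus
    the partial derivative. As the shift has length at most 1, all of these are supported in the
    ball of radius R + 1.\<close>
  define E where "E n x = (\<phi> (x + axis j (- (1 / 2 ^ n))) - \<phi> x) * 2 ^ n" for n x
  have E_le: "\<bar>E n x\<bar> \<le> B" for n x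
  proof -
    have "\<exists>t. - (1 / 2 ^ n) < t \<and> t < 0 \<and> \<phi> (x + axis j 0) - \<phi> (x + axis j (- (1 / 2 ^ n))) =
        (0 - - (1 / 2 ^ n)) * partial_deriv j \<phi> (x + axis j t)"
      by (rule MVT2[where f="\<lambda>t. \<phi> (x + axis j t)"]) (use \<phi>(3) in auto)
    then obtain t where "\<phi> (x + axis j 0) - \<phi> (x + axis j (- (1 / 2 ^ n))) = 1 / 2 ^ n * partial_deriv j \<phi> (x + axis j t)"
      by auto
    moreover have "axis j 0 = (0 :: real^2)" by (simp add: vec_eq_iff axis_def)
    ultimately have "E n x = - partial_deriv j \<phi> (x + axis j t)" by (simp add: E_def field_simps)
    then show ?thesis using B by simp
  qed
  have E_zero: "E n x = 0" if "norm x > R + 1" for n x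
  proof -
    have "axis j (- (1 / 2 ^ n)) = - ?a n" by (simp add: vec_eq_iff axis_def)
    then have "norm (axis j (- (1 / 2 ^ n)) :: real^2) \<le> 1" by (simp add: norm_axis_dyadic)
    then have "norm (x + axis j (- (1 / 2 ^ n))) > R"
      using that norm_triangle_ineq2[of x "- axis j (- (1 / 2 ^ n))"] by simp
    then show ?thesis using R(1) that by (simp add: E_def)
  qed
  have E_lim: "(\<lambda>n. E n x) \<longlonglongrightarrow> - partial_deriv j \<phi> x" for x
  proof -
    have "((\<lambda>h. (\<phi> (x + axis j (0 + h)) - \<phi> (x + axis j 0)) / h) \<longlongrightarrow> partial_deriv j \<phi> (x + axis j 0)) (at 0)"
      using \<phi>(3)[of x j 0] unfolding DERIV_def .
    moreover have "filterlim (\<lambda>n. - (1 / 2 ^ n) :: real) (at 0) sequentially"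
    proof -
      have "(\<lambda>n. - ((1 / 2) ^ n) :: real) \<longlonglongrightarrow> - 0" by (intro tendsto_intros LIMSEQ_power_zero) simp
      then show ?thesis by (simp add: filterlim_at power_divide)
    qed
    ultimately have "(\<lambda>n. (\<phi> (x + axis j (0 + - (1 / 2 ^ n))) - \<phi> (x + axis j 0)) / (- (1 / 2 ^ n)))
        \<longlonglongrightarrow> partial_deriv j \<phi> (x + axis j 0)"
      by (rule filterlim_compose)
    moreover have "axis j 0 = (0 :: real^2)" by (simp add: vec_eq_iff axis_def)
    ultimately have "(\<lambda>n. - E n x) \<longlonglongrightarrow> partial_deriv j \<phi> x" by (simp add: E_def)
    from tendsto_minus[OF this] show ?thesis by simp
  qed
  have E_cont: "continuous_on UNIV (E n)" for n
  proof -
    have "continuous_on UNIV (\<lambda>x. \<phi> (x + axis j (- (1 / 2 ^ n))))"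
      by (rule continuous_on_compose2[OF \<phi>(1)]) (auto intro!: continuous_intros)
    then show ?thesis unfolding E_def[abs_def] by (intro continuous_on_mult continuous_on_diff \<phi>(1) continuous_on_const)
  qed
  have 1: "(\<lambda>n. LINT x|lebesgue. f x * E n x) \<longlonglongrightarrow> (LINT x|lebesgue. f x * - partial_deriv j \<phi> x)"
  proof (rule integral_dominated_convergence)
    show "integrable lebesgue (\<lambda>x. indicator (cball 0 (R + 1)) x *\<^sub>R (\<bar>f x\<bar> * B))"
    proof -
      have "continuous_on UNIV (\<lambda>x. \<bar>f x\<bar> * B)" using assms(4) by (intro continuous_intros)
      from locally_integrable_continuous[OF this] show ?thesis
        unfolding locally_integrable_def set_integrable_def by (simp add: compact_cball)
    qed
    show "AE x in lebesgue. (\<lambda>n. f x * E n x) \<longlonglongrightarrow> f x * - partial_deriv j \<phi> x"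
      by (intro AE_I2 tendsto_intros E_lim)
    show "AE x in lebesgue. norm (f x * E n x) \<le> indicator (cball 0 (R + 1)) x *\<^sub>R (\<bar>f x\<bar> * B)" for n
    proof (intro AE_I2)
      fix x
      show "norm (f x * E n x) \<le> indicator (cball 0 (R + 1)) x *\<^sub>R (\<bar>f x\<bar> * B)"
        using E_le[of n x] E_zero[of x n] by (cases "norm x \<le> R + 1") (auto simp: abs_mult mult_left_mono)
    qed
  qed (intro meas continuous_on_mult continuous_on_minus assms(4) pd E_cont)+
  have int_f\<phi>: "integrable lebesgue (\<lambda>x. f x * \<phi> x)"
    by (rule integrable_continuous_ball[of _ R 0]) (auto intro!: continuous_intros assms(4) \<phi>(1) simp: R)
  have f_shift: "continuous_on UNIV (\<lambda>x. f (x + ?a n))" for n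
    by (rule continuous_on_compose2[OF assms(4)]) (auto intro!: continuous_intros)
  have int_f\<phi>': "integrable lebesgue (\<lambda>x. f (x + ?a n) * \<phi> x)" for n
    by (rule integrable_continuous_ball[of _ R 0])
      (auto intro!: continuous_on_mult f_shift \<phi>(1) simp: R)
  have int_f\<phi>'': "integrable lebesgue (\<lambda>x. f x * \<phi> (x + axis j (- (1 / 2 ^ n))))" for n
  proof -
    have "(\<lambda>x. f x * \<phi> (x + axis j (- (1 / 2 ^ n)))) = (\<lambda>x. f x * E n x * (1 / 2 ^ n) + f x * \<phi> x)"
      by (simp add: E_def fun_eq_iff algebra_simps)
    moreover have "integrable lebesgue (\<lambda>x. f x * E n x * (1 / 2 ^ n))"
      by (rule integrable_continuous_ball[of _ "R + 1" 0]) (auto intro!: continuous_intros assms(4) E_cont simp: E_zero)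
    ultimately show ?thesis using int_f\<phi> by simp
  qed
  have shift: "(LINT x|lebesgue. ((f (x + ?a n) - f x) * 2 ^ n) * \<phi> x) = (LINT x|lebesgue. f x * E n x)" for n
  proof -
    have neg: "axis j (- (1 / 2 ^ n)) = - ?a n" by (simp add: vec_eq_iff axis_def)
    have m: "(\<lambda>x. f x * \<phi> (x + axis j (- (1 / 2 ^ n)))) \<in> borel_measurable borel"
      by (intro borel_measurable_continuous_onI continuous_on_mult assms(4) continuous_on_compose2[OF \<phi>(1)])
        (auto intro!: continuous_intros)
    have "(LINT x|lebesgue. f (x + ?a n) * \<phi> x) = (LINT x|lebesgue. f x * \<phi> (x + axis j (- (1 / 2 ^ n))))"
      using lebesgue_integral_translate[OF m, of "?a n"] unfolding neg by simp
    then have "2 ^ n * (LINT x|lebesgue. f (x + ?a n) * \<phi> x) - 2 ^ n * (LINT x|lebesgue. f x * \<phi> x) =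
        2 ^ n * (LINT x|lebesgue. f x * \<phi> (x + axis j (- (1 / 2 ^ n)))) - 2 ^ n * (LINT x|lebesgue. f x * \<phi> x)"
      by simp
    moreover have "(LINT x|lebesgue. ((f (x + ?a n) - f x) * 2 ^ n) * \<phi> x) =
        (LINT x|lebesgue. 2 ^ n * (f (x + ?a n) * \<phi> x) - 2 ^ n * (f x * \<phi> x))"
      by (simp add: algebra_simps)
    moreover have "(LINT x|lebesgue. f x * E n x) =
        (LINT x|lebesgue. 2 ^ n * (f x * \<phi> (x + axis j (- (1 / 2 ^ n)))) - 2 ^ n * (f x * \<phi> x))"
      by (simp add: E_def algebra_simps)
    ultimately show ?thesis using int_f\<phi> int_f\<phi>' int_f\<phi>'' by simp
  qed
  have 2: "(\<lambda>n. LINT x|lebesgue. ((f (x + ?a n) - f x) * 2 ^ n) * \<phi> x) \<longlonglongrightarrow> (LINT x|lebesgue. g x * \<phi> x)"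
  proof (rule integral_dominated_convergence)
    show "integrable lebesgue (\<lambda>x. L * \<bar>\<phi> x\<bar>)"
    proof -
      have "integrable lebesgue \<phi>"
        by (rule integrable_continuous_ball[of _ R 0]) (auto simp: R \<phi>(1))
      then show ?thesis by (intro integrable_mult_right integrable_abs)
    qed
    have "AE x in lebesgue. x \<noteq> (0 :: real^2)"
      by (rule AE_I[where N="{0}"]) auto
    then show "AE x in lebesgue. (\<lambda>n. ((f (x + ?a n) - f x) * 2 ^ n) * \<phi> x) \<longlonglongrightarrow> g x * \<phi> x"
      by eventually_elim (intro tendsto_intros assms(2))
    show "AE x in lebesgue. norm (((f (x + ?a n) - f x) * 2 ^ n) * \<phi> x) \<le> L * \<bar>\<phi> x\<bar>" for n
    proof (intro AE_I2)
      fix x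
      have "\<bar>f (x + ?a n) - f x\<bar> * 2 ^ n \<le> L * (1 / 2 ^ n) * 2 ^ n"
        using assms(1)[of "x + ?a n" x] by (intro mult_right_mono) (auto simp: norm_axis_dyadic)
      then have "\<bar>f (x + ?a n) - f x\<bar> * 2 ^ n * \<bar>\<phi> x\<bar> \<le> L * \<bar>\<phi> x\<bar>" by (intro mult_right_mono) auto
      then show "norm (((f (x + ?a n) - f x) * 2 ^ n) * \<phi> x) \<le> L * \<bar>\<phi> x\<bar>" by (simp add: abs_mult)
    qed
  qed (intro borel_measurable_times assms(3) meas continuous_on_mult continuous_on_diff
      f_shift assms(4) \<phi>(1) continuous_on_const)+
  have "(LINT x|lebesgue. f x * - partial_deriv j \<phi> x) = (LINT x|lebesgue. g x * \<phi> x)"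
    by (rule LIMSEQ_unique[OF 1]) (use 2 shift in simp)
  then show ?thesis by simp
qed

lemma weak_gradient_exists:
  assumes "\<And>x y. norm (u x - u y) \<le> L * norm (x - y)" "L \<ge> 0"
    and "\<And>x i j. x \<noteq> 0 \<Longrightarrow> convergent (\<lambda>n. (u (x + axis j (1 / 2 ^ n)) $ i - u x $ i) * 2 ^ n)"
  shows "\<exists>G. weak_gradient u G \<and> Linfty_norm G \<le> ereal (4 * L)"
proof -
  define D where "D i j n x = (u (x + axis j (1 / 2 ^ n)) $ i - u x $ i) * 2 ^ n" for i j :: 2 and n x
  \<comment> \<open>At the origin the quotients may diverge; the value 0 on this null set keeps
    \<open>g\<close> measurable and bounded by L everywhere.\<close>
  define g where "g i j x = (if x = 0 then 0 else lim (\<lambda>n. D i j n x))" for i j x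
  define G :: "real^2 \<Rightarrow> real^2^2" where "G x = (\<chi> i j. g i j x)" for x
  have lip: "\<bar>u x $ i - u y $ i\<bar> \<le> L * norm (x - y)" for x y i
    using component_le_norm_cart[of "u x - u y" i] assms(1)[of x y] by simp
  have "continuous_on UNIV u"
    using assms(1,2) by (intro lipschitz_on_continuous_on[of L] lipschitz_onI) (auto simp: dist_norm)
  then have cont: "continuous_on UNIV (\<lambda>x. u x $ i)" for i by (intro continuous_intros)
  have lim: "(\<lambda>n. D i j n x) \<longlonglongrightarrow> g i j x" if "x \<noteq> 0" for i j x
    using assms(3)[OF that] that by (simp add: g_def D_def convergent_LIMSEQ_iff)
  have D_le: "\<bar>D i j n x\<bar> \<le> L" for i j n x
  proof -
    have "\<bar>D i j n x\<bar> \<le> (L * (1 / 2 ^ n)) * 2 ^ n"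
      unfolding D_def abs_mult using lip[of "x + axis j (1 / 2 ^ n)" i x]
      by (intro mult_mono) (auto simp: norm_axis_dyadic)
    then show ?thesis by simp
  qed
  have g_le: "\<bar>g i j x\<bar> \<le> L" for i j x
  proof (cases "x = 0")
    case False
    show ?thesis
      by (rule LIMSEQ_le_const2[OF tendsto_rabs[OF lim[OF False]]]) (use D_le in auto)
  qed (simp add: g_def assms(2))
  have D_meas: "D i j n \<in> borel_measurable borel" for i j n
  proof -
    have "continuous_on UNIV (\<lambda>x. u (x + axis j (1 / 2 ^ n)) $ i)"
      by (rule continuous_on_compose2[OF cont]) (auto intro!: continuous_intros)
    then show ?thesis
      unfolding D_def[abs_def]
      by (intro borel_measurable_continuous_onI continuous_on_mult continuous_on_diff cont continuous_on_const)
  qed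
  have g_meas_borel: "g i j \<in> borel_measurable borel" for i j
    unfolding g_def[abs_def] by (intro measurable_If borel_measurable_lim_metric D_meas) auto
  then have g_meas: "g i j \<in> borel_measurable lebesgue" for i j
    by (simp add: measurable_completion)
  have G_meas: "G \<in> borel_measurable lebesgue"
  proof (subst borel_measurable_euclidean_space, rule ballI)
    fix b :: "real^2^2" assume "b \<in> Basis"
    then obtain i j where b: "b = axis i (axis j 1)" by (auto simp: Basis_vec_def)
    show "(\<lambda>x. G x \<bullet> b) \<in> borel_measurable lebesgue"
      using g_meas[of i j] unfolding b by (simp add: inner_axis G_def)
  qed
  have "norm (G x) \<le> 4 * L" for x
  proof -
    have "norm (G x) \<le> (\<Sum>i\<in>UNIV. norm (G x $ i))" by (simp add: norm_vec_def L2_set_le_sum)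
    also have "\<dots> \<le> \<bar>g 1 1 x\<bar> + \<bar>g 1 2 x\<bar> + (\<bar>g 2 1 x\<bar> + \<bar>g 2 2 x\<bar>)"
      using norm_le_components[of "G x $ 1"] norm_le_components[of "G x $ 2"] by (simp add: sum_2 G_def)
    also have "\<dots> \<le> 4 * L" using g_le[of 1 1 x] g_le[of 1 2 x] g_le[of 2 1 x] g_le[of 2 2 x] by simp
    finally show ?thesis .
  qed
  then have "Linfty_norm G \<le> ereal (4 * L)"
    unfolding Linfty_norm_def using G_meas by (auto intro!: esssup_I)
  moreover have "weak_gradient u G"
    unfolding weak_gradient_def
  proof (intro allI conjI impI)
    fix i j
    show "locally_integrable (\<lambda>x. u x $ i)" by (rule locally_integrable_continuous[OF cont])
    show "locally_integrable (\<lambda>x. G x $ i $ j)"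
      using locally_integrable_bounded[OF g_meas g_le] by (simp add: G_def)
    fix \<phi> assume "test_function \<phi>"
    then have "(LINT x|lebesgue. u x $ i * partial_deriv j \<phi> x) = - (LINT x|lebesgue. g i j x * \<phi> x)"
      by (intro weak_partial_derivative[of _ L] lip g_meas cont lim[unfolded D_def])
    then show "(LINT x|lebesgue. u x $ i * partial_deriv j \<phi> x) = - (LINT x|lebesgue. G x $ i $ j * \<phi> x)"
      by (simp add: G_def)
  qed
  ultimately show ?thesis by blast
qed

section \<open>Differential inequalities\<close>

text \<open>The derivatives of a \<open>flow_map\<close> are taken within {0..}. At positive times
  this is the two-sided derivative, and at the end points only continuity is used.\<close>

lemma deriv_within_nonpos_imp_le:
  assumes "\<And>t. 0 \<le> t \<Longrightarrow> t \<le> T \<Longrightarrow> (f has_real_derivative f' t) (at t within {0..})"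
    and "\<And>t. 0 \<le> t \<Longrightarrow> t \<le> T \<Longrightarrow> f' t \<le> 0" and "0 \<le> T"
  shows "f T \<le> (f 0 :: real)"
proof (rule DERIV_nonpos_imp_decreasing_open[OF assms(3)])
  fix t assume t: "0 < t" "t < T"
  then have "at t within {0..} = at t" by (intro at_within_interior) auto
  then show "\<exists>y. (f has_real_derivative y) (at t) \<and> y \<le> 0"
    using assms(1,2)[of t] t by auto
next
  show "continuous_on {0..T} f"
  proof (rule continuous_on_eq_continuous_within[THEN iffD2], rule ballI)
    fix t assume t: "t \<in> {0..T}"
    then have "continuous (at t within {0..}) f"
      using assms(1)[of t] DERIV_continuous by auto
    then show "continuous (at t within {0..T}) f"
      by (rule continuous_within_subset) auto
  qed
qed

lemma norm_power2_has_derivative: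
  fixes a :: "real \<Rightarrow> real^2"
  assumes "(a has_vector_derivative a') (at t within S)"
  shows "((\<lambda>t. (norm (a t))\<^sup>2) has_real_derivative 2 * (a t \<bullet> a')) (at t within S)"
proof -
  have "((\<lambda>t. a t \<bullet> a t) has_derivative (\<lambda>h. a t \<bullet> (h *\<^sub>R a') + (h *\<^sub>R a') \<bullet> a t)) (at t within S)"
    using assms unfolding has_vector_derivative_def by (intro has_derivative_inner)
  then show ?thesis
    unfolding power2_norm_eq_inner has_field_derivative_def
    by (rule has_derivative_eq_rhs) (simp add: fun_eq_iff inner_commute)
qed

text \<open>Gronwall for the squared norm, which stays differentiable where the curve vanishes,
  weighted with exp(-2Ct) and exp(2Ct). The sign \<open>k\<close> in the derivative formula turns
  the second, increasing quantity into a decreasing one.\<close>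

lemma growth_bounds:
  fixes a a' :: "real \<Rightarrow> real^2"
  assumes a: "\<And>t. 0 \<le> t \<Longrightarrow> t \<le> T \<Longrightarrow> (a has_vector_derivative a' t) (at t within {0..})"
    and b: "\<And>t. 0 \<le> t \<Longrightarrow> t \<le> T \<Longrightarrow> norm (a' t) \<le> C * norm (a t)" and T: "0 \<le> T"
  shows "norm (a T) \<le> exp (C * T) * norm (a 0)" "norm (a 0) \<le> exp (C * T) * norm (a T)"
proof -
  have ip: "\<bar>a t \<bullet> a' t\<bar> \<le> C * (norm (a t))\<^sup>2" if "0 \<le> t" "t \<le> T" for t
  proof -
    have "\<bar>a t \<bullet> a' t\<bar> \<le> norm (a t) * norm (a' t)" by (rule Cauchy_Schwarz_ineq2)
    also have "\<dots> \<le> norm (a t) * (C * norm (a t))" using b[OF that] by (intro mult_left_mono) auto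
    finally show ?thesis by (simp add: power2_eq_square mult.left_commute)
  qed
  have D: "((\<lambda>t. k * (norm (a t))\<^sup>2 * exp (c * t)) has_real_derivative
      k * (2 * (a t \<bullet> a' t) + c * (norm (a t))\<^sup>2) * exp (c * t)) (at t within {0..})"
    if "0 \<le> t" "t \<le> T" for t k c
  proof -
    have "((\<lambda>t. exp (c * t)) has_real_derivative exp (c * t) * c) (at t within {0..})"
      using DERIV_chain2[OF DERIV_exp DERIV_cmult[OF DERIV_ident, of c]] by simp
    from DERIV_mult[OF DERIV_cmult[OF norm_power2_has_derivative[OF a[OF that]], of k] this]
    show ?thesis by (simp add: algebra_simps)
  qed
  have "1 * (norm (a T))\<^sup>2 * exp (- 2 * C * T) \<le> 1 * (norm (a 0))\<^sup>2 * exp (- 2 * C * 0)"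
  proof (rule deriv_within_nonpos_imp_le[OF D[where k=1 and c="- 2 * C"] _ T])
    fix t assume "0 \<le> t" "t \<le> T"
    then have "2 * (a t \<bullet> a' t) + (- 2 * C) * (norm (a t))\<^sup>2 \<le> 0" using abs_le_D1[OF ip[of t]] by simp
    then show "1 * (2 * (a t \<bullet> a' t) + (- 2 * C) * (norm (a t))\<^sup>2) * exp ((- 2 * C) * t) \<le> 0"
      unfolding mult_1 by (rule mult_nonpos_nonneg) simp
  qed
  then have "(norm (a T))\<^sup>2 \<le> (norm (a 0))\<^sup>2 * exp (2 * C * T)"
    by (simp add: exp_minus field_simps)
  also have "\<dots> = (exp (C * T) * norm (a 0))\<^sup>2"
    by (simp add: power_mult_distrib exp_double[symmetric] mult.commute mult.left_commute)
  finally show "norm (a T) \<le> exp (C * T) * norm (a 0)"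
    by (rule power2_le_imp_le) simp
  have "(- 1) * (norm (a T))\<^sup>2 * exp (2 * C * T) \<le> (- 1) * (norm (a 0))\<^sup>2 * exp (2 * C * 0)"
  proof (rule deriv_within_nonpos_imp_le[OF D[where k="- 1" and c="2 * C"] _ T])
    fix t assume "0 \<le> t" "t \<le> T"
    then have "0 \<le> 2 * (a t \<bullet> a' t) + 2 * C * (norm (a t))\<^sup>2" using abs_le_D2[OF ip[of t]] by simp
    then show "- 1 * (2 * (a t \<bullet> a' t) + 2 * C * (norm (a t))\<^sup>2) * exp (2 * C * t) \<le> 0"
      by (intro mult_nonpos_nonneg[where b="exp (2 * C * t)"]) auto
  qed
  then have "(norm (a 0))\<^sup>2 \<le> (norm (a T))\<^sup>2 * exp (2 * C * T)" by simp
  also have "\<dots> = (exp (C * T) * norm (a T))\<^sup>2"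
    by (simp add: power_mult_distrib exp_double[symmetric] mult.commute mult.left_commute)
  finally show "norm (a 0) \<le> exp (C * T) * norm (a T)"
    by (rule power2_le_imp_le) simp
qed

text \<open>Osgood's argument: \<open>l = ln (4 X e\<^bsup>Ct\<^esup> / |a|)\<close> satisfies \<open>l' \<le> 5 C l\<close>.\<close>

lemma osgood_bound:
  fixes a a' :: "real \<Rightarrow> real^2"
  assumes a: "\<And>t. 0 \<le> t \<Longrightarrow> t \<le> T \<Longrightarrow> (a has_vector_derivative a' t) (at t within {0..})"
    and b: "\<And>t. 0 \<le> t \<Longrightarrow> t \<le> T \<Longrightarrow>
      norm (a' t) \<le> C * norm (a t) * (1 + ln (2 * (X * exp (C * t)) / norm (a t)))"
    and nz: "\<And>t. 0 \<le> t \<Longrightarrow> t \<le> T \<Longrightarrow> a t \<noteq> 0"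
    and le: "\<And>t. 0 \<le> t \<Longrightarrow> t \<le> T \<Longrightarrow> norm (a t) \<le> 2 * (X * exp (C * t))"
    and T: "0 \<le> T" and X: "X > 0" and C: "C \<ge> 0"
  shows "norm (a 0) \<le> 4 * X * (norm (a T) / (4 * (X * exp (C * T)))) powr exp (- (5 * C * T))"
proof -
  \<comment> \<open>The logarithm of the squared norm is differentiated without taking a root. The
    factor 4, twice that of the velocity bound, keeps l \<ge> ln 2 > 1/2.\<close>
  define l where "l t = ln (4 * X) + C * t - ln ((norm (a t))\<^sup>2) / 2" for t
  define l' where "l' t = C - (a t \<bullet> a' t) / (norm (a t))\<^sup>2" for t
  have l_eq: "l t = ln (2 * (X * exp (C * t)) / norm (a t)) + ln 2" if "0 \<le> t" "t \<le> T" for t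
  proof -
    have n: "norm (a t) > 0" using nz[OF that] by simp
    have 1: "ln (4 * X) = ln 2 + (ln 2 + ln X)"
      using ln_mult_pos[of 2 "2 * X"] ln_mult_pos[of 2 X] X by simp
    have 2: "ln ((norm (a t))\<^sup>2) = 2 * ln (norm (a t))" by (simp add: ln_realpow)
    have "ln (2 * (X * exp (C * t)) / norm (a t)) = ln (2 * (X * exp (C * t))) - ln (norm (a t))"
      by (rule ln_divide_pos) (use X n in auto)
    also have "ln (2 * (X * exp (C * t))) = ln 2 + (ln X + C * t)"
      using ln_mult_pos[of 2 "X * exp (C * t)"] ln_mult_pos[of X "exp (C * t)"] X by simp
    finally show ?thesis unfolding l_def 1 2 by simp
  qed
  have l_ge: "l t \<ge> 1 / 2" if "0 \<le> t" "t \<le> T" for t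
  proof -
    have "ln (2 * (X * exp (C * t)) / norm (a t)) \<ge> 0"
      using le[OF that] nz[OF that] X by (intro ln_ge_zero) (simp add: field_simps)
    then show ?thesis using l_eq[OF that] ln2_ge_two_thirds by linarith
  qed
  have l'_le: "l' t \<le> 5 * C * l t" if "0 \<le> t" "t \<le> T" for t
  proof -
    have n: "norm (a t) > 0" using nz[OF that] by simp
    have "\<bar>a t \<bullet> a' t\<bar> \<le> norm (a t) * norm (a' t)" by (rule Cauchy_Schwarz_ineq2)
    also have "\<dots> \<le> norm (a t) * (C * norm (a t) * (1 + ln (2 * (X * exp (C * t)) / norm (a t))))"
      using b[OF that] by (intro mult_left_mono) auto
    also have "\<dots> \<le> norm (a t) * (C * norm (a t) * (1 + l t))"
      using l_eq[OF that] C by (intro mult_left_mono) auto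
    also have "\<dots> = C * (1 + l t) * (norm (a t))\<^sup>2" by (simp add: power2_eq_square)
    finally have "\<bar>a t \<bullet> a' t\<bar> / (norm (a t))\<^sup>2 \<le> C * (1 + l t)"
      using n by (simp add: divide_le_eq)
    moreover have "- ((a t \<bullet> a' t) / (norm (a t))\<^sup>2) \<le> \<bar>a t \<bullet> a' t\<bar> / (norm (a t))\<^sup>2"
      using abs_ge_minus_self[of "(a t \<bullet> a' t) / (norm (a t))\<^sup>2"] by (simp only: abs_divide abs_power2)
    ultimately have "l' t \<le> C + C * (1 + l t)"
      unfolding l'_def by linarith
    also have "\<dots> = C * (2 + l t)" by (simp add: algebra_simps)
    \<comment> \<open>From l \<ge> 1/2 follows 2 \<le> 4 l; this is the origin of the 5.\<close>
    also have "\<dots> \<le> C * (5 * l t)" using l_ge[OF that] C by (intro mult_left_mono) auto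
    finally show ?thesis by simp
  qed
  have D: "((\<lambda>t. l t * exp (- (5 * C) * t)) has_real_derivative
      (l' t - 5 * C * l t) * exp (- (5 * C) * t)) (at t within {0..})" if "0 \<le> t" "t \<le> T" for t
  proof -
    have n: "(norm (a t))\<^sup>2 > 0" using nz[OF that] by simp
    note d2 = norm_power2_has_derivative[OF a[OF that]]
    have d3: "((\<lambda>t. ln ((norm (a t))\<^sup>2)) has_real_derivative
        inverse ((norm (a t))\<^sup>2) * (2 * (a t \<bullet> a' t))) (at t within {0..})"
      by (rule DERIV_chain2[where f=ln and g="\<lambda>t. (norm (a t))\<^sup>2", OF DERIV_ln[OF n] d2])
    have d4: "((\<lambda>t. ln (4 * X) + C * t - ln ((norm (a t))\<^sup>2) / 2) has_real_derivative
        0 + C * 1 - inverse ((norm (a t))\<^sup>2) * (2 * (a t \<bullet> a' t)) / 2) (at t within {0..})"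
      by (rule DERIV_diff[OF DERIV_add[OF DERIV_const DERIV_cmult[OF DERIV_ident]] DERIV_cdivide[OF d3]])
    have l_fun: "(\<lambda>t. ln (4 * X) + C * t - ln ((norm (a t))\<^sup>2) / 2) = l"
      by (simp add: l_def fun_eq_iff)
    have l'_eq: "0 + C * 1 - inverse ((norm (a t))\<^sup>2) * (2 * (a t \<bullet> a' t)) / 2 = l' t"
    proof -
      have "0 + C * 1 - inverse p * (2 * w) / 2 = C - w / p" for p w
        by (cases "p = 0") (simp_all add: field_simps)
      then show ?thesis unfolding l'_def .
    qed
    have l': "(l has_real_derivative l' t) (at t within {0..})"
      using d4 unfolding l_fun l'_eq .
    have "((\<lambda>t. - (5 * C) * t) has_real_derivative - (5 * C) * 1) (at t within {0..})"
      by (rule DERIV_cmult[OF DERIV_ident])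
    then have e: "((\<lambda>t. exp (- (5 * C) * t)) has_real_derivative exp (- (5 * C) * t) * (- (5 * C) * 1)) (at t within {0..})"
      by (rule DERIV_chain2[where f=exp and g="\<lambda>t. - (5 * C) * t", OF DERIV_exp])
    have eq: "p * E + E * (- (5 * C) * 1) * q = (p - 5 * C * q) * E" for p q E
      by (simp add: algebra_simps)
    show ?thesis by (rule DERIV_cong[OF DERIV_mult[OF l' e] eq])
  qed
  have "l T * exp (- (5 * C) * T) \<le> l 0 * exp (- (5 * C) * 0)"
    by (rule deriv_within_nonpos_imp_le[OF D _ T]) (use l'_le in \<open>auto intro!: mult_nonpos_nonneg\<close>)
  then have lT: "exp (- (5 * C * T)) * l T \<le> l 0" by (simp add: mult.commute)
  have a0: "norm (a 0) > 0" and aT: "norm (a T) > 0" using nz T by auto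
  have ln_a: "ln (norm (a t) / (4 * (X * exp (C * t)))) = - l t" if "0 \<le> t" "t \<le> T" for t
  proof -
    have n: "norm (a t) > 0" using nz[OF that] by simp
    have "ln (norm (a t) / (4 * (X * exp (C * t)))) = ln (norm (a t)) - ln (4 * X * exp (C * t))"
      using ln_divide_pos[OF n, of "4 * X * exp (C * t)"] X by (simp add: mult.assoc)
    also have "ln (4 * X * exp (C * t)) = ln (4 * X) + C * t"
      using ln_mult_pos[of "4 * X" "exp (C * t)"] X by simp
    finally show ?thesis unfolding l_def by (simp add: ln_realpow)
  qed
  define y where "y = (norm (a T) / (4 * (X * exp (C * T)))) powr exp (- (5 * C * T))"
  have y: "y > 0" using aT X by (simp add: y_def)
  have "ln (norm (a 0) / (4 * X)) \<le> ln y"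
    using lT ln_a[of 0] ln_a[of T] T by (simp add: y_def)
  then have "norm (a 0) / (4 * X) \<le> y"
    using a0 X y by (subst (asm) ln_le_cancel_iff) auto
  then have "norm (a 0) \<le> 4 * X * y" using X by (simp add: field_simps)
  then show ?thesis unfolding y_def .
qed

section \<open>The scale invariant Hoelder condition\<close>

text \<open>After division by a + b both fractions lie in [0, 1], where t \<le> t^\<alpha>.\<close>

lemma powr_subadditive:
  fixes a b :: real
  assumes "a \<ge> 0" "b \<ge> 0" "0 < \<alpha>" "\<alpha> \<le> 1"
  shows "(a + b) powr \<alpha> \<le> a powr \<alpha> + b powr \<alpha>"
proof (cases "a + b = 0")
  case False
  then have s: "a + b > 0" using assms by simp
  have *: "t \<le> t powr \<alpha>" if "0 \<le> t" "t \<le> 1" for t :: real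
    using that assms powr_mono'[of \<alpha> 1 t] by (cases "t = 0") auto
  have "1 = a / (a + b) + b / (a + b)" using s by (simp add: add_divide_distrib[symmetric])
  also have "\<dots> \<le> (a / (a + b)) powr \<alpha> + (b / (a + b)) powr \<alpha>"
    using assms s by (intro add_mono *) auto
  also have "\<dots> = (a powr \<alpha> + b powr \<alpha>) / (a + b) powr \<alpha>"
    using assms s by (simp add: powr_divide add_divide_distrib)
  finally show ?thesis using s by (simp add: field_simps)
qed (use assms in simp)

lemma norm_powr_diff_le:
  fixes x y :: "'a :: real_normed_vector"
  assumes "0 < \<alpha>" "\<alpha> \<le> 1"
  shows "\<bar>norm x powr \<alpha> - norm y powr \<alpha>\<bar> \<le> norm (x - y) powr \<alpha>"
proof -
  have *: "norm x powr \<alpha> \<le> norm y powr \<alpha> + norm (x - y) powr \<alpha>" for x y :: 'a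
  proof -
    have "norm x powr \<alpha> \<le> (norm y + norm (x - y)) powr \<alpha>"
      using norm_triangle_ineq[of y "x - y"] assms by (intro powr_mono2) auto
    also have "\<dots> \<le> norm y powr \<alpha> + norm (x - y) powr \<alpha>"
      using assms by (intro powr_subadditive) auto
    finally show ?thesis .
  qed
  show ?thesis using *[of x y] *[of y x] by (simp add: abs_le_iff norm_minus_commute)
qed

text \<open>The origin is left out because functions of finite \<open>ring_holder_norm\<close> need not be continuous there.\<close>

definition scale_holder :: "real \<Rightarrow> real \<Rightarrow> (real^2 \<Rightarrow> real) \<Rightarrow> bool" where
  "scale_holder \<gamma> A f \<longleftrightarrow> (\<forall>x y. x \<noteq> 0 \<longrightarrow> y \<noteq> 0 \<longrightarrow>
     \<bar>f x - f y\<bar> \<le> A * (norm (x - y) / max (norm x) (norm y)) powr \<gamma>)"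

lemma AE_nonzero: "AE x in lebesgue. x \<noteq> (0 :: real^2)"
  by (rule AE_I[where N="{0}"]) auto

lemma Linfty_norm_nonneg: "Linfty_norm f \<ge> 0"
proof (cases "f \<in> borel_measurable lebesgue")
  case True
  have "esssup lebesgue (\<lambda>x::real^2. 0 :: ereal) \<le> esssup lebesgue (\<lambda>x. ereal (norm (f x)))"
    by (rule esssup_mono) auto
  moreover have "esssup lebesgue (\<lambda>x::real^2. 0 :: ereal) = 0"
    by (rule esssup_const) simp
  ultimately show ?thesis using True by (simp add: Linfty_norm_def)
qed (simp add: Linfty_norm_def)

lemma ring_holder_norm_finite:
  assumes "ring_holder_norm \<alpha> f < \<infinity>"
  defines "N \<equiv> real_of_ereal (ring_holder_norm \<alpha> f)"
  shows "N \<ge> 0" "AE x in lebesgue. \<bar>f x\<bar> \<le> N"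
    "\<bar>norm x powr \<alpha> * f x - norm y powr \<alpha> * f y\<bar> \<le> N * norm (x - y) powr \<alpha>"
proof -
  let ?q = "\<lambda>x x'. \<bar>norm x powr \<alpha> * f x - norm x' powr \<alpha> * f x'\<bar> / norm (x - x') powr \<alpha>"
  define S where "S = (SUP (x, x') \<in> {(x, x'). x \<noteq> x'}. ereal (?q x x'))"
  have le_S: "ereal (?q x x') \<le> S" if "x \<noteq> x'" for x x'
    unfolding S_def using that by (intro SUP_upper2[of "(x, x')"]) auto
  have "0 \<le> ereal (?q 0 (axis 1 1))" by simp
  also have "\<dots> \<le> S" by (rule le_S) (simp add: vec_eq_iff axis_def)
  finally have S: "S \<ge> 0" .
  have sum: "ring_holder_norm \<alpha> f = Linfty_norm f + S" by (simp add: ring_holder_norm_def S_def)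
  have fin: "Linfty_norm f \<noteq> \<infinity>" "S \<noteq> \<infinity>"
    using assms(1) S Linfty_norm_nonneg[of f] unfolding sum by auto
  obtain a b where ab: "Linfty_norm f = ereal a" "S = ereal b" "a \<ge> 0" "b \<ge> 0"
    using fin S Linfty_norm_nonneg[of f] by (cases "Linfty_norm f"; cases S) auto
  have N: "N = a + b" by (simp add: N_def sum ab)
  show "N \<ge> 0" using ab N by simp
  have "f \<in> borel_measurable lebesgue" using fin(1) by (auto simp: Linfty_norm_def split: if_splits)
  then have "esssup lebesgue (\<lambda>x. ereal (norm (f x))) = ereal a" using ab(1) by (simp add: Linfty_norm_def)
  then have "AE x in lebesgue. ereal (norm (f x)) \<le> ereal a"
    using esssup_AE[of "\<lambda>x. ereal (norm (f x))" lebesgue] by simp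
  then show "AE x in lebesgue. \<bar>f x\<bar> \<le> N"
    by eventually_elim (use ab N in simp)
  show "\<bar>norm x powr \<alpha> * f x - norm y powr \<alpha> * f y\<bar> \<le> N * norm (x - y) powr \<alpha>"
  proof (cases "x = y")
    case False
    then have "?q x y \<le> N" using le_S[OF False] ab N by simp
    then show ?thesis using False by (simp add: field_simps)
  qed simp
qed

text \<open>The flow transports point values, so the essential bound has to hold at every nonzero
  point. The ball of radius |x| about x is not negligible and thus contains a point w where the
  bound holds; the Hoelder quotient carries it from w to x. Here 3 = 2 + 1, the 2 coming from |w|
  \<le> 2|x|.\<close>

lemma ring_holder_norm_pointwise_le:
  assumes "ring_holder_norm \<alpha> f < \<infinity>" "0 < \<alpha>" "\<alpha> \<le> 1" "x \<noteq> 0"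
  shows "\<bar>f x\<bar> \<le> 3 * real_of_ereal (ring_holder_norm \<alpha> f)"
proof -
  note N = ring_holder_norm_finite[OF assms(1)]
  let ?N = "real_of_ereal (ring_holder_norm \<alpha> f)"
  obtain Z where Z0: "{x \<in> space lebesgue. \<not> \<bar>f x\<bar> \<le> ?N} \<subseteq> Z" "emeasure lebesgue Z = 0"
      "Z \<in> sets lebesgue"
    by (rule AE_E[OF N(2)])
  note Z = Z0(1) null_setsI[OF Z0(2,3)]
  have "\<not> ball x (norm x) \<subseteq> Z"
  proof
    assume "ball x (norm x) \<subseteq> Z"
    then have "negligible (ball x (norm x))"
      using Z(2) negligible_iff_null_sets negligible_subset by blast
    then show False using open_not_negligible[of "ball x (norm x)"] assms(4) by auto
  qed
  then obtain w where "w \<in> ball x (norm x)" "w \<notin> Z" by blast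
  then have w: "norm (w - x) \<le> norm x" "\<bar>f w\<bar> \<le> ?N"
    using Z(1) by (auto simp: dist_norm norm_minus_commute)
  have "norm w \<le> 2 * norm x" using norm_triangle_ineq[of "w - x" x] w(1) by simp
  then have "norm w powr \<alpha> \<le> (2 * norm x) powr \<alpha>" using assms by (intro powr_mono2) auto
  also have "\<dots> = 2 powr \<alpha> * norm x powr \<alpha>" by (rule powr_mult)
  also have "\<dots> \<le> 2 powr 1 * norm x powr \<alpha>" using assms by (intro mult_right_mono powr_mono) auto
  finally have 1: "norm w powr \<alpha> \<le> 2 * norm x powr \<alpha>" by simp
  have "norm (x - w) powr \<alpha> \<le> norm x powr \<alpha>"
    using w(1) assms by (intro powr_mono2) (auto simp: norm_minus_commute)
  then have "?N * norm (x - w) powr \<alpha> \<le> ?N * norm x powr \<alpha>" using N(1) by (intro mult_left_mono)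
  with N(3)[of x w] have "\<bar>norm x powr \<alpha> * f x\<bar> \<le> \<bar>norm w powr \<alpha> * f w\<bar> + ?N * norm x powr \<alpha>"
    by linarith
  moreover have "\<bar>norm w powr \<alpha> * f w\<bar> \<le> (2 * norm x powr \<alpha>) * ?N"
    unfolding abs_mult using 1 w(2) by (intro mult_mono) auto
  ultimately have "\<bar>norm x powr \<alpha> * f x\<bar> \<le> (2 * norm x powr \<alpha>) * ?N + ?N * norm x powr \<alpha>"
    by linarith
  also have "\<dots> = norm x powr \<alpha> * (3 * ?N)" by simp
  finally have "\<bar>norm x powr \<alpha> * f x\<bar> \<le> norm x powr \<alpha> * (3 * ?N)" .
  then have "norm x powr \<alpha> * \<bar>f x\<bar> \<le> norm x powr \<alpha> * (3 * ?N)"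
    by (simp add: abs_mult)
  then show ?thesis using assms(4) by simp
qed

text \<open>The difference f(x) - f(y) is weighted with the power of the norm of the point farther
  from the origin; replacing that weight on f(y) by the weight of y costs the pointwise bound 3N,
  whence 4 = 1 + 3.\<close>

lemma ring_holder_norm_imp_scale_holder:
  assumes "ring_holder_norm \<alpha> f < \<infinity>" "0 < \<alpha>" "\<alpha> \<le> 1"
  shows "scale_holder \<alpha> (4 * real_of_ereal (ring_holder_norm \<alpha> f)) f"
proof -
  note N = ring_holder_norm_finite[OF assms(1)]
  let ?N = "real_of_ereal (ring_holder_norm \<alpha> f)"
  have *: "\<bar>f x - f y\<bar> \<le> 4 * ?N * (norm (x - y) / max (norm x) (norm y)) powr \<alpha>"
    if "x \<noteq> 0" "y \<noteq> 0" "norm y \<le> norm x" for x y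
  proof -
    have "norm x powr \<alpha> * (f x - f y) = (norm x powr \<alpha> * f x - norm y powr \<alpha> * f y)
        - (norm x powr \<alpha> - norm y powr \<alpha>) * f y" by (simp add: algebra_simps)
    moreover have "\<bar>(norm x powr \<alpha> - norm y powr \<alpha>) * f y\<bar> \<le> norm (x - y) powr \<alpha> * (3 * ?N)"
      unfolding abs_mult
      using norm_powr_diff_le[OF assms(2,3)] ring_holder_norm_pointwise_le[OF assms that(2)]
      by (intro mult_mono) auto
    ultimately have "\<bar>norm x powr \<alpha> * (f x - f y)\<bar> \<le> ?N * norm (x - y) powr \<alpha> + norm (x - y) powr \<alpha> * (3 * ?N)"
      using N(3)[of x y] by linarith
    also have "\<dots> = 4 * ?N * norm (x - y) powr \<alpha>" by simp
    finally have "norm x powr \<alpha> * \<bar>f x - f y\<bar> \<le> 4 * ?N * norm (x - y) powr \<alpha>"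
      by (simp add: abs_mult)
    then show ?thesis
      using that by (simp add: max_def powr_divide field_simps)
  qed
  show ?thesis
    unfolding scale_holder_def
  proof (intro allI impI)
    fix x y :: "real^2" assume xy: "x \<noteq> 0" "y \<noteq> 0"
    show "\<bar>f x - f y\<bar> \<le> 4 * ?N * (norm (x - y) / max (norm x) (norm y)) powr \<alpha>"
    proof (cases "norm y \<le> norm x")
      case False
      then show ?thesis
        using *[of y x] xy by (simp add: norm_minus_commute max.commute abs_minus_commute)
    qed (use * xy in blast)
  qed
qed

lemma scale_holder_imp_ring_holder_norm_le:
  assumes "scale_holder \<alpha> A f" "\<And>x. x \<noteq> 0 \<Longrightarrow> \<bar>f x\<bar> \<le> P" "A \<ge> 0" "P \<ge> 0"
    and "f \<in> borel_measurable lebesgue" "0 < \<alpha>" "\<alpha> \<le> 1"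
  shows "ring_holder_norm \<alpha> f \<le> ereal (P + (A + P))"
proof -
  have *: "\<bar>norm x powr \<alpha> * f x - norm y powr \<alpha> * f y\<bar> \<le> (A + P) * norm (x - y) powr \<alpha>"
    if "norm y \<le> norm x" "x \<noteq> 0" for x y
  proof (cases "y = 0")
    \<comment> \<open>Since \<open>0 powr \<alpha> = 0\<close>, the weighted term at the origin
      vanishes whatever the value of \<open>f\<close> there, on which the hypotheses are
      silent.\<close>
    case True
    have "norm x powr \<alpha> * \<bar>f x\<bar> \<le> norm x powr \<alpha> * (A + P)"
      using assms(2)[OF that(2)] assms(3) by (intro mult_left_mono) auto
    with True show ?thesis using assms(6) by (simp add: abs_mult mult.commute)
  next
    case False
    have "\<bar>f x - f y\<bar> \<le> A * (norm (x - y) / norm x) powr \<alpha>"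
    proof -
      have "max (norm x) (norm y) = norm x" using that by simp
      then show ?thesis using assms(1) that False unfolding scale_holder_def by metis
    qed
    then have "norm x powr \<alpha> * \<bar>f x - f y\<bar> \<le> norm x powr \<alpha> * (A * (norm (x - y) / norm x) powr \<alpha>)"
      by (intro mult_left_mono) auto
    also have "\<dots> = A * norm (x - y) powr \<alpha>" using that by (simp add: powr_divide)
    finally have 1: "\<bar>norm x powr \<alpha> * (f x - f y)\<bar> \<le> A * norm (x - y) powr \<alpha>" by (simp add: abs_mult)
    have 2: "\<bar>(norm x powr \<alpha> - norm y powr \<alpha>) * f y\<bar> \<le> norm (x - y) powr \<alpha> * P"
      unfolding abs_mult using norm_powr_diff_le[OF assms(6,7)] assms(2)[OF False]
      by (intro mult_mono) auto
    have "norm x powr \<alpha> * f x - norm y powr \<alpha> * f y =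
        norm x powr \<alpha> * (f x - f y) + (norm x powr \<alpha> - norm y powr \<alpha>) * f y"
      by (simp add: algebra_simps)
    then have "\<bar>norm x powr \<alpha> * f x - norm y powr \<alpha> * f y\<bar> \<le> A * norm (x - y) powr \<alpha> + norm (x - y) powr \<alpha> * P"
      using 1 2 by linarith
    then show ?thesis by (simp add: algebra_simps)
  qed
  have q: "\<bar>norm x powr \<alpha> * f x - norm y powr \<alpha> * f y\<bar> / norm (x - y) powr \<alpha> \<le> A + P" if "x \<noteq> y" for x y
  proof -
    have "\<bar>norm x powr \<alpha> * f x - norm y powr \<alpha> * f y\<bar> \<le> (A + P) * norm (x - y) powr \<alpha>"
    proof (cases "norm y \<le> norm x")
      case True
      then show ?thesis using that by (intro *) auto
    next
      case False
      then have "y \<noteq> 0" "norm x \<le> norm y" by auto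
      then show ?thesis using *[of x y] by (simp add: norm_minus_commute abs_minus_commute)
    qed
    then show ?thesis using that by (simp add: field_simps)
  qed
  have "(SUP (x, x') \<in> {(x, x'). x \<noteq> x'}.
      ereal (\<bar>norm x powr \<alpha> * f x - norm x' powr \<alpha> * f x'\<bar> / norm (x - x') powr \<alpha>)) \<le> ereal (A + P)"
    by (rule SUP_least) (use q in auto)
  moreover have "Linfty_norm f \<le> ereal P"
    unfolding Linfty_norm_def using assms(5) AE_nonzero
    by (auto intro!: esssup_I elim!: eventually_mono simp: assms(2))
  ultimately have "ring_holder_norm \<alpha> f \<le> ereal P + ereal (A + P)"
    unfolding ring_holder_norm_def by (intro add_mono) auto
  then show ?thesis by simp
qed

lemma scale_holder_AE:
  assumes "scale_holder \<gamma> A f" "A \<ge> 0" "0 < \<gamma>" "x \<noteq> 0"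
  shows "AE w in lebesgue. \<bar>f w - f x\<bar> \<le> A * (norm (w - x) / norm x) powr \<gamma>"
  using AE_nonzero
proof eventually_elim
  case (elim w)
  have "\<bar>f w - f x\<bar> \<le> A * (norm (w - x) / max (norm w) (norm x)) powr \<gamma>"
    using assms(1,4) elim unfolding scale_holder_def by blast
  also have "\<dots> \<le> A * (norm (w - x) / norm x) powr \<gamma>"
  proof (intro mult_left_mono powr_mono2)
    have m: "max (norm w) (norm x) > 0" using assms(4) by (simp add: less_max_iff_disj)
    then show "0 \<le> norm (w - x) / max (norm w) (norm x)" by (intro divide_nonneg_pos) auto
    show "norm (w - x) / max (norm w) (norm x) \<le> norm (w - x) / norm x"
      using m assms(4) by (intro divide_left_mono mult_pos_pos) auto
  qed (use assms(2,3) in auto)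
  finally show ?case .
qed

section \<open>Transport of the vorticity\<close>

locale euler_flow =
  fixes \<alpha> C N :: real and m :: nat and \<omega>0 and \<omega> :: "real \<Rightarrow> real^2 \<Rightarrow> real"
    and u :: "real \<Rightarrow> real^2 \<Rightarrow> real^2" and \<Phi> :: "real \<Rightarrow> real^2 \<Rightarrow> real^2"
  assumes \<alpha>: "0 < \<alpha>" "\<alpha> \<le> 1" and C: "C > 0" "velocity_bound m C"
    and fin: "ring_holder_norm \<alpha> \<omega>0 < \<infinity>" and N: "N = real_of_ereal (ring_holder_norm \<alpha> \<omega>0)"
    and vel: "\<And>t. t \<ge> 0 \<Longrightarrow> is_velocity m (\<omega> t) (u t)"
    and flow: "flow_map u \<Phi>" and trans: "\<And>t x. t \<ge> 0 \<Longrightarrow> \<omega> t x = \<omega>0 (inv (\<Phi> t) x)"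
begin

lemma N_nonneg: "N \<ge> 0"
  using ring_holder_norm_finite(1)[OF fin] N by simp

lemma bij: "t \<ge> 0 \<Longrightarrow> bij (\<Phi> t)" and \<Phi>0: "\<Phi> 0 x = x"
  and \<Phi>_deriv: "t \<ge> 0 \<Longrightarrow> ((\<lambda>s. \<Phi> s x) has_vector_derivative u t (\<Phi> t x)) (at t within {0..})"
  using flow by (auto simp: flow_map_def)

lemma transported: "t \<ge> 0 \<Longrightarrow> \<omega> t (\<Phi> t x) = \<omega>0 x"
  using trans bij by (simp add: bij_is_inj)

lemma \<omega>0_le: "x \<noteq> 0 \<Longrightarrow> \<bar>\<omega>0 x\<bar> \<le> 3 * N"
  using ring_holder_norm_pointwise_le[OF fin \<alpha>] N by simp

lemma measurable_vorticity: "t \<ge> 0 \<Longrightarrow> \<omega> t \<in> borel_measurable lebesgue"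
  using vel[of t] unfolding is_velocity_def Linfty_norm_def by (auto split: if_splits)

lemma data:
  assumes "t \<ge> 0"
  shows "velocity_data m (u t) (\<omega> t) (3 * N)"
  unfolding velocity_data_def
proof (intro conjI vel measurable_vorticity assms)
  have "AE x in lebesgue. x \<noteq> \<Phi> t 0"
    by (rule AE_I[where N="{\<Phi> t 0}"]) auto
  then show "AE x in lebesgue. \<bar>\<omega> t x\<bar> \<le> 3 * N"
  proof eventually_elim
    case (elim x)
    obtain y where "x = \<Phi> t y" using bij[OF assms] by (metis bij_pointE)
    with elim show ?case using transported[OF assms, of y] \<omega>0_le[of y] by auto
  qed
qed (use N_nonneg in simp)

definition V :: real where "V = C * (3 * N)"

lemma V_nonneg: "V \<ge> 0"
  using C N_nonneg by (simp add: V_def)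

lemma velocity_le: "t \<ge> 0 \<Longrightarrow> norm (u t z) \<le> V * norm z"
  using C(2) data unfolding velocity_bound_def V_def by blast

lemma velocity_log_le:
  "t \<ge> 0 \<Longrightarrow> x \<noteq> y \<Longrightarrow> norm x \<le> X \<Longrightarrow> norm y \<le> X \<Longrightarrow>
    norm (u t x - u t y) \<le> V * norm (x - y) * (1 + ln (2 * X / norm (x - y)))"
  using C(2) data unfolding velocity_bound_def V_def by blast

lemma \<Phi>_le: "t \<ge> 0 \<Longrightarrow> norm (\<Phi> t x) \<le> exp (V * t) * norm x"
  using growth_bounds(1)[of t "\<lambda>s. \<Phi> s x" "\<lambda>s. u s (\<Phi> s x)" V] \<Phi>_deriv velocity_le \<Phi>0 by auto

lemma \<Phi>_zero: "t \<ge> 0 \<Longrightarrow> \<Phi> t 0 = 0"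
  using \<Phi>_le[of t 0] by simp

lemma \<Phi>_surj:
  assumes "t \<ge> 0" "X \<noteq> 0"
  obtains x where "X = \<Phi> t x" "x \<noteq> 0"
  using bij[OF assms(1)] \<Phi>_zero[OF assms(1)] assms(2) by (metis bij_pointE)

lemma \<Phi>_inj: "t \<ge> 0 \<Longrightarrow> x \<noteq> y \<Longrightarrow> \<Phi> t x \<noteq> \<Phi> t y"
  using bij by (meson bij_is_inj injD)

lemma vorticity_le: "t \<ge> 0 \<Longrightarrow> x \<noteq> 0 \<Longrightarrow> \<bar>\<omega> t x\<bar> \<le> 3 * N"
  using \<Phi>_surj[of t x] transported \<omega>0_le by metis

lemma vorticity_diff_le:
  assumes "t \<ge> 0" "x \<noteq> 0" "y \<noteq> 0" "norm (x - y) / max (norm x) (norm y) \<le> F"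
  shows "\<bar>\<omega> t (\<Phi> t x) - \<omega> t (\<Phi> t y)\<bar> \<le> 4 * N * F powr \<alpha>"
proof -
  have "\<bar>\<omega>0 x - \<omega>0 y\<bar> \<le> 4 * N * (norm (x - y) / max (norm x) (norm y)) powr \<alpha>"
    using ring_holder_norm_imp_scale_holder[OF fin \<alpha>] assms(2,3) unfolding scale_holder_def N by blast
  also have "\<dots> \<le> 4 * N * F powr \<alpha>"
    using assms(4) \<alpha> N_nonneg by (intro mult_left_mono powr_mono2) (auto simp: max_def)
  finally show ?thesis using transported[OF assms(1)] by simp
qed

lemma max_\<Phi>_le: "t \<ge> 0 \<Longrightarrow> max (norm (\<Phi> t x)) (norm (\<Phi> t y)) \<le> max (norm x) (norm y) * exp (V * t)"
  using \<Phi>_le[of t x] \<Phi>_le[of t y]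
    mult_right_mono[of "norm x" "max (norm x) (norm y)" "exp (V * t)"]
    mult_right_mono[of "norm y" "max (norm x) (norm y)" "exp (V * t)"]
  by (auto simp: mult.commute intro: order_trans)

text \<open>The exponent that \<open>osgood_bound\<close> gives for the Hoelder continuity of the
  inverse flow.\<close>

definition \<beta> :: "real \<Rightarrow> real" where "\<beta> t = exp (- (5 * V * t))"

lemma \<beta>: "t \<ge> 0 \<Longrightarrow> 0 < \<beta> t" "t \<ge> 0 \<Longrightarrow> \<beta> t \<le> 1"
  using V_nonneg by (auto simp: \<beta>_def)

text \<open>Osgood's argument along the difference of two trajectories, both of which stay in the
  growing ball of radius X exp(V s).\<close>

lemma separation_le:
  assumes t: "t \<ge> 0" and "x \<noteq> y"
  defines "X \<equiv> max (norm x) (norm y)"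
  shows "norm (x - y) \<le> 4 * X * (norm (\<Phi> t x - \<Phi> t y) / (4 * (X * exp (V * t)))) powr \<beta> t"
proof -
  have X: "X > 0" using assms(2) by (auto simp: X_def less_max_iff_disj)
  have b: "norm (\<Phi> s x) \<le> X * exp (V * s)" "norm (\<Phi> s y) \<le> X * exp (V * s)" if "s \<ge> 0" for s
    using max_\<Phi>_le[OF that, of x y] by (auto simp: X_def)
  have "norm (\<Phi> 0 x - \<Phi> 0 y) \<le> 4 * X * (norm (\<Phi> t x - \<Phi> t y) / (4 * (X * exp (V * t)))) powr exp (- (5 * V * t))"
  proof (rule osgood_bound[where a'="\<lambda>s. u s (\<Phi> s x) - u s (\<Phi> s y)", OF _ _ _ _ t X V_nonneg])
    fix s :: real assume s: "0 \<le> s" "s \<le> t"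
    show "((\<lambda>s. \<Phi> s x - \<Phi> s y) has_vector_derivative u s (\<Phi> s x) - u s (\<Phi> s y)) (at s within {0..})"
      by (intro has_vector_derivative_diff \<Phi>_deriv s)
    show "\<Phi> s x - \<Phi> s y \<noteq> 0" using \<Phi>_inj[OF s(1) assms(2)] by simp
    show "norm (u s (\<Phi> s x) - u s (\<Phi> s y)) \<le> V * norm (\<Phi> s x - \<Phi> s y) *
        (1 + ln (2 * (X * exp (V * s)) / norm (\<Phi> s x - \<Phi> s y)))"
      by (intro velocity_log_le \<Phi>_inj s assms b)
    show "norm (\<Phi> s x - \<Phi> s y) \<le> 2 * (X * exp (V * s))"
      using norm_triangle_ineq4[of "\<Phi> s x" "\<Phi> s y"] b[OF s(1)] by linarith
  qed
  then show ?thesis by (simp add: \<Phi>0 \<beta>_def)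
qed

text \<open>Only the exponent deteriorates, not the constant: by \<open>separation_le\<close> the
  relative distance of the starting points is at most 4 R^\<beta>, with R the relative distance of
  the end points, since the factor exp(V t) in the denominator absorbs the growth of the
  trajectories. The initial constant 4N is multiplied by 4^\<alpha> \<le> 4.\<close>

lemma vorticity_scale_holder:
  assumes t: "t \<ge> 0"
  shows "scale_holder (\<alpha> * \<beta> t) (16 * N) (\<omega> t)"
  unfolding scale_holder_def
proof (intro allI impI)
  fix X Y :: "real^2" assume "X \<noteq> 0" "Y \<noteq> 0"
  obtain x where x: "X = \<Phi> t x" "x \<noteq> 0" using \<Phi>_surj[OF t \<open>X \<noteq> 0\<close>] .
  obtain y where y: "Y = \<Phi> t y" "y \<noteq> 0" using \<Phi>_surj[OF t \<open>Y \<noteq> 0\<close>] .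
  define R where "R = norm (X - Y) / max (norm X) (norm Y)"
  define M where "M = max (norm x) (norm y)"
  have M: "M > 0" using x(2) by (auto simp: M_def less_max_iff_disj)
  have mX: "max (norm X) (norm Y) > 0" using \<open>X \<noteq> 0\<close> by (auto simp: less_max_iff_disj)
  have R: "R \<ge> 0" unfolding R_def using mX by (intro divide_nonneg_pos) auto
  have "norm (x - y) / M \<le> 4 * R powr \<beta> t"
  proof (cases "x = y")
    case False
    have "norm (x - y) \<le> 4 * M * (norm (X - Y) / (4 * (M * exp (V * t)))) powr \<beta> t"
      using separation_le[OF t False] by (simp add: M_def x(1) y(1))
    also have "\<dots> \<le> 4 * M * R powr \<beta> t"
    proof (intro mult_left_mono powr_mono2)
      have "max (norm X) (norm Y) \<le> M * exp (V * t)"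
        using max_\<Phi>_le[OF t, of x y] by (simp add: M_def x(1) y(1))
      also have "\<dots> \<le> 4 * (M * exp (V * t))" using M by simp
      finally show "norm (X - Y) / (4 * (M * exp (V * t))) \<le> R"
        unfolding R_def using mX M by (intro divide_left_mono) (auto intro!: mult_pos_pos)
    qed (use M \<beta>(1)[OF t] in auto)
    finally show ?thesis using M by (simp add: field_simps)
  qed simp
  from vorticity_diff_le[OF t x(2) y(2) this[unfolded M_def]]
  have "\<bar>\<omega> t X - \<omega> t Y\<bar> \<le> 4 * N * (4 * R powr \<beta> t) powr \<alpha>" by (simp add: x(1) y(1))
  also have "(4 * R powr \<beta> t) powr \<alpha> = 4 powr \<alpha> * R powr (\<alpha> * \<beta> t)"
    by (simp add: powr_mult powr_powr mult.commute)
  also have "4 * N * (4 powr \<alpha> * R powr (\<alpha> * \<beta> t)) \<le> 4 * N * (4 powr 1 * R powr (\<alpha> * \<beta> t))"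
    using \<alpha> N_nonneg by (intro mult_left_mono mult_right_mono powr_mono) auto
  finally show "\<bar>\<omega> t X - \<omega> t Y\<bar> \<le> 16 * N * (norm (X - Y) / max (norm X) (norm Y)) powr (\<alpha> * \<beta> t)"
    by (simp add: R_def)
qed

text \<open>The Lipschitz constant of the velocity at time 0. At time t the exponent is \<gamma> =
  \<alpha> exp(-5Vt), and 3N + 16N/\<gamma> \<le> 19N/\<gamma> = (19N/\<alpha>) exp(5Vt).\<close>

definition Q :: real where "Q = 19 * C * N / \<alpha>"

lemma Q_nonneg: "Q \<ge> 0"
  using C \<alpha> N_nonneg by (simp add: Q_def)

lemma velocity_regular:
  assumes t: "t \<ge> 0"
  shows "norm (u t x - u t y) \<le> Q * exp (5 * V * t) * norm (x - y)"
    and "x \<noteq> 0 \<Longrightarrow> convergent (\<lambda>n. (u t (x + axis j (1 / 2 ^ n)) $ i - u t x $ i) * 2 ^ n)"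
proof -
  define \<gamma> where "\<gamma> = \<alpha> * \<beta> t"
  have \<gamma>: "0 < \<gamma>" "\<gamma> \<le> 1" using \<alpha> \<beta>[OF t] by (simp_all add: \<gamma>_def mult_le_one)
  have A: "16 * N \<ge> 0" using N_nonneg by simp
  have H: "\<forall>x. x \<noteq> 0 \<longrightarrow> (AE w in lebesgue. \<bar>\<omega> t w - \<omega> t x\<bar> \<le> 16 * N * (norm (w - x) / norm x) powr \<gamma>)"
    using scale_holder_AE[OF vorticity_scale_holder[OF t] A] \<gamma>(1) by (simp add: \<gamma>_def)
  from C(2) data[OF t] \<gamma> A H
  have lip: "norm (u t x - u t y) \<le> C * (3 * N + 16 * N / \<gamma>) * norm (x - y)"
    and conv: "x \<noteq> 0 \<Longrightarrow> convergent (\<lambda>n. (u t (x + axis j (1 / 2 ^ n)) $ i - u t x $ i) * 2 ^ n)"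
    unfolding velocity_bound_def by blast+
  show "x \<noteq> 0 \<Longrightarrow> convergent (\<lambda>n. (u t (x + axis j (1 / 2 ^ n)) $ i - u t x $ i) * 2 ^ n)"
    by (rule conv)
  have "C * (3 * N + 16 * N / \<gamma>) \<le> C * (19 * N / \<gamma>)"
  proof (rule mult_left_mono)
    have "3 * N * \<gamma> \<le> 3 * N * 1" using \<gamma> N_nonneg by (intro mult_left_mono) auto
    then have "3 * N \<le> 3 * N / \<gamma>" using \<gamma> by (simp add: field_simps)
    then show "3 * N + 16 * N / \<gamma> \<le> 19 * N / \<gamma>" by simp
  qed (use C in simp)
  also have "\<dots> = Q * exp (5 * V * t)"
    by (simp add: Q_def \<gamma>_def \<beta>_def exp_minus divide_inverse)
  finally have "C * (3 * N + 16 * N / \<gamma>) * norm (x - y) \<le> Q * exp (5 * V * t) * norm (x - y)"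
    by (intro mult_right_mono) auto
  with lip show "norm (u t x - u t y) \<le> Q * exp (5 * V * t) * norm (x - y)" by linarith
qed

lemma weak_gradient_bound:
  assumes "t \<ge> 0"
  shows "\<exists>G. weak_gradient (u t) G \<and> Linfty_norm G \<le> ereal (4 * (Q * exp (5 * V * t)))"
  by (rule weak_gradient_exists) (use velocity_regular[OF assms] Q_nonneg in auto)

text \<open>The Lipschitz constant at the final time dominates those at earlier times, so the
  backward Gronwall estimate applies with a single constant on the whole interval.\<close>

lemma separation_le_lipschitz:
  assumes t: "t \<ge> 0"
  shows "norm (x - y) \<le> exp (Q * exp (5 * V * t) * t) * norm (\<Phi> t x - \<Phi> t y)"
proof -
  have "norm (\<Phi> 0 x - \<Phi> 0 y) \<le> exp (Q * exp (5 * V * t) * t) * norm (\<Phi> t x - \<Phi> t y)"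
  proof (rule growth_bounds(2)[where a'="\<lambda>s. u s (\<Phi> s x) - u s (\<Phi> s y)", OF _ _ t])
    fix s :: real assume s: "0 \<le> s" "s \<le> t"
    show "((\<lambda>s. \<Phi> s x - \<Phi> s y) has_vector_derivative u s (\<Phi> s x) - u s (\<Phi> s y)) (at s within {0..})"
      by (intro has_vector_derivative_diff \<Phi>_deriv s)
    have "Q * exp (5 * V * s) * norm (\<Phi> s x - \<Phi> s y) \<le> Q * exp (5 * V * t) * norm (\<Phi> s x - \<Phi> s y)"
      using s Q_nonneg V_nonneg by (intro mult_right_mono mult_left_mono) (auto intro: mult_left_mono)
    with velocity_regular(1)[OF s(1)]
    show "norm (u s (\<Phi> s x) - u s (\<Phi> s y)) \<le> Q * exp (5 * V * t) * norm (\<Phi> s x - \<Phi> s y)"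
      using order_trans by blast
  qed
  then show ?thesis by (simp add: \<Phi>0)
qed

text \<open>Lipschitz instead of Hoelder control of the inverse flow restores the exponent \<alpha>.
  In the exponential, Q exp(5Vt) measures the approach of trajectories and V the change in size of
  the points by which distances are divided. The 6N is the pointwise bound 3N counted twice by
  \<open>scale_holder_imp_ring_holder_norm_le\<close>.\<close>

lemma ring_holder_norm_le:
  assumes t: "t \<ge> 0"
  shows "ring_holder_norm \<alpha> (\<omega> t) \<le> ereal (6 * N + 4 * N * exp ((Q * exp (5 * V * t) + V) * t))"
proof -
  define L where "L = (Q * exp (5 * V * t) + V) * t"
  have L: "L \<ge> 0" using Q_nonneg V_nonneg t by (simp add: L_def)
  have "scale_holder \<alpha> (4 * N * exp L) (\<omega> t)"
    unfolding scale_holder_def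
  proof (intro allI impI)
    fix X Y :: "real^2" assume "X \<noteq> 0" "Y \<noteq> 0"
    obtain x where x: "X = \<Phi> t x" "x \<noteq> 0" using \<Phi>_surj[OF t \<open>X \<noteq> 0\<close>] .
    obtain y where y: "Y = \<Phi> t y" "y \<noteq> 0" using \<Phi>_surj[OF t \<open>Y \<noteq> 0\<close>] .
    define R where "R = norm (X - Y) / max (norm X) (norm Y)"
    define M where "M = max (norm x) (norm y)"
    have M: "M > 0" using x(2) by (auto simp: M_def less_max_iff_disj)
    have mX: "max (norm X) (norm Y) > 0" using \<open>X \<noteq> 0\<close> by (auto simp: less_max_iff_disj)
    have R: "R \<ge> 0" unfolding R_def using mX by (intro divide_nonneg_pos) auto
    have mXM: "max (norm X) (norm Y) \<le> M * exp (V * t)"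
      using max_\<Phi>_le[OF t, of x y] by (simp add: M_def x(1) y(1))
    have "norm (x - y) \<le> exp (Q * exp (5 * V * t) * t) * norm (X - Y)"
      using separation_le_lipschitz[OF t, of x y] by (simp add: x(1) y(1))
    also have "norm (X - Y) = R * max (norm X) (norm Y)" using mX by (simp add: R_def)
    also have "exp (Q * exp (5 * V * t) * t) * (R * max (norm X) (norm Y)) \<le>
        exp (Q * exp (5 * V * t) * t) * (R * (M * exp (V * t)))"
      using mXM R by (intro mult_left_mono) auto
    also have "\<dots> = exp L * R * M" by (simp add: L_def exp_add distrib_right)
    finally have "norm (x - y) / M \<le> exp L * R" using M by (simp add: field_simps)
    from vorticity_diff_le[OF t x(2) y(2) this[unfolded M_def]]
    have "\<bar>\<omega> t X - \<omega> t Y\<bar> \<le> 4 * N * (exp L * R) powr \<alpha>" by (simp add: x(1) y(1))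
    also have "(exp L * R) powr \<alpha> = exp (\<alpha> * L) * R powr \<alpha>"
      unfolding powr_mult by (simp add: powr_def)
    also have "4 * N * (exp (\<alpha> * L) * R powr \<alpha>) \<le> 4 * N * (exp L * R powr \<alpha>)"
      using \<alpha> L N_nonneg mult_right_mono[of \<alpha> 1 L] by (intro mult_left_mono mult_right_mono) auto
    finally show "\<bar>\<omega> t X - \<omega> t Y\<bar> \<le> 4 * N * exp L * (norm (X - Y) / max (norm X) (norm Y)) powr \<alpha>"
      by (simp add: R_def)
  qed
  from scale_holder_imp_ring_holder_norm_le[OF this vorticity_le[OF t] _ _ measurable_vorticity[OF t] \<alpha>]
  have "ring_holder_norm \<alpha> (\<omega> t) \<le> ereal (3 * N + (4 * N * exp L + 3 * N))"
    using N_nonneg by simp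
  then show ?thesis by (simp add: L_def add.commute add.left_commute)
qed

text \<open>The factor t in the exponent is bounded by exp t, which the extra 1 in K \<ge> 5V + 1
  absorbs into exp(K t). The condition K \<ge> 10 N combines 6N and 4N.\<close>

lemma double_exponential_bounds:
  fixes K :: real
  assumes K: "K \<ge> 10 * N" "K \<ge> 4 * Q" "K \<ge> Q + V" "K \<ge> 5 * V + 1" and t: "t \<ge> 0"
  shows "ring_holder_norm \<alpha> (\<omega> t) \<le> ereal (K * exp (K * exp (K * t)))"
    and "\<exists>G. weak_gradient (u t) G \<and> Linfty_norm G \<le> ereal (K * exp (K * t))"
proof -
  have e5: "exp (5 * V * t) * exp t \<le> exp (K * t)"
    using mult_right_mono[OF K(4) t] by (simp add: exp_add[symmetric] algebra_simps)
  have "exp (5 * V * t) * 1 \<le> exp (5 * V * t) * exp t" using t by (intro mult_left_mono) auto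
  with e5 have e1: "exp (5 * V * t) \<le> exp (K * t)" by linarith
  have K0: "K \<ge> 0" using K(1) N_nonneg by simp
  have "4 * (Q * exp (5 * V * t)) \<le> K * exp (K * t)"
    using mult_mono[OF K(2) e1] K0 by simp
  with weak_gradient_bound[OF t] show "\<exists>G. weak_gradient (u t) G \<and> Linfty_norm G \<le> ereal (K * exp (K * t))"
    by (meson ereal_less_eq(3) order_trans)
  have "(Q * exp (5 * V * t) + V) * t \<le> (Q * exp (5 * V * t) + V * exp (5 * V * t)) * exp t"
  proof (rule mult_mono)
    have "1 \<le> exp (5 * V * t)" using V_nonneg t by simp
    then have "V * 1 \<le> V * exp (5 * V * t)" using V_nonneg by (intro mult_left_mono)
    then show "Q * exp (5 * V * t) + V \<le> Q * exp (5 * V * t) + V * exp (5 * V * t)" by simp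
    show "t \<le> exp t" using exp_ge_add_one_self[of t] by linarith
  qed (use Q_nonneg V_nonneg t in auto)
  also have "\<dots> = (Q + V) * (exp (5 * V * t) * exp t)" by (simp add: algebra_simps)
  also have "\<dots> \<le> K * exp (K * t)" using K(3) e5 K0 by (intro mult_mono) auto
  finally have E: "exp ((Q * exp (5 * V * t) + V) * t) \<le> exp (K * exp (K * t))" by simp
  have "6 * N * 1 \<le> 6 * N * exp (K * exp (K * t))"
    using N_nonneg K0 by (intro mult_left_mono) auto
  moreover have "4 * N * exp ((Q * exp (5 * V * t) + V) * t) \<le> 4 * N * exp (K * exp (K * t))"
    using N_nonneg E by (intro mult_left_mono) auto
  moreover have "10 * N * exp (K * exp (K * t)) \<le> K * exp (K * exp (K * t))"
    using K(1) by (intro mult_right_mono) auto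
  ultimately have "6 * N + 4 * N * exp ((Q * exp (5 * V * t) + V) * t) \<le> K * exp (K * exp (K * t))"
    by linarith
  with ring_holder_norm_le[OF t] show "ring_holder_norm \<alpha> (\<omega> t) \<le> ereal (K * exp (K * exp (K * t)))"
    by (meson ereal_less_eq(3) order_trans)
qed

end

theorem theoremC:
  fixes \<alpha> :: real and m :: nat
  assumes "0 < \<alpha>" and "\<alpha> \<le> 1" and "m \<ge> 3"
  shows "\<exists>C :: real \<Rightarrow> real. (\<forall>N. C N > 0) \<and>
    (\<forall>(\<omega>0 :: real^2 \<Rightarrow> real) \<omega> u.
       ring_holder_norm \<alpha> \<omega>0 < \<infinity> \<longrightarrow> mfold_scalar m \<omega>0 \<longrightarrow> euler_solution m \<omega>0 \<omega> u \<longrightarrow>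
       (let K = C (real_of_ereal (ring_holder_norm \<alpha> \<omega>0)) in
        \<forall>t\<ge>0.
          ring_holder_norm \<alpha> (\<omega> t) \<le> ereal (K * exp (K * exp (K * t))) \<and>
          (\<exists>G. weak_gradient (u t) G \<and> Linfty_norm G \<le> ereal (K * exp (K * t)))))"
proof -
  obtain C where C: "C > 0" "velocity_bound m C"
    using velocity_bound_exists[OF assms(3)] by blast
  \<comment> \<open>The sum dominates the four lower bounds asked for by
    \<open>double_exponential_bounds\<close>. The absolute values and the 1 make it positive for
    every real argument. It is fixed before the data and sees them only through the norm.\<close>
  define K where "K N = 10 * \<bar>N\<bar> + 4 * (19 * C * \<bar>N\<bar> / \<alpha>) + 5 * (C * (3 * \<bar>N\<bar>)) + 1" for N
  have K_pos: "K N > 0" for N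
  proof -
    have "0 \<le> C * \<bar>N\<bar> / \<alpha>" "0 \<le> C * \<bar>N\<bar>" using C(1) assms(1) by simp_all
    then show ?thesis unfolding K_def by simp
  qed
  show ?thesis
  proof (intro exI[of _ K] conjI allI impI K_pos, unfold Let_def, intro allI impI)
    fix \<omega>0 :: "real^2 \<Rightarrow> real" and \<omega> u and t :: real
    assume fin: "ring_holder_norm \<alpha> \<omega>0 < \<infinity>" and sol: "euler_solution m \<omega>0 \<omega> u" and t: "t \<ge> 0"
    define N where "N = real_of_ereal (ring_holder_norm \<alpha> \<omega>0)"
    obtain \<Phi> where \<Phi>: "flow_map u \<Phi>" "\<And>t x. t \<ge> 0 \<Longrightarrow> \<omega> t x = \<omega>0 (inv (\<Phi> t) x)"
      and vel: "\<And>t. t \<ge> 0 \<Longrightarrow> is_velocity m (\<omega> t) (u t)"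
      using sol unfolding euler_solution_def by blast
    interpret euler_flow \<alpha> C N m \<omega>0 \<omega> u \<Phi>
      by unfold_locales (use assms C fin N_def vel \<Phi> in auto)
    have "K N \<ge> 10 * N" "K N \<ge> 4 * Q" "K N \<ge> Q + V" "K N \<ge> 5 * V + 1"
      using N_nonneg Q_nonneg V_nonneg by (simp_all add: K_def Q_def V_def)
    from double_exponential_bounds[OF this t]
    show "ring_holder_norm \<alpha> (\<omega> t) \<le> ereal (K (real_of_ereal (ring_holder_norm \<alpha> \<omega>0)) *
          exp (K (real_of_ereal (ring_holder_norm \<alpha> \<omega>0)) * exp (K (real_of_ereal (ring_holder_norm \<alpha> \<omega>0)) * t))) \<and>
        (\<exists>G. weak_gradient (u t) G \<and> Linfty_norm G \<le>
          ereal (K (real_of_ereal (ring_holder_norm \<alpha> \<omega>0)) * exp (K (real_of_ereal (ring_holder_norm \<alpha> \<omega>0)) * t)))"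
      unfolding N_def by blast
  qed
qed

end
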